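(* Let $\mathcal{H}$ be an infinite-dimensional real separable Hilbert space with orthonormal basis $\{e_1,e_2,\dots\}$, and let $S$ be a Gaussian Covariance Operator on $\mathcal{H}\oplus\mathcal{H}$. Denote the symplectic eigenvalues of $S$ that are greater than $1$, in non-increasing order and counted with multiplicity, by $d_1(S)\ge d_2(S)\ge\cdots\ge d_R(S)$, where $R\in\{0,1,2,\dots\}\cup\{\infty\}$ is their number. For $n\ge1$ let $d_1(S_{2n})\ge d_2(S_{2n})\ge\cdots\ge d_n(S_{2n})$ be the symplectic eigenvalues of the truncation $S_{2n}$, in non-increasing order. Then for every $k\ge1$, $$\lim_{n\to\infty}d_k(S_{2n})=\begin{cases}d_k(S), & \text{if } R=\infty,\text{ or if } R<\infty \text{ and } 1\le k\le R,\\ 1, & \text{if } R<\infty\text{ and }k\ge R+1.\end{cases}$$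
   Context: Operators are bounded and linear. For a real Hilbert space $\mathcal{K}$, $\hat{\mathcal{K}}=\mathcal{K}+i\mathcal{K}$ is its complexification, and for an operator $T$ on $\mathcal{K}$, $\hat T(x+iy)=Tx+iTy$ is the complexification of $T$. The spectrum of $T$ is the spectrum of $\hat T$. On $\mathcal{H}\oplus\mathcal{H}$ let $J=\begin{bmatrix}0&I\\-I&0\end{bmatrix}$. A bounded invertible operator $M$ on $\mathcal{H}\oplus\mathcal{H}$ is symplectic if $M^TJM=J$. A real linear, bounded, symmetric and invertible operator $S$ on $\mathcal{H}\oplus\mathcal{H}$ is a Gaussian Covariance Operator (GCO) if: (i) $\hat S-i\hat J\ge 0$; (ii) $S-I$ is Hilbert-Schmidt; (iii) $(\sqrt S J\sqrt S)^T(\sqrt SJ\sqrt S)-I$ is of trace class. (Condition (i) forces $S\geq 0$, so $\sqrt S$ makes sense.) Symplectic eigenvalues: for a strictly positive invertible operator $T$ on $\mathcal{H}\oplus\mathcal{H}$ (self-adjoint with spectrum in $(0,\infty)$; in particular for a GCO) there are a positive invertible operator $D$ on $\mathcal{H}$ and a symplectic $M$ with $T=M^T\begin{bmatrix}D&0\\0&D\end{bmatrix}M$, and $D$ is unique up to conjugation by an orthogonal transformation (infinite-dimensional Williamson normal form). The symplectic spectrum of $T$ is $\sigma(D)$, and the symplectic eigenvalues of $T$, with multiplicity, are the eigenvalues of $D$; for a GCO the symplectic spectrum is contained in $[1,\infty)$. For a strictly positive definite real $2n\times2n$ matrix the same holds with $D$ a positive diagonal $n\times n$ matrix, unique up to the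 order of its entries, whose $n$ diagonal entries (with multiplicity) are the symplectic eigenvalues of the matrix. Truncation: $P_{2n}$ is the orthogonal projection of $\mathcal{H}\oplus\mathcal{H}$ onto $\operatorname{span}\{(e_1,0),\dots,(e_n,0),(0,e_1),\dots,(0,e_n)\}$, and $S_{2n}$ is the restriction of $P_{2n}SP_{2n}$ to this subspace, regarded as a $2n\times2n$ real matrix in this ordered basis. *)

theory Defs
  imports
    "HOL-Analysis.Analysis"
    "HOL-Library.Extended_Nat"
    "Jordan_Normal_Form.Matrix"
begin

hide_const (open) Finite_Cartesian_Product.mat Matrix.orthogonal

section \<open>Operators on a real Hilbert space\<close>

definition symmetric_op :: "('k::real_inner \<Rightarrow> 'k) \<Rightarrow> bool" where
  "symmetric_op A \<longleftrightarrow> bounded_linear A \<and> (\<forall>x y. inner (A x) y = inner x (A y))"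

definition positive_op :: "('k::real_inner \<Rightarrow> 'k) \<Rightarrow> bool" where
  "positive_op A \<longleftrightarrow> symmetric_op A \<and> (\<forall>x. 0 \<le> inner x (A x))"

definition invertible_op :: "('k::real_inner \<Rightarrow> 'k) \<Rightarrow> bool" where
  "invertible_op A \<longleftrightarrow> bounded_linear A \<and> (\<exists>B. bounded_linear B \<and> A \<circ> B = id \<and> B \<circ> A = id)"

text \<open>The positive square root; meaningful only for positive operators on a complete space,
  where it exists and is unique.\<close>

definition op_sqrt :: "('k::real_inner \<Rightarrow> 'k) \<Rightarrow> 'k \<Rightarrow> 'k" where
  "op_sqrt A = (SOME R. positive_op R \<and> R \<circ> R = A)"

definition op_abs :: "('k::real_inner \<Rightarrow> 'k) \<Rightarrow> 'k \<Rightarrow> 'k" where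
  "op_abs A = op_sqrt (adjoint A \<circ> A)"

definition orthonormal_basis :: "'k::real_inner set \<Rightarrow> bool" where
  "orthonormal_basis B \<longleftrightarrow>
     pairwise orthogonal B \<and> (\<forall>b\<in>B. norm b = 1) \<and> closure (span B) = UNIV"

text \<open>On a Hilbert space the sums in the next two definitions do not depend on the basis.\<close>

definition hilbert_schmidt :: "('k::real_inner \<Rightarrow> 'k) \<Rightarrow> bool" where
  "hilbert_schmidt A \<longleftrightarrow> bounded_linear A \<and>
     (\<exists>B. orthonormal_basis B \<and> (\<lambda>b. (norm (A b))\<^sup>2) summable_on B)"

definition trace_class :: "('k::real_inner \<Rightarrow> 'k) \<Rightarrow> bool" where
  "trace_class A \<longleftrightarrow> bounded_linear A \<and>
     (\<exists>B. orthonormal_basis B \<and> (\<lambda>b. inner b (op_abs A b)) summable_on B)"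


section \<open>Complexification\<close>

text \<open>The pair \<open>(x, y)\<close> stands for \<open>x + \<i> y\<close>. The inner product is conjugate-linear in its
  first argument.\<close>

type_synonym 'k complexified = "'k \<times> 'k"

definition c_inner :: "'k::real_inner complexified \<Rightarrow> 'k complexified \<Rightarrow> complex" where
  "c_inner z w = Complex (inner (fst z) (fst w) + inner (snd z) (snd w))
                         (inner (fst z) (snd w) - inner (snd z) (fst w))"

definition c_scale :: "complex \<Rightarrow> 'k::real_inner complexified \<Rightarrow> 'k complexified" where
  "c_scale c z = (Re c *\<^sub>R fst z - Im c *\<^sub>R snd z, Re c *\<^sub>R snd z + Im c *\<^sub>R fst z)"

definition complexify :: "('k \<Rightarrow> 'k) \<Rightarrow> 'k complexified \<Rightarrow> 'k complexified" where
  "complexify A = map_prod A A"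

definition c_positive :: "('k::real_inner complexified \<Rightarrow> 'k complexified) \<Rightarrow> bool" where
  "c_positive A \<longleftrightarrow> (\<forall>z. c_inner z (A z) \<in> \<real>\<^sub>\<ge>\<^sub>0)"


section \<open>Gaussian covariance operators\<close>

definition symp_J :: "'h::real_inner \<times> 'h \<Rightarrow> 'h \<times> 'h" where
  "symp_J z = (snd z, - fst z)"

definition symplectic_op :: "('h::real_inner \<times> 'h \<Rightarrow> 'h \<times> 'h) \<Rightarrow> bool" where
  "symplectic_op M \<longleftrightarrow> invertible_op M \<and> adjoint M \<circ> symp_J \<circ> M = symp_J"

definition gaussian_covariance_op :: "('h::real_inner \<times> 'h \<Rightarrow> 'h \<times> 'h) \<Rightarrow> bool" where
  "gaussian_covariance_op S \<longleftrightarrow>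
     symmetric_op S \<and> invertible_op S \<and>
     c_positive (\<lambda>z. complexify S z - c_scale \<i> (complexify symp_J z)) \<and>
     hilbert_schmidt (\<lambda>z. S z - z) \<and>
     (let W = op_sqrt S \<circ> symp_J \<circ> op_sqrt S in trace_class (\<lambda>z. (adjoint W \<circ> W) z - z))"


section \<open>Symplectic eigenvalues of operators\<close>

definition williamson_op :: "('h::real_inner \<times> 'h \<Rightarrow> 'h \<times> 'h) \<Rightarrow> ('h \<Rightarrow> 'h) \<Rightarrow> bool" where
  "williamson_op T D \<longleftrightarrow> positive_op D \<and> invertible_op D \<and>
     (\<exists>M. symplectic_op M \<and> T = adjoint M \<circ> map_prod D D \<circ> M)"

text \<open>Dimensions and cardinalities in \<^typ>\<open>enat\<close>, because \<^const>\<open>dim\<close> and \<^const>\<open>card\<close>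
  are \<open>0\<close> in the infinite case.\<close>

definition ecard :: "'b set \<Rightarrow> enat" where
  "ecard I = (if finite I then enat (card I) else \<infinity>)"

definition edim :: "'k::real_vector set \<Rightarrow> enat" where
  "edim V = (if \<exists>B. finite B \<and> V \<subseteq> span B then enat (dim V) else \<infinity>)"

definition multiplicity_op :: "('k::real_vector \<Rightarrow> 'k) \<Rightarrow> real \<Rightarrow> enat" where
  "multiplicity_op D c = edim {x. D x = c *\<^sub>R x}"

text \<open>\<open>d 1 \<ge> d 2 \<ge> \<dots>\<close>, with index set \<open>{k. 1 \<le> k \<and> k \<le> R}\<close>, lists the eigenvalues of \<open>D\<close> that
  exceed 1, each as often as its multiplicity.\<close>

definition eigenvalues_above_1 :: "('k::real_vector \<Rightarrow> 'k) \<Rightarrow> enat \<Rightarrow> (nat \<Rightarrow> real) \<Rightarrow> bool" where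
  "eigenvalues_above_1 D R d \<longleftrightarrow>
     (\<forall>k. 1 \<le> k \<and> enat k \<le> R \<longrightarrow> d k > 1) \<and>
     (\<forall>j k. 1 \<le> j \<and> j \<le> k \<and> enat k \<le> R \<longrightarrow> d k \<le> d j) \<and>
     (\<forall>c>1. ecard {k. 1 \<le> k \<and> enat k \<le> R \<and> d k = c} = multiplicity_op D c)"

text \<open>\<open>R\<close> and the values \<open>d k\<close> for \<open>1 \<le> k \<le> R\<close> do not depend on the choice, since \<open>D\<close> is unique
  up to orthogonal conjugation.\<close>

definition symplectic_data :: "('h::real_inner \<times> 'h \<Rightarrow> 'h \<times> 'h) \<Rightarrow> enat \<times> (nat \<Rightarrow> real)" where
  "symplectic_data T = (SOME (R, d). \<exists>D. williamson_op T D \<and> eigenvalues_above_1 D R d)"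

definition symplectic_count :: "('h::real_inner \<times> 'h \<Rightarrow> 'h \<times> 'h) \<Rightarrow> enat" where
  "symplectic_count T = fst (symplectic_data T)"

definition symplectic_eigenvalue :: "('h::real_inner \<times> 'h \<Rightarrow> 'h \<times> 'h) \<Rightarrow> nat \<Rightarrow> real" where
  "symplectic_eigenvalue T = snd (symplectic_data T)"


section \<open>Symplectic eigenvalues of matrices\<close>

definition symp_J_mat :: "nat \<Rightarrow> real mat" where
  "symp_J_mat n = four_block_mat (0\<^sub>m n n) (1\<^sub>m n) (- 1\<^sub>m n) (0\<^sub>m n n)"

definition symplectic_mat :: "nat \<Rightarrow> real mat \<Rightarrow> bool" where
  "symplectic_mat n M \<longleftrightarrow> M \<in> carrier_mat (2 * n) (2 * n) \<and> invertible_mat M \<and>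
     transpose_mat M * symp_J_mat n * M = symp_J_mat n"

definition williamson_mat :: "nat \<Rightarrow> real mat \<Rightarrow> real list \<Rightarrow> bool" where
  "williamson_mat n A ds \<longleftrightarrow> length ds = n \<and> (\<forall>c\<in>set ds. 0 < c) \<and>
     (\<exists>M. symplectic_mat n M \<and>
        A = transpose_mat M *
            four_block_mat (mat_diag n (\<lambda>i. ds ! i)) (0\<^sub>m n n) (0\<^sub>m n n) (mat_diag n (\<lambda>i. ds ! i)) * M)"

text \<open>The non-increasing list of the symplectic eigenvalues of a strictly positive definite
  \<open>2n \<times> 2n\<close> matrix; it is unique, and its entries are numbered from 1 below.\<close>

definition symplectic_eigenvalues_mat :: "nat \<Rightarrow> real mat \<Rightarrow> real list" where
  "symplectic_eigenvalues_mat n A = (SOME ds. williamson_mat n A ds \<and> sorted_wrt (\<ge>) ds)"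

definition symplectic_eigenvalue_mat :: "nat \<Rightarrow> real mat \<Rightarrow> nat \<Rightarrow> real" where
  "symplectic_eigenvalue_mat n A k = symplectic_eigenvalues_mat n A ! (k - 1)"


section \<open>Truncation\<close>

text \<open>The sequence \<open>e 0, e 1, \<dots>\<close> is the basis \<open>e\<^sub>1, e\<^sub>2, \<dots>\<close>; the ordered basis of the
  truncated space is \<open>trunc_vec e n 0, \<dots>, trunc_vec e n (2 * n - 1)\<close>.\<close>

definition trunc_vec :: "(nat \<Rightarrow> 'h::real_inner) \<Rightarrow> nat \<Rightarrow> nat \<Rightarrow> 'h \<times> 'h" where
  "trunc_vec e n i = (if i < n then (e i, 0) else (0, e (i - n)))"

definition trunc_proj :: "(nat \<Rightarrow> 'h::real_inner) \<Rightarrow> nat \<Rightarrow> 'h \<times> 'h \<Rightarrow> 'h \<times> 'h" where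
  "trunc_proj e n z = (\<Sum>i<2 * n. inner (trunc_vec e n i) z *\<^sub>R trunc_vec e n i)"

definition truncation :: "(nat \<Rightarrow> 'h::real_inner) \<Rightarrow> nat \<Rightarrow> ('h \<times> 'h \<Rightarrow> 'h \<times> 'h) \<Rightarrow> real mat" where
  "truncation e n S = Matrix.mat (2 * n) (2 * n) (\<lambda>(i, j).
     inner (trunc_vec e n i) ((trunc_proj e n \<circ> S \<circ> trunc_proj e n) (trunc_vec e n j)))"

end

theory Submission
  imports Defs "Jordan_Normal_Form.Determinant"
begin

hide_const (open) Matrix.orthogonal

text \<open>
  Write \<open>q x = inner x (S x)\<close> and \<open>\<omega> x z = inner (J x) z\<close>. Among the numbers \<open>c > 0\<close> for which some
  \<open>2 k\<close>-dimensional subspace \<open>V\<close> satisfies \<open>(c * \<omega> x z)\<^sup>2 \<le> q x * q z\<close> for all \<open>x \<in> V\<close> and all \<open>z\<close>,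
  the \<open>k\<close>-th symplectic eigenvalue is the largest. This min-max principle involves neither inverses
  nor square roots, is monotone in \<open>q\<close>, and reads the same for \<open>S\<close> and for its truncations.

  Condition (i) says \<open>(\<omega> x z)\<^sup>2 \<le> q x * q z\<close>, so \<open>c = 1\<close> is always possible and covers \<open>k > R\<close>. Passing
  from \<open>S\<close> to the truncation uses that the projections \<open>P\<close> converge strongly, hence uniformly on \<open>V\<close>.
  The other direction needs \<open>q (P z) \<le> (1 + \<eta>) * q z\<close> for all \<open>z\<close>, which holds for large \<open>n\<close>
  because \<open>S - I\<close> is compact. Compactness of \<open>S - I\<close> also yields compactness of \<open>D - I\<close>, as
  \<open>(D \<oplus> D)\<^sup>2 = - M J S J S M\<^sup>-\<^sup>1\<close>.

  Williamson's form comes from diagonalising \<open>K\<^sup>2\<close>, where \<open>K = S\<^sup>-\<^sup>1 J\<close> is skew for the form of \<open>S\<close> and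
  \<open>- K\<^sup>2\<close> is a compact perturbation of the identity with eigenvalues \<open>1 / d\<^sup>2\<close>.
\<close>

section \<open>Symmetric coercive forms\<close>

text \<open>The supremum of \<open>(\<omega> x z)\<^sup>2 / q z\<close> over nonzero
  \<open>z \<in> Z\<close> is \<open>q (K x)\<close>, where \<open>K x \<in> Z\<close> represents
  \<open>\<omega> x\<close> for the form on \<open>Z\<close>. So the condition says
  \<open>c\<^sup>2 * q (K x) \<le> q x\<close> without naming \<open>K\<close>, which does not fit
  truncation: the inverse of a compression is not the compression of the inverse. The pairing does
  fit, because the truncated spaces are invariant under \<open>J\<close>, so that
  \<open>\<omega> (P x) z = \<omega> x z\<close> for \<open>z\<close> in such a space. Only
  \<open>q\<close> is perturbed. This explains the different tools for the two directions. One
  replaces \<open>x\<close> in a fixed finite-dimensional \<open>V\<close>; the other replaces the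
  test vector \<open>z\<close>, which is arbitrary, so the estimate has to be uniform on the whole
  space. The dimension is \<open>2 k\<close> because each symplectic eigenvalue owns a plane. The
  choice operators in the definitions are harmless: existence is proved, and every Williamson form,
  with every admissible list of its eigenvalues above 1, satisfies the same two bounds.\<close>

lemma quadratic_nonneg_discrim:
  fixes a b c :: real
  assumes "\<And>t. 0 \<le> a + 2 * b * t + c * t\<^sup>2"
  shows "b\<^sup>2 \<le> a * c"
proof (cases "c = 0")
  case True
  have "b = 0"
  proof (rule ccontr)
    assume "b \<noteq> 0"
    then show False using assms[of "- (a + 1) / (2 * b)"] True by simp
  qed
  then show ?thesis using True by simp
next
  case False
  have *: "0 \<le> a - b\<^sup>2 / c"
    using assms[of "- b / c"] False by (simp add: power2_eq_square field_simps)
  have "c > 0"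
  proof (rule ccontr)
    assume "\<not> c > 0"
    with False have c: "c < 0" by simp
    \<comment> \<open>For negative c this t makes the leading term win: t \<ge> 1 bounds a by |a| t,
      and - c t exceeds |a| + 2 |b|.\<close>
    define t where "t = (\<bar>a\<bar> + 2 * \<bar>b\<bar> + 1) / (- c) + 1"
      have "0 \<le> (\<bar>a\<bar> + 2 * \<bar>b\<bar> + 1) / (- c)" using c by (intro divide_nonneg_pos) auto
    then have t1: "t \<ge> 1" unfolding t_def by simp
    have t2: "- c * t > \<bar>a\<bar> + 2 * \<bar>b\<bar>" unfolding t_def using c by (simp add: field_simps)
    have "a + 2 * b * t + c * t\<^sup>2 \<le> (\<bar>a\<bar> + 2 * \<bar>b\<bar> + c * t) * t"
    proof -
      have "a \<le> \<bar>a\<bar> * t" using t1 mult_left_mono[OF t1, of "\<bar>a\<bar>"] by simp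
      moreover have "2 * b * t \<le> 2 * \<bar>b\<bar> * t" using t1 by (intro mult_right_mono) auto
      ultimately show ?thesis by (simp add: power2_eq_square algebra_simps)
    qed
    also have "\<dots> < 0" using t1 t2 by (intro mult_neg_pos) auto
    finally show False using assms[of t] by simp
  qed
  then show ?thesis using * by (simp add: field_simps)
qed

text \<open>The first-order condition at a minimiser; it turns minimality in
  \<open>representer\<close> into the variational equation.\<close>

lemma quadratic_nonneg_linear_zero:
  fixes b c :: real
  assumes "\<And>t. 0 \<le> 2 * b * t + c * t\<^sup>2"
  shows "b = 0"
  using quadratic_nonneg_discrim[of 0 b c] assms by simp

text \<open>Coercivity makes the form an inner product equivalent to the ambient one. Projections,
  Bessel's inequality and spectral arguments can then be run in the geometry of \<open>S\<close>
  without changing the type or taking a root of \<open>S\<close>.\<close>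

locale coercive_form =
  fixes S :: "'k::{real_inner, complete_space} \<Rightarrow> 'k" and \<delta> :: real
  assumes S_bl: "bounded_linear S"
    and S_sym: "inner (S x) y = inner x (S y)"
    and delta_pos: "\<delta> > 0"
    and coercive: "\<delta> * (norm x)\<^sup>2 \<le> inner x (S x)"
begin

definition form :: "'k \<Rightarrow> 'k \<Rightarrow> real" where "form x y = inner x (S y)"
abbreviation q :: "'k \<Rightarrow> real" where "q x \<equiv> form x x"

lemma S_lin: "linear S" by (rule bounded_linear.linear[OF S_bl])

lemma form_sym: "form x y = form y x"
  unfolding form_def by (metis S_sym inner_commute)

lemma form_simps:
  "form (x + y) z = form x z + form y z" "form z (x + y) = form z x + form z y"
  "form (x - y) z = form x z - form y z" "form z (x - y) = form z x - form z y"
  "form (a *\<^sub>R x) z = a * form x z" "form z (a *\<^sub>R x) = a * form z x"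
  "form 0 z = 0" "form z 0 = 0" "form (- x) z = - form x z" "form z (- x) = - form z x"
  by (auto simp: form_def linear_add[OF S_lin] linear_diff[OF S_lin] linear_scale[OF S_lin]
      linear_0[OF S_lin] linear_neg[OF S_lin] inner_simps)

lemma form_sum: "form (\<Sum>i\<in>A. f i) z = (\<Sum>i\<in>A. form (f i) z)" "form z (\<Sum>i\<in>A. f i) = (\<Sum>i\<in>A. form z (f i))"
  by (auto simp: form_def inner_sum_left linear_sum[OF S_lin] inner_sum_right)

lemma form_coercive: "\<delta> * (norm x)\<^sup>2 \<le> q x" using coercive by (simp add: form_def)

lemma q_nonneg: "0 \<le> q x"
  using form_coercive[of x] delta_pos by (meson less_imp_le mult_nonneg_nonneg order_trans zero_le_power2)

lemma q_pos: "x \<noteq> 0 \<Longrightarrow> 0 < q x"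
  using form_coercive[of x] delta_pos by (smt (verit) mult_pos_pos zero_less_norm_iff zero_less_power)

lemma q_eq_0: "q x = 0 \<longleftrightarrow> x = 0" using q_pos[of x] form_simps(7)[of 0] by (cases "x = 0") simp_all

lemma form_bounded: "\<exists>C>0. \<forall>x y. \<bar>form x y\<bar> \<le> C * norm x * norm y"
proof -
  obtain K where K: "K > 0" "\<And>x. norm (S x) \<le> norm x * K"
    using bounded_linear.pos_bounded[OF S_bl] by blast
  have "\<bar>form x y\<bar> \<le> K * norm x * norm y" for x y
    using Cauchy_Schwarz_ineq2[of x "S y"] K(2)[of y] mult_left_mono[OF K(2)[of y], of "norm x"]
    by (simp add: form_def ac_simps)
  then show ?thesis using K(1) by blast
qed

lemma form_tendsto [tendsto_intros]:
  "(f \<longlongrightarrow> a) F \<Longrightarrow> (g \<longlongrightarrow> b) F \<Longrightarrow> ((\<lambda>x. form (f x) (g x)) \<longlongrightarrow> form a b) F"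
  unfolding form_def by (intro tendsto_intros bounded_linear.tendsto[OF S_bl])

lemma form_cauchy_schwarz: "(form x y)\<^sup>2 \<le> q x * q y"
proof (rule quadratic_nonneg_discrim)
  fix t :: real
  have "0 \<le> q (x + t *\<^sub>R y)" by (rule q_nonneg)
  then show "0 \<le> q x + 2 * form x y * t + q y * t\<^sup>2"
    by (simp add: form_simps form_sym[of y x] power2_eq_square algebra_simps)
qed

text \<open>Lax--Milgram for a symmetric form: the representer minimises \<open>q x - 2 * \<phi> x\<close>.\<close>

lemma representer:
  fixes \<phi> :: "'k \<Rightarrow> real"
  assumes W: "subspace W" "closed W" and \<phi>: "bounded_linear \<phi>"
  obtains m where "m \<in> W" "\<And>y. y \<in> W \<Longrightarrow> form m y = \<phi> y"
proof -
  define h where "h x = q x - 2 * \<phi> x" for x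
  have \<phi>lin: "linear \<phi>" by (rule bounded_linear.linear[OF \<phi>])
  obtain K where K: "K > 0" "\<And>x. norm (\<phi> x) \<le> norm x * K"
    using bounded_linear.pos_bounded[OF \<phi>] by blast
  have lower: "- (K\<^sup>2 / \<delta>) \<le> h x" for x
  proof -
    have "\<phi> x \<le> norm x * K" using K(2)[of x] by auto
    then have 1: "\<delta> * (norm x)\<^sup>2 - 2 * (norm x * K) \<le> h x"
      unfolding h_def using form_coercive[of x] by linarith
    have "0 \<le> (\<delta> * norm x - K)\<^sup>2 / \<delta>" using delta_pos by simp
    also have "\<dots> = \<delta> * (norm x)\<^sup>2 - 2 * (norm x * K) + K\<^sup>2 / \<delta>"
      using delta_pos by (simp add: power2_eq_square field_simps)
    finally show ?thesis using 1 by linarith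
  qed
  define I where "I = Inf (h ` W)"
  have "0 \<in> W" by (rule subspace_0[OF W(1)])
  then have ne: "h ` W \<noteq> {}" by blast
  have bdd: "bdd_below (h ` W)" unfolding bdd_below_def using lower by blast
  have I_le: "I \<le> h x" if "x \<in> W" for x
    unfolding I_def using that bdd by (simp add: cInf_lower)
  have "\<exists>x\<in>W. h x < I + 1 / (real n + 1)" for n
    using cInf_lessD[OF ne, of "I + 1 / (real n + 1)"] unfolding I_def by force
  then obtain X where X: "\<And>n. X n \<in> W" "\<And>n. h (X n) < I + 1 / (real n + 1)" by metis
  \<comment> \<open>Parallelogram identity: the linear part cancels, so vectors whose values are
    near the infimum are near each other.\<close>
  have par: "h x + h y - 2 * h ((1/2) *\<^sub>R (x + y)) = q (x - y) / 2" for x y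
    unfolding h_def
    by (simp add: form_simps linear_add[OF \<phi>lin] linear_scale[OF \<phi>lin] form_sym[of y x] field_simps)
  have dist: "\<delta> * (norm (x - y))\<^sup>2 / 2 \<le> h x + h y - 2 * I" if "x \<in> W" "y \<in> W" for x y
    using par[of x y] form_coercive[of "x - y"] I_le[of "(1/2) *\<^sub>R (x + y)"]
      subspace_scale[OF W(1) subspace_add[OF W(1) that], of "1/2"] by linarith
  have "Cauchy X"
  proof (rule metric_CauchyI)
    fix e :: real assume e: "e > 0"
    \<comment> \<open>The estimate \<open>dist\<close> puts \<delta> times the squared distance
      below 4 / (M + 1), hence an M of order 1 / (\<delta> e^2).\<close>
    define M where "M = nat \<lceil>8 / (\<delta> * e\<^sup>2)\<rceil> + 1"
    have M: "4 / (real M + 1) < \<delta> * e\<^sup>2"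
    proof -
      have "8 / (\<delta> * e\<^sup>2) < real M + 1" unfolding M_def by linarith
      then have "8 < (real M + 1) * (\<delta> * e\<^sup>2)" using e delta_pos by (simp add: field_simps)
      then show ?thesis by (simp add: field_simps)
    qed
    show "\<exists>M. \<forall>m\<ge>M. \<forall>n\<ge>M. dist (X m) (X n) < e"
    proof (intro exI allI impI)
      fix m n assume mn: "m \<ge> M" "n \<ge> M"
      have "1 / (real m + 1) \<le> 1 / (real M + 1)" "1 / (real n + 1) \<le> 1 / (real M + 1)"
        using mn by (auto intro!: divide_left_mono)
      then have "\<delta> * (norm (X m - X n))\<^sup>2 / 2 < 2 / (real M + 1)"
        using dist[OF X(1) X(1), of m n] X(2)[of m] X(2)[of n] by linarith
      then have "\<delta> * (norm (X m - X n))\<^sup>2 < \<delta> * e\<^sup>2" using M by linarith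
      then have "(norm (X m - X n))\<^sup>2 < e\<^sup>2" using delta_pos by simp
      then show "dist (X m) (X n) < e" unfolding dist_norm using e power2_less_imp_less by force
    qed
  qed
  then obtain m where m: "X \<longlonglongrightarrow> m" using Cauchy_convergent_iff convergent_def by blast
  have mW: "m \<in> W" by (rule closed_sequentially[OF W(2) _ m]) (rule X(1))
  have "(\<lambda>n. h (X n)) \<longlonglongrightarrow> h m"
    unfolding h_def by (intro tendsto_intros m bounded_linear.tendsto[OF \<phi>])
  moreover have "(\<lambda>n. I + 1 / (real n + 1)) \<longlonglongrightarrow> I + 0"
    using LIMSEQ_Suc[OF lim_1_over_n] by (intro tendsto_add tendsto_const) (simp add: add.commute)
  ultimately have "h m \<le> I + 0"
    by (rule LIMSEQ_le) (use X(2) less_imp_le in blast)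
  then have min: "h m \<le> h x" if "x \<in> W" for x using I_le[OF that] by linarith
  have "form m y = \<phi> y" if y: "y \<in> W" for y
  proof -
    have "form m y - \<phi> y = 0"
    proof (rule quadratic_nonneg_linear_zero)
      fix t :: real
      have "h m \<le> h (m + t *\<^sub>R y)"
        by (rule min) (intro subspace_add[OF W(1)] subspace_scale[OF W(1)] mW y)
      then show "0 \<le> 2 * (form m y - \<phi> y) * t + q y * t\<^sup>2"
        unfolding h_def
        by (simp add: form_simps linear_add[OF \<phi>lin] linear_scale[OF \<phi>lin] form_sym[of y m]
            power2_eq_square algebra_simps)
    qed
    then show ?thesis by simp
  qed
  with mW show ?thesis by (rule that)
qed

lemma representer_unique:
  assumes "subspace W" "m \<in> W" "m' \<in> W" "\<And>y. y \<in> W \<Longrightarrow> form m y = form m' y"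
  shows "m = m'"
  using assms(4)[of "m - m'"] subspace_diff[OF assms(1-3)] q_eq_0[of "m - m'"]
  by (simp add: form_simps)

end

section \<open>Riesz representation, orthogonal complements and adjoints\<close>

lemma coercive_form_id: "coercive_form (\<lambda>x::'k::{real_inner, complete_space}. x) 1"
  by (rule coercive_form.intro) (simp_all add: power2_norm_eq_inner bounded_linear_ident)

text \<open>Take a vector outside \<open>W\<close> and subtract its projection. Totality claims
  below are reduced to this: a closed subspace with trivial complement is everything.\<close>

lemma orthogonal_complement_nontrivial:
  fixes W :: "'k::{real_inner, complete_space} set"
  assumes "subspace W" "closed W" "W \<noteq> UNIV"
  shows "\<exists>v. v \<noteq> 0 \<and> (\<forall>w\<in>W. inner v w = 0)"
proof -
  interpret coercive_form "\<lambda>x::'k. x" 1 by (rule coercive_form_id)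
  obtain x where x: "x \<notin> W" using assms(3) by blast
  obtain m where m: "m \<in> W" "\<And>y. y \<in> W \<Longrightarrow> form m y = inner x y"
    using representer[OF assms(1,2) bounded_linear_inner_right[of x]] by blast
  have "\<forall>w\<in>W. inner (x - m) w = 0" using m(2) by (simp add: form_def inner_simps)
  moreover have "x - m \<noteq> 0" using x m(1) by auto
  ultimately show ?thesis by blast
qed

text \<open>\<open>adjoint\<close> is defined by choice, so its equation holds only once
  representers exist. Riesz's theorem supplies them, as the instance of \<open>representer\<close>
  for the ambient inner product; this is where completeness of the domain enters.\<close>

lemma adjoint_inner:
  fixes f :: "'a::{real_inner, complete_space} \<Rightarrow> 'b::real_inner"
  assumes f: "bounded_linear f"
  shows "inner (f x) y = inner x (adjoint f y)"
proof -
  interpret coercive_form "\<lambda>x::'a. x" 1 by (rule coercive_form_id)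
  have "\<exists>m. \<forall>x. inner (f x) y = inner x m" for y
  proof -
    have "bounded_linear (\<lambda>x. inner (f x) y)"
      by (rule bounded_linear_compose[OF bounded_linear_inner_left f])
    from representer[OF subspace_UNIV closed_UNIV this] show ?thesis
      by (metis UNIV_I form_def inner_commute)
  qed
  then have "\<exists>g. \<forall>x y. inner (f x) y = inner x (g y)" by metis
  then show ?thesis unfolding adjoint_def by (rule someI2_ex) auto
qed

lemma adjoint_bounded_linear:
  fixes f :: "'a::{real_inner, complete_space} \<Rightarrow> 'b::real_inner"
  assumes f: "bounded_linear f"
  shows "bounded_linear (adjoint f)"
proof -
  obtain K where K: "K > 0" "\<And>x. norm (f x) \<le> norm x * K"
    using bounded_linear.pos_bounded[OF f] by blast
  have adj: "inner z (adjoint f y) = inner (f z) y" for z y by (rule adjoint_inner[OF f, symmetric])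
  show ?thesis
  proof (rule bounded_linear_intro[where K=K])
    show "adjoint f (x + y) = adjoint f x + adjoint f y" for x y
      by (rule vector_eq_ldot[THEN iffD1]) (simp add: adj inner_simps)
    show "adjoint f (r *\<^sub>R x) = r *\<^sub>R adjoint f x" for r x
      by (rule vector_eq_ldot[THEN iffD1]) (simp add: adj inner_simps)
    show "norm (adjoint f x) \<le> norm x * K" for x
    proof (cases "adjoint f x = 0")
      case False
      have "(norm (adjoint f x))\<^sup>2 = inner (f (adjoint f x)) x"
        by (simp add: power2_norm_eq_inner adj)
      also have "\<dots> \<le> norm (f (adjoint f x)) * norm x" by (rule norm_cauchy_schwarz)
      also have "\<dots> \<le> (norm (adjoint f x) * K) * norm x" by (intro mult_right_mono K) auto
      finally show ?thesis using False by (simp add: power2_eq_square ac_simps)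
    qed (use K in simp)
  qed
qed


section \<open>Compact operators and extremal eigenvectors\<close>

text \<open>For bounded operators on a Hilbert space this is compactness: up to \<open>\<epsilon>\<close>, finitely many
  functionals control \<open>G\<close>. It is stable under bounded factors and restricts to subspaces.\<close>

definition compact_on :: "'a::real_inner set \<Rightarrow> ('a \<Rightarrow> 'b::real_normed_vector) \<Rightarrow> bool" where
  "compact_on N G \<longleftrightarrow>
     (\<forall>\<epsilon>>0. \<exists>fs. \<forall>x\<in>N. norm (G x) \<le> \<epsilon> * norm x + (\<Sum>f\<leftarrow>fs. \<bar>inner f x\<bar>))"

lemma compact_onD:
  assumes "compact_on N G" "\<epsilon> > 0"
  obtains fs where "\<And>x. x \<in> N \<Longrightarrow> norm (G x) \<le> \<epsilon> * norm x + (\<Sum>f\<leftarrow>fs. \<bar>inner f x\<bar>)"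
  using assms unfolding compact_on_def by blast

lemma compact_on_left:
  assumes "bounded_linear L" "compact_on N G"
  shows "compact_on N (\<lambda>x. L (G x))"
  unfolding compact_on_def
proof (intro allI impI)
  fix \<epsilon> :: real assume e: "\<epsilon> > 0"
  obtain K where K: "K > 0" "\<And>x. norm (L x) \<le> norm x * K"
    using bounded_linear.pos_bounded[OF assms(1)] by blast
  obtain fs where fs: "\<And>x. x \<in> N \<Longrightarrow> norm (G x) \<le> (\<epsilon> / K) * norm x + (\<Sum>f\<leftarrow>fs. \<bar>inner f x\<bar>)"
    using compact_onD[OF assms(2), of "\<epsilon> / K"] e K by auto
  have "norm (L (G x)) \<le> \<epsilon> * norm x + (\<Sum>f\<leftarrow>map (\<lambda>f. K *\<^sub>R f) fs. \<bar>inner f x\<bar>)" if "x \<in> N" for x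
  proof -
    have "norm (L (G x)) \<le> ((\<epsilon> / K) * norm x + (\<Sum>f\<leftarrow>fs. \<bar>inner f x\<bar>)) * K"
      using K(2)[of "G x"] mult_right_mono[OF fs[OF that], of K] K(1) by linarith
    also have "\<dots> = \<epsilon> * norm x + (\<Sum>f\<leftarrow>map (\<lambda>f. K *\<^sub>R f) fs. \<bar>inner f x\<bar>)"
      using K(1) by (simp add: o_def abs_mult distrib_left sum_list_const_mult mult.commute[of _ K])
    finally show ?thesis .
  qed
  then show "\<exists>fs. \<forall>x\<in>N. norm (L (G x)) \<le> \<epsilon> * norm x + (\<Sum>f\<leftarrow>fs. \<bar>inner f x\<bar>)" by blast
qed

text \<open>The functionals are pulled back along \<open>L\<close> by its adjoint, and \<epsilon> is
  divided by a bound of \<open>L\<close>.\<close>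

lemma compact_on_right:
  fixes L :: "'a::{real_inner, complete_space} \<Rightarrow> 'b::real_inner"
  assumes "bounded_linear L" "compact_on N' G" "L ` N \<subseteq> N'"
  shows "compact_on N (\<lambda>x. G (L x))"
  unfolding compact_on_def
proof (intro allI impI)
  fix \<epsilon> :: real assume e: "\<epsilon> > 0"
  obtain K where K: "K > 0" "\<And>x. norm (L x) \<le> norm x * K"
    using bounded_linear.pos_bounded[OF assms(1)] by blast
  obtain fs where fs: "\<And>x. x \<in> N' \<Longrightarrow> norm (G x) \<le> (\<epsilon> / K) * norm x + (\<Sum>f\<leftarrow>fs. \<bar>inner f x\<bar>)"
    using compact_onD[OF assms(2), of "\<epsilon> / K"] e K by auto
  have "norm (G (L x)) \<le> \<epsilon> * norm x + (\<Sum>f\<leftarrow>map (adjoint L) fs. \<bar>inner f x\<bar>)" if "x \<in> N" for x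
  proof -
    have "norm (G (L x)) \<le> (\<epsilon> / K) * norm (L x) + (\<Sum>f\<leftarrow>fs. \<bar>inner f (L x)\<bar>)"
      using fs assms(3) that by blast
    also have "(\<epsilon> / K) * norm (L x) \<le> (\<epsilon> / K) * (norm x * K)"
      using K e by (intro mult_left_mono) auto
    also have "(\<epsilon> / K) * (norm x * K) = \<epsilon> * norm x" using K by simp
    also have "(\<Sum>f\<leftarrow>fs. \<bar>inner f (L x)\<bar>) = (\<Sum>f\<leftarrow>map (adjoint L) fs. \<bar>inner f x\<bar>)"
      by (simp add: o_def adjoint_inner[OF assms(1)] inner_commute[of _ "L x"] inner_commute[of _ x])
    finally show ?thesis by simp
  qed
  then show "\<exists>fs. \<forall>x\<in>N. norm (G (L x)) \<le> \<epsilon> * norm x + (\<Sum>f\<leftarrow>fs. \<bar>inner f x\<bar>)" by blast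
qed

lemma compact_on_add:
  assumes "compact_on N G" "compact_on N H"
  shows "compact_on N (\<lambda>x. G x + H x)"
  unfolding compact_on_def
proof (intro allI impI)
  fix \<epsilon> :: real assume e: "\<epsilon> > 0"
  obtain fs where fs: "\<And>x. x \<in> N \<Longrightarrow> norm (G x) \<le> (\<epsilon> / 2) * norm x + (\<Sum>f\<leftarrow>fs. \<bar>inner f x\<bar>)"
    using compact_onD[OF assms(1), of "\<epsilon> / 2"] e by auto
  obtain gs where gs: "\<And>x. x \<in> N \<Longrightarrow> norm (H x) \<le> (\<epsilon> / 2) * norm x + (\<Sum>f\<leftarrow>gs. \<bar>inner f x\<bar>)"
    using compact_onD[OF assms(2), of "\<epsilon> / 2"] e by auto
  have "norm (G x + H x) \<le> \<epsilon> * norm x + (\<Sum>f\<leftarrow>fs @ gs. \<bar>inner f x\<bar>)" if "x \<in> N" for x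
    using fs[OF that] gs[OF that] norm_triangle_ineq[of "G x" "H x"] by simp
  then show "\<exists>fs. \<forall>x\<in>N. norm (G x + H x) \<le> \<epsilon> * norm x + (\<Sum>f\<leftarrow>fs. \<bar>inner f x\<bar>)" by blast
qed

text \<open>Carries compactness to operators known only through an estimate: from
  \<open>S - I\<close> to \<open>K - J\<close>, and from D^2 - I to D - I.\<close>

lemma compact_on_le:
  assumes "compact_on N G" "\<And>x. x \<in> N \<Longrightarrow> norm (H x) \<le> norm (G x)"
  shows "compact_on N H"
  using assms unfolding compact_on_def by (meson order_trans)

lemma compact_on_subset: "compact_on N G \<Longrightarrow> N' \<subseteq> N \<Longrightarrow> compact_on N' G"
  unfolding compact_on_def by (meson subsetD)

text \<open>Bolzano-Weierstrass for one functional after another. Since \<open>compact_on\<close>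
  offers finitely many functionals per \<epsilon>, this finite version takes the place of weak
  sequential compactness.\<close>

lemma subsequence_inner_convergent:
  fixes x :: "nat \<Rightarrow> 'a::real_inner"
  assumes "\<And>n. norm (x n) \<le> C"
  shows "\<exists>r. strict_mono (r::nat \<Rightarrow> nat) \<and> (\<forall>f\<in>set fs. convergent (\<lambda>n. inner f (x (r n))))"
proof (induction fs)
  case Nil
  show ?case using strict_mono_id by auto
next
  case (Cons f fs)
  then obtain r where r: "strict_mono r" "\<forall>f\<in>set fs. convergent (\<lambda>n. inner f (x (r n)))" by blast
  have "norm (inner f (x (r n))) \<le> norm f * C" for n
    using Cauchy_Schwarz_ineq2[of f "x (r n)"] mult_left_mono[OF assms[of "r n"], of "norm f"] by simp
  then have "bounded (range (\<lambda>n. inner f (x (r n))))" unfolding bounded_iff by blast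
  then obtain l s where s: "strict_mono (s::nat\<Rightarrow>nat)" "((\<lambda>n. inner f (x (r n))) \<circ> s) \<longlonglongrightarrow> l"
    using bounded_imp_convergent_subsequence by blast
  have "convergent (\<lambda>n. inner g (x ((r \<circ> s) n)))" if "g \<in> set (f # fs)" for g
  proof (cases "g = f")
    case True
    then show ?thesis using s(2) by (auto simp: convergent_def o_def)
  next
    case False
    then have "convergent (\<lambda>n. inner g (x (r n)))" using that r by auto
    from convergent_subseq_convergent[OF this s(1)] show ?thesis by (simp add: o_def)
  qed
  then show ?case using strict_mono_o[OF r(1) s(1)] by blast
qed

text \<open>Approximate eigenvectors for g > 0 cluster: compactness with \<epsilon> = g / 2 absorbs
  half of g |x m - x n|, and what remains is bounded by the Cauchy residuals and finitely many
  convergent functionals.\<close>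

lemma compact_on_subsequence:
  fixes x :: "nat \<Rightarrow> 'a::{real_inner, complete_space}"
  assumes N: "subspace N" and G: "linear G" "compact_on N G" and g: "g > 0"
    and x: "\<And>n. x n \<in> N" "\<And>n. norm (x n) \<le> C"
    and lim: "(\<lambda>n. g *\<^sub>R x n - G (x n)) \<longlonglongrightarrow> 0"
  obtains r where "strict_mono (r::nat \<Rightarrow> nat)" "convergent (x \<circ> r)"
proof -
  obtain fs where fs: "\<And>x. x \<in> N \<Longrightarrow> norm (G x) \<le> (g / 2) * norm x + (\<Sum>f\<leftarrow>fs. \<bar>inner f x\<bar>)"
    using compact_onD[OF G(2), of "g / 2"] g by auto
  obtain r where r: "strict_mono (r::nat \<Rightarrow> nat)" "\<forall>f\<in>set fs. convergent (\<lambda>n. inner f (x (r n)))"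
    using subsequence_inner_convergent[of x, OF x(2), of fs] by blast
  define u where "u n = g *\<^sub>R x (r n) - G (x (r n))" for n
  have "u \<longlonglongrightarrow> 0" using LIMSEQ_subseq_LIMSEQ[OF lim r(1)] by (simp add: u_def[abs_def] o_def)
  then have "Cauchy u" by (rule LIMSEQ_imp_Cauchy)
  have key: "(g / 2) * norm (x (r m) - x (r n)) \<le>
      norm (u m - u n) + (\<Sum>f\<leftarrow>fs. \<bar>inner f (x (r m)) - inner f (x (r n))\<bar>)" for m n
  proof -
    define w where "w = x (r m) - x (r n)"
    have w: "w \<in> N" unfolding w_def by (intro subspace_diff[OF N] x)
    have "g *\<^sub>R w = (u m - u n) + G w"
      unfolding w_def u_def by (simp add: linear_diff[OF G(1)] scaleR_diff_right)
    then have "g * norm w \<le> norm (u m - u n) + norm (G w)"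
      using norm_triangle_ineq[of "u m - u n" "G w"] g by (metis abs_of_pos norm_scaleR)
    then show ?thesis using fs[OF w] by (simp add: w_def inner_diff_right)
  qed
  have sumC: "\<exists>M. \<forall>m\<ge>M. \<forall>n\<ge>M. (\<Sum>f\<leftarrow>fs. \<bar>inner f (x (r m)) - inner f (x (r n))\<bar>) < e" if "e > 0" for e
    using r(2) that
  proof (induction fs arbitrary: e)
    case Nil then show ?case by simp
  next
    case (Cons f fs)
    have "Cauchy (\<lambda>n. inner f (x (r n)))" using Cons.prems by (simp add: convergent_Cauchy)
    then obtain M1 where M1: "\<forall>m\<ge>M1. \<forall>n\<ge>M1. \<bar>inner f (x (r m)) - inner f (x (r n))\<bar> < e / 2"
      using Cons.prems(2) metric_CauchyD[of "\<lambda>n. inner f (x (r n))" "e / 2"] unfolding dist_real_def by auto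
    obtain M2 where M2: "\<forall>m\<ge>M2. \<forall>n\<ge>M2. (\<Sum>f\<leftarrow>fs. \<bar>inner f (x (r m)) - inner f (x (r n))\<bar>) < e / 2"
      using Cons.IH[of "e/2"] Cons.prems by auto
    have "(\<Sum>f\<leftarrow>f # fs. \<bar>inner f (x (r m)) - inner f (x (r n))\<bar>) < e" if "m \<ge> max M1 M2" "n \<ge> max M1 M2" for m n
    proof -
      have "\<bar>inner f (x (r m)) - inner f (x (r n))\<bar> < e / 2" using M1 that by simp
      moreover have "(\<Sum>f\<leftarrow>fs. \<bar>inner f (x (r m)) - inner f (x (r n))\<bar>) < e / 2" using M2 that by simp
      ultimately show ?thesis by simp
    qed
    then show ?case by blast
  qed
  have "Cauchy (x \<circ> r)"
  proof (rule metric_CauchyI)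
    fix e :: real assume e: "e > 0"
    obtain M1 where M1: "\<forall>m\<ge>M1. \<forall>n\<ge>M1. norm (u m - u n) < g * e / 4"
      using metric_CauchyD[OF \<open>Cauchy u\<close>, of "g * e / 4"] e g unfolding dist_norm by auto
    obtain M2 where M2: "\<forall>m\<ge>M2. \<forall>n\<ge>M2. (\<Sum>f\<leftarrow>fs. \<bar>inner f (x (r m)) - inner f (x (r n))\<bar>) < g * e / 4"
      using sumC[of "g * e / 4"] e g by auto
    have "dist ((x \<circ> r) m) ((x \<circ> r) n) < e" if "m \<ge> max M1 M2" "n \<ge> max M1 M2" for m n
    proof -
      have "norm (u m - u n) < g * e / 4" using M1 that by simp
      moreover have "(\<Sum>f\<leftarrow>fs. \<bar>inner f (x (r m)) - inner f (x (r n))\<bar>) < g * e / 4" using M2 that by simp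
      ultimately have "(g / 2) * norm (x (r m) - x (r n)) < (g / 2) * e" using key[of m n] by linarith
      then show ?thesis using g by (simp add: dist_norm)
    qed
    then show "\<exists>M. \<forall>m\<ge>M. \<forall>n\<ge>M. dist ((x \<circ> r) m) ((x \<circ> r) n) < e" by blast
  qed
  then have "convergent (x \<circ> r)" using Cauchy_convergent_iff by blast
  with r(1) show ?thesis by (rule that)
qed

context coercive_form
begin

text \<open>The supremum of the Rayleigh quotient, being positive, is attained: along a normalised
  maximising sequence the residual \<open>g *\<^sub>R x n - G (x n)\<close> tends to 0, and
  compactness then provides a limit. Admitting a closed invariant \<open>N\<close> allows
  eigenvectors to be split off one by one.\<close>

lemma max_eigenvector:
  assumes N: "subspace N" "closed N"
    and G: "bounded_linear G" "G ` N \<subseteq> N" "compact_on N G"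
    and sym: "\<And>x y. x \<in> N \<Longrightarrow> y \<in> N \<Longrightarrow> form (G x) y = form x (G y)"
    and x0: "x0 \<in> N" "form x0 (G x0) > 0"
  obtains x g where "x \<in> N" "x \<noteq> 0" "g > 0" "G x = g *\<^sub>R x" "\<And>y. y \<in> N \<Longrightarrow> form y (G y) \<le> g * q y"
proof -
  have Glin: "linear G" by (rule bounded_linear.linear[OF G(1)])
  obtain K where K: "K > 0" "\<And>x. norm (G x) \<le> norm x * K"
    using bounded_linear.pos_bounded[OF G(1)] by blast
  obtain C where C: "C > 0" "\<And>x y. \<bar>form x y\<bar> \<le> C * norm x * norm y" using form_bounded by blast
  have formG: "\<bar>form y (G y)\<bar> \<le> C * K / \<delta> * q y" for y
  proof -
    have "\<bar>form y (G y)\<bar> \<le> C * norm y * norm (G y)" by (rule C)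
    also have "\<dots> \<le> C * norm y * (norm y * K)" using C K by (intro mult_left_mono) auto
    also have "\<dots> = C * K / \<delta> * (\<delta> * (norm y)\<^sup>2)" using delta_pos by (simp add: power2_eq_square)
    also have "\<dots> \<le> C * K / \<delta> * q y"
      using C K delta_pos form_coercive by (intro mult_left_mono) auto
    finally show ?thesis .
  qed
  define R where "R = (\<lambda>y. form y (G y) / q y) ` (N - {0})"
  have x00: "x0 \<noteq> 0" using x0(2) by (auto simp: form_simps)
  then have ne: "R \<noteq> {}" unfolding R_def using x0 by blast
  have "form y (G y) / q y \<le> C * K / \<delta>" if "y \<noteq> 0" for y
    using formG[of y] q_pos[OF that] by (simp add: pos_divide_le_eq)
  then have bdd: "bdd_above R" unfolding bdd_above_def R_def by auto
  define g where "g = Sup R"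
  have le_g: "form y (G y) \<le> g * q y" if "y \<in> N" for y
  proof (cases "y = 0")
    case False
    then have "form y (G y) / q y \<le> g" unfolding g_def using that bdd by (intro cSup_upper) (auto simp: R_def)
    then show ?thesis using q_pos[OF False] by (simp add: pos_divide_le_eq)
  qed (simp add: form_simps)
  have g: "g > 0"
    using le_g[OF x0(1)] x0(2) q_pos[OF x00] by (smt (verit) mult_nonpos_nonneg)
  have "\<exists>y\<in>N - {0}. form y (G y) / q y > g - 1 / (real n + 1)" for n
    using less_cSupD[OF ne, of "g - 1 / (real n + 1)"] unfolding g_def R_def by force
  then obtain y where y: "\<And>n. y n \<in> N" "\<And>n. y n \<noteq> 0"
      "\<And>n. form (y n) (G (y n)) / q (y n) > g - 1 / (real n + 1)"
    by (metis Diff_iff singletonI)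
  define x where "x n = (1 / norm (y n)) *\<^sub>R y n" for n
  have xN: "x n \<in> N" for n unfolding x_def by (intro subspace_scale[OF N(1)] y)
  have xnorm: "norm (x n) = 1" for n unfolding x_def using y(2) by simp
  have qx: "0 < q (x n)" "q (x n) \<le> C" for n
    using q_pos[of "x n"] xnorm[of n] C(2)[of "x n" "x n"] norm_zero[where 'a='k]
    by (metis zero_neq_one, simp)
  have hx: "g * q (x n) - form (x n) (G (x n)) \<le> C / (real n + 1)" for n
  proof -
    have "form (x n) (G (x n)) / q (x n) = form (y n) (G (y n)) / q (y n)"
      unfolding x_def using y(2) by (simp add: form_simps linear_scale[OF Glin])
    then have "form (x n) (G (x n)) > (g - 1 / (real n + 1)) * q (x n)"
      using y(3)[of n] pos_less_divide_eq[OF qx(1)[of n], of "g - 1 / (real n + 1)" "form (x n) (G (x n))"]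
      by linarith
    then have "g * q (x n) - form (x n) (G (x n)) \<le> 1 / (real n + 1) * q (x n)"
      by (simp add: left_diff_distrib)
    also have "\<dots> \<le> 1 / (real n + 1) * C" by (intro mult_left_mono qx) auto
    finally show ?thesis by simp
  qed
  define u where "u n = g *\<^sub>R x n - G (x n)" for n
  have uN: "u n \<in> N" for n
    unfolding u_def using G(2) xN by (intro subspace_diff[OF N(1)] subspace_scale[OF N(1)]) auto
  \<comment> \<open>Bounds the form \<open>?h\<close> below by a multiple of \<open>q\<close>: g
    plus the bound \<open>C * K / \<delta>\<close> from \<open>formG\<close>.\<close>
  define C' where "C' = g + C * K / \<delta>"
  have C': "C' > 0" unfolding C'_def using g C K delta_pos by (intro add_pos_pos) auto
  have unorm: "\<delta> * (norm (u n))\<^sup>2 \<le> C' * (C / (real n + 1))" for n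
  proof -
    let ?h = "\<lambda>a b. g * form a b - form a (G b)"
    \<comment> \<open>Cauchy-Schwarz for \<open>?h\<close>, which is nonnegative on \<open>N\<close>
      because g is the supremum. At \<open>x n\<close>, \<open>u n\<close> its value is
      \<open>q (u n)\<close>, while \<open>?h (x n) (x n)\<close> is the defect made small by
      \<open>hx\<close>.\<close>
    have "(?h (x n) (u n))\<^sup>2 \<le> ?h (x n) (x n) * ?h (u n) (u n)"
    proof (rule quadratic_nonneg_discrim)
      fix t :: real
      have "x n + t *\<^sub>R u n \<in> N" by (intro subspace_add[OF N(1)] subspace_scale[OF N(1)] xN uN)
      from le_g[OF this] show "0 \<le> ?h (x n) (x n) + 2 * ?h (x n) (u n) * t + ?h (u n) (u n) * t\<^sup>2"
        using sym[OF xN uN, of n n] form_sym[of "u n" "x n"] form_sym[of "u n" "G (x n)"]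
        by (simp add: form_simps linear_add[OF Glin] linear_scale[OF Glin] power2_eq_square algebra_simps)
    qed
    moreover have "?h (x n) (u n) = q (u n)"
    proof -
      have "q (u n) = form (g *\<^sub>R x n - G (x n)) (u n)" by (simp add: u_def)
      also have "\<dots> = g * form (x n) (u n) - form (G (x n)) (u n)" by (simp only: form_simps)
      finally show ?thesis using sym[OF xN uN, of n n] by simp
    qed
    moreover have "?h (u n) (u n) \<le> C' * q (u n)"
      using formG[of "u n"] unfolding C'_def by (simp add: distrib_right)
    moreover have "?h (x n) (x n) * ?h (u n) (u n) \<le> ?h (x n) (x n) * (C' * q (u n))"
      using le_g[OF xN, of n] calculation by (intro mult_left_mono) auto
    ultimately have *: "(q (u n))\<^sup>2 \<le> ?h (x n) (x n) * (C' * q (u n))" by simp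
    have "q (u n) \<le> ?h (x n) (x n) * C'"
    proof (cases "q (u n) = 0")
      case True
      then show ?thesis using le_g[OF xN, of n] C' by simp
    next
      case False
      then have "0 < q (u n)" using q_nonneg[of "u n"] by simp
      moreover have "q (u n) * q (u n) \<le> (?h (x n) (x n) * C') * q (u n)"
        using * by (simp add: power2_eq_square mult.assoc)
      ultimately show ?thesis by (rule mult_right_le_imp_le[rotated])
    qed
    also have "\<dots> \<le> C / (real n + 1) * C'" using hx[of n] C' by (intro mult_right_mono) auto
    finally show ?thesis using form_coercive[of "u n"] by (simp add: mult.commute)
  qed
  have "(\<lambda>n. (norm (u n))\<^sup>2) \<longlonglongrightarrow> 0"
  proof (rule Lim_null_comparison)
    show "\<forall>\<^sub>F n in sequentially. norm ((norm (u n))\<^sup>2) \<le> C' * C / \<delta> * (1 / (real n + 1))"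
    proof (intro always_eventually allI)
      fix n
      have "(norm (u n))\<^sup>2 \<le> C' * (C / (real n + 1)) / \<delta>"
        using unorm[of n] by (simp only: pos_le_divide_eq[OF delta_pos] mult.commute[of "(norm (u n))\<^sup>2" \<delta>])
      also have "C' * (C / (real n + 1)) / \<delta> = C' * C / \<delta> * (1 / (real n + 1))"
        by (simp only: times_divide_eq_right mult_1_right divide_divide_eq_left times_divide_times_eq mult.commute[of \<delta>])
      finally show "norm ((norm (u n))\<^sup>2) \<le> C' * C / \<delta> * (1 / (real n + 1))" by simp
    qed
    have "(\<lambda>n. 1 / (real n + 1)) \<longlonglongrightarrow> 0"
      using LIMSEQ_Suc[OF lim_1_over_n] by (simp add: add.commute)
    then show "(\<lambda>n. C' * C / \<delta> * (1 / (real n + 1))) \<longlonglongrightarrow> 0"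
      using tendsto_mult_right_zero by blast
  qed
  then have "(\<lambda>n. sqrt ((norm (u n))\<^sup>2)) \<longlonglongrightarrow> sqrt 0" by (rule tendsto_real_sqrt)
  then have ulim: "u \<longlonglongrightarrow> 0" by (simp add: tendsto_norm_zero_iff)
  obtain r where r: "strict_mono (r::nat\<Rightarrow>nat)" "convergent (x \<circ> r)"
    using compact_on_subsequence[OF N(1) Glin G(3) g, where x=x and C=1] xnorm xN ulim unfolding u_def[abs_def] by auto
  obtain a where a: "(x \<circ> r) \<longlonglongrightarrow> a" using r(2) convergent_def by blast
  have aN: "a \<in> N" by (rule closed_sequentially[OF N(2) _ a]) (simp add: xN)
  have "(\<lambda>n. norm ((x \<circ> r) n)) \<longlonglongrightarrow> norm a" by (intro tendsto_intros a)
  then have "norm a = 1" using xnorm by (simp add: LIMSEQ_const_iff)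
  then have a0: "a \<noteq> 0" by auto
  have "(\<lambda>n. g *\<^sub>R (x \<circ> r) n - G ((x \<circ> r) n)) \<longlonglongrightarrow> g *\<^sub>R a - G a"
    by (intro tendsto_intros a bounded_linear.tendsto[OF G(1)])
  moreover have "(\<lambda>n. g *\<^sub>R (x \<circ> r) n - G ((x \<circ> r) n)) \<longlonglongrightarrow> 0"
    using LIMSEQ_subseq_LIMSEQ[OF ulim r(1)] by (simp add: u_def[abs_def] o_def)
  ultimately have "g *\<^sub>R a - G a = 0" by (rule LIMSEQ_unique)
  then have "G a = g *\<^sub>R a" by simp
  from that[OF aN a0 g this le_g] show ?thesis by blast
qed

end

section \<open>Finite orthonormal families and Hilbert-Schmidt operators\<close>

lemma orthonormal_expansion:
  fixes B :: "'a::real_inner set"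
  assumes "finite B" "pairwise orthogonal B" "\<forall>b\<in>B. norm b = 1" "x \<in> span B"
  shows "x = (\<Sum>b\<in>B. inner b x *\<^sub>R b)"
proof -
  obtain c where c: "x = (\<Sum>b\<in>B. c b *\<^sub>R b)" using assms(1,4) by (auto simp: span_finite)
  have "inner b x = c b" if b: "b \<in> B" for b
  proof -
    have "inner b x = (\<Sum>b'\<in>B. c b' * inner b b')" by (simp add: c inner_sum_right)
    also have "\<dots> = (\<Sum>b'\<in>B. if b' = b then c b else 0)"
    proof (rule sum.cong[OF refl])
      fix b' assume b': "b' \<in> B"
      have "inner b b = 1" using assms(3) b by (simp add: norm_eq_1)
      then show "c b' * inner b b' = (if b' = b then c b else 0)"
        using assms(2) b b' by (auto simp: pairwise_def Linear_Algebra.orthogonal_def)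
    qed
    finally show ?thesis using assms(1) b by simp
  qed
  then show ?thesis using c by (metis (no_types, lifting) sum.cong)
qed

lemma orthonormal_norm_sum:
  fixes B :: "'a::real_inner set"
  assumes "finite B" "pairwise orthogonal B" "\<forall>b\<in>B. norm b = 1"
  shows "(norm (\<Sum>b\<in>B. c b *\<^sub>R b))\<^sup>2 = (\<Sum>b\<in>B. (c b)\<^sup>2)"
proof -
  have "pairwise (\<lambda>i j. orthogonal (c i *\<^sub>R i) (c j *\<^sub>R j)) B"
    using assms(2) by (simp add: pairwise_def orthogonal_clauses)
  from norm_sum_Pythagorean[OF assms(1) this] show ?thesis using assms(3) by simp
qed

lemma bessel:
  fixes B :: "'a::real_inner set"
  assumes "finite B" "pairwise orthogonal B" "\<forall>b\<in>B. norm b = 1"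
  shows "(\<Sum>b\<in>B. (inner b x)\<^sup>2) \<le> (norm x)\<^sup>2"
proof -
  define p where "p = (\<Sum>b\<in>B. inner b x *\<^sub>R b)"
  have 1: "inner p x = (\<Sum>b\<in>B. (inner b x)\<^sup>2)"
    by (simp add: p_def inner_sum_left power2_eq_square)
  have 2: "inner p p = (\<Sum>b\<in>B. (inner b x)\<^sup>2)"
    using orthonormal_norm_sum[OF assms, of "\<lambda>b. inner b x"] by (simp add: p_def power2_norm_eq_inner)
  have "0 \<le> inner (x - p) (x - p)" by simp
  then show ?thesis using 1 2
    by (simp add: inner_diff_left inner_diff_right power2_norm_eq_inner inner_commute)
qed

text \<open>Expand in the basis and split at a finite set \<open>F\<close> carrying all but
  \<epsilon>^2 of the sum of \<open>(norm (A b))\<^sup>2\<close>. Cauchy-Schwarz and Bessel bound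
  the tail by \<epsilon> |x|; the head is a matter of finitely many functionals.\<close>

lemma hilbert_schmidt_compact_on:
  assumes "hilbert_schmidt A"
  shows "compact_on UNIV A"
  unfolding compact_on_def
proof (intro allI impI)
  fix \<epsilon> :: real assume e: "\<epsilon> > 0"
  have A: "bounded_linear A" using assms by (simp add: hilbert_schmidt_def)
  then have Alin: "linear A" by (rule bounded_linear.linear)
  obtain B where B: "orthonormal_basis B" "(\<lambda>b. (norm (A b))\<^sup>2) summable_on B"
    using assms unfolding hilbert_schmidt_def by blast
  then obtain s where s: "((\<lambda>b. (norm (A b))\<^sup>2) has_sum s) B" unfolding summable_on_def by blast
  \<comment> \<open>Every finite \<open>Y\<close> above \<open>F\<close> is within \<epsilon>^2 / 2
    of the total, so the sums over \<open>Y\<close> and \<open>F\<close> differ by less than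
    \<epsilon>^2.\<close>
  then have "\<forall>\<^sub>F F in finite_subsets_at_top B. dist (\<Sum>b\<in>F. (norm (A b))\<^sup>2) s < \<epsilon>\<^sup>2 / 2"
    unfolding has_sum_def using e by (intro tendstoD) auto
  from eventually_finite_subsets_at_top[THEN iffD1, OF this]
  obtain F where F: "finite F" "F \<subseteq> B"
      and F': "\<forall>Y. finite Y \<and> F \<subseteq> Y \<and> Y \<subseteq> B \<longrightarrow> dist (\<Sum>b\<in>Y. (norm (A b))\<^sup>2) s < \<epsilon>\<^sup>2 / 2"
    by (elim exE conjE) (rule that)
  have tail: "(\<Sum>b\<in>Y - F. (norm (A b))\<^sup>2) \<le> \<epsilon>\<^sup>2" if "finite Y" "F \<subseteq> Y" "Y \<subseteq> B" for Y
  proof -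
    have "dist (\<Sum>b\<in>Y. (norm (A b))\<^sup>2) s < \<epsilon>\<^sup>2 / 2" "dist (\<Sum>b\<in>F. (norm (A b))\<^sup>2) s < \<epsilon>\<^sup>2 / 2"
      using F' F that by blast+
    then show ?thesis
      using sum_diff[OF that(1,2), of "\<lambda>b. (norm (A b))\<^sup>2"] unfolding dist_real_def by linarith
  qed
  obtain bs where bs: "set bs = F" "distinct bs" using finite_distinct_list[OF F(1)] by blast
  \<comment> \<open>The weights \<open>norm (A b)\<close> let the plain sum of absolute values
    dominate the head.\<close>
  define fs where "fs = map (\<lambda>b. norm (A b) *\<^sub>R b) bs"
  have fs: "(\<Sum>f\<leftarrow>fs. \<bar>inner f x\<bar>) = (\<Sum>b\<in>F. \<bar>inner b x\<bar> * norm (A b))" for x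
    unfolding fs_def bs(1)[symmetric]
    by (simp add: o_def abs_mult sum_list_distinct_conv_sum_set[OF bs(2)] mult.commute)
  have B': "pairwise orthogonal B" "\<forall>b\<in>B. norm b = 1" "closure (span B) = UNIV"
    using B(1) by (auto simp: orthonormal_basis_def)
  have on_span: "norm (A x) \<le> \<epsilon> * norm x + (\<Sum>f\<leftarrow>fs. \<bar>inner f x\<bar>)" if "x \<in> span B" for x
  proof -
    obtain Y0 where Y0: "finite Y0" "Y0 \<subseteq> B" "x \<in> span Y0"
      using \<open>x \<in> span B\<close> unfolding span_alt span_explicit by blast
    define Y where "Y = Y0 \<union> F"
    have Y: "finite Y" "F \<subseteq> Y" "Y \<subseteq> B" "x \<in> span Y"
      using Y0 F span_mono[of Y0 Y] by (auto simp: Y_def)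
    have YB: "pairwise orthogonal Y" "\<forall>b\<in>Y. norm b = 1"
      using B' Y(3) pairwise_subset by auto
    have x: "x = (\<Sum>b\<in>Y. inner b x *\<^sub>R b)" by (rule orthonormal_expansion[OF Y(1) YB Y(4)])
    have "A x = (\<Sum>b\<in>Y. inner b x *\<^sub>R A b)"
      by (subst x) (simp add: linear_sum[OF Alin] linear_scale[OF Alin])
    then have "A x = (\<Sum>b\<in>Y - F. inner b x *\<^sub>R A b) + (\<Sum>b\<in>F. inner b x *\<^sub>R A b)"
      using sum.subset_diff[OF Y(2,1)] by metis
    then have "norm (A x) \<le> norm (\<Sum>b\<in>Y - F. inner b x *\<^sub>R A b) + norm (\<Sum>b\<in>F. inner b x *\<^sub>R A b)"
      by (metis norm_triangle_ineq)
    moreover have "norm (\<Sum>b\<in>F. inner b x *\<^sub>R A b) \<le> (\<Sum>f\<leftarrow>fs. \<bar>inner f x\<bar>)"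
      unfolding fs by (rule order_trans[OF norm_sum]) simp
    moreover have "norm (\<Sum>b\<in>Y - F. inner b x *\<^sub>R A b) \<le> \<epsilon> * norm x"
    proof -
      have "norm (\<Sum>b\<in>Y - F. inner b x *\<^sub>R A b) \<le> (\<Sum>b\<in>Y - F. \<bar>inner b x\<bar> * norm (A b))"
        by (rule order_trans[OF norm_sum]) simp
      moreover have "(\<Sum>b\<in>Y - F. \<bar>inner b x\<bar> * norm (A b))\<^sup>2
          \<le> (\<Sum>b\<in>Y - F. \<bar>inner b x\<bar>\<^sup>2) * (\<Sum>b\<in>Y - F. (norm (A b))\<^sup>2)"
        by (rule Cauchy_Schwarz_ineq_sum)
      moreover have "(\<Sum>b\<in>Y - F. \<bar>inner b x\<bar>\<^sup>2) \<le> (norm x)\<^sup>2"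
        using bessel[of "Y - F" x] Y YB pairwise_subset[OF YB(1), of "Y - F"] by auto
      moreover have "(\<Sum>b\<in>Y - F. \<bar>inner b x\<bar>\<^sup>2) * (\<Sum>b\<in>Y - F. (norm (A b))\<^sup>2) \<le> (norm x)\<^sup>2 * \<epsilon>\<^sup>2"
        using tail[OF Y(1-3)] calculation(3) by (intro mult_mono) (auto intro!: sum_nonneg)
      moreover have "(norm (\<Sum>b\<in>Y - F. inner b x *\<^sub>R A b))\<^sup>2 \<le> (\<Sum>b\<in>Y - F. \<bar>inner b x\<bar> * norm (A b))\<^sup>2"
        using calculation(1) by (rule power_mono) simp
      ultimately have "(norm (\<Sum>b\<in>Y - F. inner b x *\<^sub>R A b))\<^sup>2 \<le> (norm x)\<^sup>2 * \<epsilon>\<^sup>2"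
        by linarith
      then have "(norm (\<Sum>b\<in>Y - F. inner b x *\<^sub>R A b))\<^sup>2 \<le> (\<epsilon> * norm x)\<^sup>2"
        by (simp add: power_mult_distrib mult.commute)
      then show ?thesis by (rule power2_le_imp_le) (use e in auto)
    qed
    ultimately show ?thesis by linarith
  qed
  \<comment> \<open>Both sides are continuous in \<open>x\<close>, which extends the estimate from
    the span to its closure.\<close>
  have cont: "continuous_on UNIV (\<lambda>x. \<Sum>f\<leftarrow>fs. \<bar>inner f x\<bar>)"
    by (induction fs) (auto intro!: continuous_intros)
  have "closed {x. norm (A x) \<le> \<epsilon> * norm x + (\<Sum>f\<leftarrow>fs. \<bar>inner f x\<bar>)}"
    by (intro closed_Collect_le continuous_intros cont linear_continuous_on A)
  then have "closure (span B) \<subseteq> {x. norm (A x) \<le> \<epsilon> * norm x + (\<Sum>f\<leftarrow>fs. \<bar>inner f x\<bar>)}"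
    using on_span by (intro closure_minimal) auto
  then show "\<exists>fs. \<forall>x\<in>UNIV. norm (A x) \<le> \<epsilon> * norm x + (\<Sum>f\<leftarrow>fs. \<bar>inner f x\<bar>)"
    using B'(3) by blast
qed


section \<open>Symplectically adapted frames\<close>

lemma symp_J_bl: "bounded_linear (symp_J :: 'h::real_inner \<times> 'h \<Rightarrow> _)"
  unfolding symp_J_def
  by (intro bounded_linear_Pair bounded_linear_snd bounded_linear_minus bounded_linear_fst)

lemmas symp_J_lin = bounded_linear.linear[OF symp_J_bl]

lemma symp_J_J [simp]: "symp_J (symp_J z) = - z"
  by (simp add: symp_J_def prod_eq_iff)

lemma symp_J_skew: "inner (symp_J x) z = - inner x (symp_J z)"
  by (simp add: symp_J_def inner_prod_def inner_commute)

text \<open>\<open>Z\<close> is the whole space for the operator \<open>S\<close> itself and a truncated space for its truncations.\<close>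

locale gaussian_form = coercive_form S \<delta>
  for S :: "'k::{real_inner, complete_space} \<Rightarrow> 'k" and \<delta> +
  fixes J :: "'k \<Rightarrow> 'k" and Z :: "'k set"
  assumes J_bl: "bounded_linear J"
    and J_J [simp]: "J (J z) = - z"
    and J_skew: "inner (J x) z = - inner x (J z)"
    and uncertainty: "(inner (J x) z)\<^sup>2 \<le> inner x (S x) * inner z (S z)"
    and compact: "compact_on UNIV (\<lambda>z. S z - z)"
    and Z: "subspace Z" "closed Z" "J ` Z \<subseteq> Z"
begin

lemmas J_lin = bounded_linear.linear[OF J_bl]

lemma J_isometry: "inner (J x) (J z) = inner x z"
  by (simp add: J_skew)

lemma J_norm [simp]: "norm (J x) = norm x"
  by (simp add: norm_eq_sqrt_inner J_isometry)

lemma J_antisym: "inner (J x) z = - inner (J z) x"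
  by (metis J_skew inner_commute)

lemma J_self [simp]: "inner (J x) x = 0"
  using J_antisym[of x x] by simp


lemma J_in_Z: "z \<in> Z \<Longrightarrow> J z \<in> Z" using Z(3) by blast

text \<open>For \<open>Z = UNIV\<close> this is S^-1 J; on a truncated space it is the inverse of
  the compressed \<open>S\<close> after \<open>J\<close>. The variational equation treats both
  alike.\<close>

definition K :: "'k \<Rightarrow> 'k" where
  "K x = (SOME m. m \<in> Z \<and> (\<forall>y\<in>Z. form m y = inner (J x) y))"

lemma K: "K x \<in> Z" "y \<in> Z \<Longrightarrow> form (K x) y = inner (J x) y"
proof -
  have "\<exists>m. m \<in> Z \<and> (\<forall>y\<in>Z. form m y = inner (J x) y)"
    using representer[OF Z(1,2) bounded_linear_inner_right[of "J x"]] by metis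
  then have "K x \<in> Z \<and> (\<forall>y\<in>Z. form (K x) y = inner (J x) y)"
    unfolding K_def by (rule someI_ex)
  then show "K x \<in> Z" "y \<in> Z \<Longrightarrow> form (K x) y = inner (J x) y" by blast+
qed

lemma K_unique: "m \<in> Z \<Longrightarrow> (\<And>y. y \<in> Z \<Longrightarrow> form m y = inner (J x) y) \<Longrightarrow> K x = m"
  by (rule representer_unique[OF Z(1) K(1)]) (simp_all add: K(2))

lemma K_bl: "bounded_linear K"
proof (rule bounded_linear_intro[where K="1/\<delta>"])
  show "K (x + y) = K x + K y" for x y
    by (rule K_unique) (auto intro: subspace_add[OF Z(1)] K(1)
        simp: form_simps K(2) linear_add[OF J_lin] inner_simps)
  show "K (r *\<^sub>R x) = r *\<^sub>R K x" for r x
    by (rule K_unique) (auto intro: subspace_scale[OF Z(1)] K(1)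
        simp: form_simps K(2) linear_scale[OF J_lin] inner_simps)
  show "norm (K x) \<le> norm x * (1 / \<delta>)" for x
  proof (cases "K x = 0")
    case False
    have "\<delta> * (norm (K x))\<^sup>2 \<le> inner (J x) (K x)"
      using form_coercive[of "K x"] by (simp add: K)
    also have "\<dots> \<le> norm x * norm (K x)"
      using norm_cauchy_schwarz[of "J x" "K x"] by simp
    finally show ?thesis using False delta_pos by (simp add: power2_eq_square field_simps)
  qed (use delta_pos in simp)
qed

lemmas K_lin = bounded_linear.linear[OF K_bl]

lemma form_K_skew: "x \<in> Z \<Longrightarrow> y \<in> Z \<Longrightarrow> form x (K y) = - form (K x) y"
  by (metis K(2) form_sym J_antisym)

text \<open>Uncertainty tested against \<open>z = K x\<close>. The eigenvalues of - K^2 are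
  therefore at most 1, which puts all symplectic eigenvalues at 1 or above.\<close>

lemma q_K_le: "q (K x) \<le> q x"
proof (cases "K x = 0")
  case False
  have "(q (K x))\<^sup>2 \<le> q x * q (K x)"
    using uncertainty[of x "K x"] K(2)[OF K(1), of x x] by (simp add: form_def)
  then show ?thesis using q_pos[OF False] by (simp add: power2_eq_square)
qed (simp add: form_simps q_nonneg)

text \<open>On the whole space K - J = S^-1 (I - S) J. Evaluating \<open>q\<close> at w = K x - J x
  gives the corresponding estimate on every \<open>Z\<close>, since w itself lies in
  \<open>Z\<close> and may serve as test vector.\<close>

lemma K_minus_J: "x \<in> Z \<Longrightarrow> \<delta> * norm (K x - J x) \<le> norm (S (J x) - J x)"
proof (cases "K x - J x = 0")
  case False
  assume x: "x \<in> Z"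
  define w where "w = K x - J x"
  have w: "w \<in> Z" unfolding w_def by (intro subspace_diff[OF Z(1)] K J_in_Z x)
  have "q w = inner (J x) w - form (J x) w"
    by (subst (1) w_def) (simp add: form_simps K(2)[OF w])
  also have "\<dots> = - inner (S (J x) - J x) w"
    by (simp add: form_def S_sym[symmetric] inner_simps)
  also have "\<dots> \<le> norm (S (J x) - J x) * norm w"
    using norm_cauchy_schwarz[of "- (S (J x) - J x)" w]
    by (metis inner_minus_left norm_minus_cancel)
  finally have "\<delta> * (norm w)\<^sup>2 \<le> norm (S (J x) - J x) * norm w"
    using form_coercive[of w] by linarith
  then show ?thesis using False unfolding w_def[symmetric] by (simp add: power2_eq_square)
qed simp

lemma compact_on_K_minus_J: "compact_on Z (\<lambda>x. K x - J x)"
proof (rule compact_on_le)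
  show "compact_on Z (\<lambda>x. (1 / \<delta>) *\<^sub>R (S (J x) - J x))"
    by (rule compact_on_left[OF bounded_linear_scaleR_right compact_on_right[OF J_bl compact subset_UNIV]])
  show "norm (K x - J x) \<le> norm ((1 / \<delta>) *\<^sub>R (S (J x) - J x))" if "x \<in> Z" for x
  proof -
    have "norm ((1 / \<delta>) *\<^sub>R (S (J x) - J x)) = norm (S (J x) - J x) / \<delta>" using delta_pos by simp
    then show ?thesis using K_minus_J[OF that] pos_le_divide_eq[OF delta_pos] by (metis mult.commute)
  qed
qed

text \<open>As J^2 = -1, the operator 1 + K^2 equals K (K - J) + (K - J) J.\<close>

lemma compact_on_1_plus_K2: "compact_on Z (\<lambda>x. x + K (K x))"
proof -
  have "compact_on Z (\<lambda>x. K (K x - J x) + (K (J x) - J (J x)))"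
    by (intro compact_on_add compact_on_left[OF K_bl] compact_on_K_minus_J
        compact_on_right[OF J_bl compact_on_K_minus_J] Z(3))
  then show ?thesis by (simp add: linear_diff[OF K_lin] add.commute)
qed

lemma K_eq_0: "x \<in> Z \<Longrightarrow> K x = 0 \<Longrightarrow> x = 0"
  using K(2)[of "J x" x] J_in_Z[of x] by (simp add: form_simps J_isometry del: inner_eq_zero_iff)
    (simp)

lemma form_K_K: "x \<in> Z \<Longrightarrow> y \<in> Z \<Longrightarrow> form (K (K x)) y = - form (K x) (K y)"
  by (metis K(2) form_sym J_antisym K(1))

text \<open>The operator 1 + K^2 is compact and, by \<open>q_K_le\<close>, nonnegative for the form
  on \<open>N\<close>. If it is positive somewhere, its largest eigenvalue is attained; otherwise it
  vanishes on \<open>N\<close> and every vector is an eigenvector with l = 1.\<close>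

lemma K2_eigenvector:
  assumes N: "subspace N" "closed N" "N \<subseteq> Z" "K ` N \<subseteq> N" "N \<noteq> {0}"
  obtains x l where "x \<in> N" "q x = 1" "l > 0" "K (K x) = - l *\<^sub>R x"
proof -
  define G where "G x = x + K (K x)" for x
  have G_bl: "bounded_linear G"
    unfolding G_def by (intro bounded_linear_add bounded_linear_ident bounded_linear_compose[OF K_bl] K_bl)
  have GN: "G ` N \<subseteq> N"     unfolding G_def using N(4) by (intro image_subsetI subspace_add[OF N(1)]) blast+
  have formG: "form x (G y) = form x y - form (K x) (K y)" if "x \<in> N" "y \<in> N" for x y
    using form_K_K[of y x] that N(3) by (auto simp: G_def form_simps form_sym[of x] form_sym[of "K x"])
  have sym: "form (G x) y = form x (G y)" if "x \<in> N" "y \<in> N" for x y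
    using formG[OF that] formG[OF that(2,1)] form_sym by metis
  have "\<exists>x l. x \<in> N \<and> x \<noteq> 0 \<and> K (K x) = - l *\<^sub>R x"
  proof (cases "\<exists>x\<in>N. form x (G x) > 0")
    case True
    then obtain x0 where x0: "x0 \<in> N" "form x0 (G x0) > 0" by blast
    have "compact_on N G" unfolding G_def[abs_def] using compact_on_subset[OF compact_on_1_plus_K2 N(3)] .
    from max_eigenvector[OF N(1,2) G_bl GN this sym x0]
    obtain x g where x: "x \<in> N" "x \<noteq> 0" "G x = g *\<^sub>R x" by metis
    then have "K (K x) = - (1 - g) *\<^sub>R x" unfolding G_def by (simp add: algebra_simps)
    with x show ?thesis by blast
  next
    case False
    have z: "form x (G x) = 0" if "x \<in> N" for x
      using False that formG[OF that that] q_K_le[of x] by force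
    obtain x where x: "x \<in> N" "x \<noteq> 0" using N(5) subspace_0[OF N(1)] by blast
    have Gx: "G x \<in> N" using GN x by blast
    \<comment> \<open>Polarisation with the vector \<open>G x\<close>: a vanishing quadratic form
      forces \<open>q (G x) = 0\<close>.\<close>
    have "form (x + G x) (G (x + G x)) = 0" by (intro z subspace_add[OF N(1)] x Gx)
    moreover have "G (x + G x) = G x + G (G x)" using G_bl by (simp add: bounded_linear.linear linear_add)
    ultimately have "2 * form (G x) (G x) = 0"
      using z[OF x(1)] z[OF Gx] sym[OF x(1) Gx] by (simp add: form_simps)
    then have "G x = 0" using q_eq_0 by simp
    then have "K (K x) = - 1 *\<^sub>R x" unfolding G_def by (simp add: add_eq_0_iff)
    with x show ?thesis by blast
  qed
  then obtain x l where x: "x \<in> N" "x \<noteq> 0" "K (K x) = - l *\<^sub>R x" by blast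
  have xZ: "x \<in> Z" using x(1) N(3) by blast
  have "l * q x = q (K x)" using form_K_K[OF xZ xZ] by (simp add: x(3) form_simps)
  moreover have "q (K x) > 0" using K_eq_0[OF xZ] x(2) by (intro q_pos) auto
  ultimately have l: "l > 0" using q_pos[OF x(2)] by (metis zero_less_mult_pos2)
  define x' where "x' = (1 / sqrt (q x)) *\<^sub>R x"
  show ?thesis
  proof (rule that)
    show "x' \<in> N" unfolding x'_def by (rule subspace_scale[OF N(1) x(1)])
    show "q x' = 1" unfolding x'_def using q_pos[OF x(2)] by (simp add: form_simps)
    show "K (K x') = - l *\<^sub>R x'" unfolding x'_def by (simp add: linear_scale[OF K_lin] x(3))
  qed (rule l)
qed

text \<open>Each member \<open>x\<close> stands for the plane spanned by \<open>x\<close> and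
  \<open>K x\<close>; planes of distinct members are orthogonal for the form. Inside a plane
  orthogonality is automatic, since \<open>K\<close> is skew.\<close>

definition adapted :: "'k set \<Rightarrow> bool" where
  "adapted X \<longleftrightarrow> X \<subseteq> Z \<and> (\<forall>x\<in>X. q x = 1 \<and> (\<exists>l>0. K (K x) = - l *\<^sub>R x)) \<and>
     (\<forall>x\<in>X. \<forall>y\<in>X. x \<noteq> y \<longrightarrow> form x y = 0 \<and> form x (K y) = 0)"

lemma adaptedD:
  assumes "adapted X" "x \<in> X"
  shows "x \<in> Z" "q x = 1" "\<exists>l>0. K (K x) = - l *\<^sub>R x"
    "y \<in> X \<Longrightarrow> x \<noteq> y \<Longrightarrow> form x y = 0" "y \<in> X \<Longrightarrow> x \<noteq> y \<Longrightarrow> form x (K y) = 0"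
  using assms unfolding adapted_def by (simp_all add: subset_iff)

text \<open>Zorn's lemma covers finite- and infinite-dimensional \<open>Z\<close> at once. The
  vectors orthogonal to all planes form a closed \<open>K\<close>-invariant subspace; were it
  nonzero, \<open>K2_eigenvector\<close> would supply a further member.\<close>

lemma maximal_adapted:
  obtains X where "adapted X" "\<And>z. z \<in> Z \<Longrightarrow> (\<And>x. x \<in> X \<Longrightarrow> form x z = 0 \<and> form (K x) z = 0) \<Longrightarrow> z = 0"
proof -
  have "\<exists>M\<in>Collect adapted. \<forall>X\<in>Collect adapted. M \<subseteq> X \<longrightarrow> X = M"
  proof (rule subset_Zorn')
    fix C assume C: "subset.chain (Collect adapted) C"
    then have ad: "\<And>X. X \<in> C \<Longrightarrow> adapted X"
      and comp: "\<And>X Y. X \<in> C \<Longrightarrow> Y \<in> C \<Longrightarrow> X \<subseteq> Y \<or> Y \<subseteq> X"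
      unfolding subset_chain_def by auto
    have tot: "\<exists>X\<in>C. x \<in> X \<and> y \<in> X" if "x \<in> \<Union>C" "y \<in> \<Union>C" for x y
      using that comp by (meson UnionE subsetD)
    show "\<Union>C \<in> Collect adapted"
      unfolding adapted_def mem_Collect_eq
    proof (intro conjI ballI impI)
      show "\<Union>C \<subseteq> Z" using adaptedD(1)[OF ad] by blast
      show "q x = 1" "\<exists>l>0. K (K x) = - l *\<^sub>R x" if "x \<in> \<Union>C" for x
        using that adaptedD(2,3)[OF ad] by (auto elim!: UnionE)
      show "form x y = 0" "form x (K y) = 0" if "x \<in> \<Union>C" "y \<in> \<Union>C" "x \<noteq> y" for x y
        using tot[OF that(1,2)] adaptedD(4,5)[OF ad] that(3) by blast+
    qed
  qed
  then obtain M where M: "adapted M" and max: "\<And>X. adapted X \<Longrightarrow> M \<subseteq> X \<Longrightarrow> X = M"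
    unfolding Bex_def Ball_def mem_Collect_eq by (elim exE conjE) (rule that, auto)
  define N where "N = {z \<in> Z. \<forall>x\<in>M. form x z = 0 \<and> form (K x) z = 0}"
  have N_sub: "subspace N"
    unfolding N_def subspace_def
    by (auto simp: form_simps subspace_0[OF Z(1)] intro: subspace_add[OF Z(1)] subspace_scale[OF Z(1)])
  have "N = Z \<inter> (\<Inter>x\<in>M. {z. form x z = 0} \<inter> {z. form (K x) z = 0})" unfolding N_def by blast
  moreover have "closed {z. form x z = 0}" for x
    unfolding form_def by (intro closed_Collect_eq continuous_intros linear_continuous_on S_bl)
  ultimately have N_cl: "closed N" using Z(2) by (simp add: closed_INT closed_Int)
  have MZ: "x \<in> Z" if "x \<in> M" for x by (rule adaptedD(1)[OF M that])
  have K_N: "K z \<in> N" if z: "z \<in> N" for z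
    unfolding N_def
  proof (intro CollectI conjI ballI)
    show "K z \<in> Z" by (rule K)
    fix x assume x: "x \<in> M"
    have zZ: "z \<in> Z" and z0: "form x z = 0" "form (K x) z = 0" using z x by (auto simp: N_def)
    show "form x (K z) = 0" using form_K_skew[OF MZ[OF x] zZ] z0 by simp
    obtain l where l: "K (K x) = - l *\<^sub>R x" using adaptedD(3)[OF M x] by blast
    show "form (K x) (K z) = 0" using form_K_K[OF MZ[OF x] zZ] z0 by (simp add: l form_simps)
  qed
  have "N = {0}"
  proof (rule ccontr)
    assume "N \<noteq> {0}"
    have NZ: "N \<subseteq> Z" unfolding N_def by blast
    have "K ` N \<subseteq> N" using K_N by blast
    obtain x l where x: "x \<in> N" "q x = 1" "l > 0" "K (K x) = - l *\<^sub>R x"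
      using K2_eigenvector[OF N_sub N_cl NZ \<open>K ` N \<subseteq> N\<close> \<open>N \<noteq> {0}\<close>] .
    have xn: "x \<notin> M" using x(1,2) by (auto simp: N_def)
    have o: "form y x = 0" "form x y = 0" "form x (K y) = 0" "form y (K x) = 0" if "y \<in> M" for y
      using x(1) K_N[OF x(1)] that by (auto simp: N_def form_sym[of x])
    have "adapted (insert x M)"
      unfolding adapted_def
    proof (intro conjI ballI impI)
      show "insert x M \<subseteq> Z" using MZ x(1) NZ by blast
      show "q y = 1" "\<exists>l>0. K (K y) = - l *\<^sub>R y" if "y \<in> insert x M" for y
        using that adaptedD(2,3)[OF M] x(2-4) by blast+
      show "form y z = 0" "form y (K z) = 0" if "y \<in> insert x M" "z \<in> insert x M" "y \<noteq> z" for y z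
        using that adaptedD(4,5)[OF M] o by blast+
    qed
    from max[OF this] xn show False by blast
  qed
  then have "z = 0" if "z \<in> Z" "\<And>x. x \<in> M \<Longrightarrow> form x z = 0 \<and> form (K x) z = 0" for z
    using that unfolding N_def by blast
  with M show ?thesis by (rule that)
qed

text \<open>Form-orthonormal pairs \<open>(x, b x)\<close> with symplectic eigenvalue
  \<open>d x\<close>; the last clause is completeness. The uniform bound \<open>C\<close> is what
  makes the operators built from the frame bounded.\<close>

definition symplectic_frame :: "'k set \<Rightarrow> ('k \<Rightarrow> 'k) \<Rightarrow> ('k \<Rightarrow> real) \<Rightarrow> real \<Rightarrow> bool" where
  "symplectic_frame X b d C \<longleftrightarrow> X \<subseteq> Z \<and> (\<forall>x\<in>X. b x \<in> Z \<and> 1 \<le> d x \<and> d x \<le> C) \<and>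
     (\<forall>x\<in>X. \<forall>y\<in>X. form x y = (if x = y then 1 else 0) \<and>
        form (b x) (b y) = (if x = y then 1 else 0) \<and> form x (b y) = 0) \<and>
     (\<forall>x\<in>X. \<forall>z\<in>Z. form x z = d x * inner (J (b x)) z \<and> form (b x) z = - d x * inner (J x) z) \<and>
     (\<forall>z\<in>Z. (\<forall>x\<in>X. form x z = 0 \<and> form (b x) z = 0) \<longrightarrow> z = 0)"

lemma symplectic_frame_exists: "\<exists>X b d C. symplectic_frame X b d C"
proof -
  obtain X where X: "adapted X"
    and Xmax: "\<And>z. z \<in> Z \<Longrightarrow> (\<And>x. x \<in> X \<Longrightarrow> form x z = 0 \<and> form (K x) z = 0) \<Longrightarrow> z = 0"
    using maximal_adapted by blast
  have XZ: "x \<in> Z" if "x \<in> X" for x by (rule adaptedD(1)[OF X that])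
  have qX: "q x = 1" if "x \<in> X" for x by (rule adaptedD(2)[OF X that])
  have K2: "K (K x) = - q (K x) *\<^sub>R x" if x: "x \<in> X" for x
  proof -
    obtain l where l: "K (K x) = - l *\<^sub>R x" using adaptedD(3)[OF X x] by blast
    have "l = q (K x)" using form_K_K[OF XZ XZ, OF x x] qX[OF x] by (simp add: l form_simps)
    then show ?thesis using l by simp
  qed
  have orth: "form x y = 0" "form x (K y) = 0" if "x \<in> X" "y \<in> X" "x \<noteq> y" for x y
    using adaptedD(4,5)[OF X that(1)] that(2,3) by auto
  have orthK: "form x (K y) = 0" if "x \<in> X" "y \<in> X" for x y
    using orth(2)[OF that] K(2)[OF XZ, OF that(1), of x] form_sym[of x "K x"] by (cases "x = y") auto
  obtain C where C: "C > 0" "\<And>x y. \<bar>form x y\<bar> \<le> C * norm x * norm y" using form_bounded by blast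
  \<comment> \<open>Since K^2 x = - q (K x) x, this \<open>d x\<close> gives
    \<open>q (b x) = 1\<close>, and the sign in \<open>b x\<close> is the one for which
    \<open>form x z = d x * inner (J (b x)) z\<close>.\<close>
  define d where "d x = 1 / sqrt (q (K x))" for x
  define b where "b x = - d x *\<^sub>R K x" for x
  have qK: "0 < q (K x)" "q (K x) \<le> 1" "\<delta> / C ^ 3 \<le> q (K x)" if x: "x \<in> X" for x
  proof -
    have x0: "x \<noteq> 0" using qX[OF x] by (auto simp: form_simps)
    then show "0 < q (K x)" using K_eq_0[OF XZ[OF x]] q_pos by blast
    show "q (K x) \<le> 1" using q_K_le[of x] qX[OF x] by simp
    \<comment> \<open>Testing \<open>K x\<close> against \<open>J x\<close> bounds |x| by C |K x|.
      Combined with 1 = q x \<le> C |x|^2 and coercivity this yields \<delta> / C^3, hence the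
      uniform upper bound for \<open>d\<close>.\<close>
    have "(norm x)\<^sup>2 = form (K x) (J x)"
      using K(2)[OF J_in_Z[OF XZ[OF x]], of x] by (simp add: J_isometry power2_norm_eq_inner)
    also have "\<dots> \<le> C * norm (K x) * norm x" using C(2)[of "K x" "J x"] by simp
    finally have 1: "norm x \<le> C * norm (K x)" using x0 by (simp add: power2_eq_square)
    have "1 \<le> C * (norm x)\<^sup>2" using C(2)[of x x] qX[OF x] by (simp add: power2_eq_square mult.assoc)
    also have "\<dots> \<le> C * (C * norm (K x))\<^sup>2" using 1 C(1) by (intro mult_left_mono power_mono) auto
    also have "\<dots> = C ^ 3 / \<delta> * (\<delta> * (norm (K x))\<^sup>2)"
      using delta_pos by (simp add: power2_eq_square power3_eq_cube)
    also have "\<dots> \<le> C ^ 3 / \<delta> * q (K x)"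
      using form_coercive[of "K x"] C(1) delta_pos by (intro mult_left_mono) auto
    finally show "\<delta> / C ^ 3 \<le> q (K x)" using C(1) delta_pos by (simp add: field_simps)
  qed
  have dpos: "d x > 0" and d2: "d x * d x * q (K x) = 1" if "x \<in> X" for x
    unfolding d_def using qK(1)[OF that] by (auto simp: field_simps)
  have "symplectic_frame X b d (1 / sqrt (\<delta> / C ^ 3))"
    unfolding symplectic_frame_def
  proof (intro conjI ballI impI)
    show "X \<subseteq> Z" using XZ by blast
    show "b x \<in> Z" if "x \<in> X" for x unfolding b_def by (intro subspace_scale[OF Z(1)] K)
    show "1 \<le> d x" if "x \<in> X" for x
      unfolding d_def using qK[OF that] by simp
    show "d x \<le> 1 / sqrt (\<delta> / C ^ 3)" if "x \<in> X" for x
      unfolding d_def using qK[OF that] delta_pos C(1) by (intro divide_left_mono) auto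
    show "form x y = (if x = y then 1 else 0)" if "x \<in> X" "y \<in> X" for x y
      using qX that orth(1) by auto
    show "form x (b y) = 0" if "x \<in> X" "y \<in> X" for x y
      unfolding b_def using orthK[OF that] by (simp add: form_simps)
    show "form (b x) (b y) = (if x = y then 1 else 0)" if "x \<in> X" "y \<in> X" for x y
    proof -
      have "form (K x) (K y) = q (K x) * form x y"
      proof -
        have "form (K (K x)) y = - q (K x) * form x y"
          using K2[OF that(1)] form_simps(5) by metis
        then show ?thesis using form_K_K[OF XZ XZ, OF that] by linarith
      qed
      moreover have "form (b x) (b y) = d x * d y * form (K x) (K y)"
        unfolding b_def by (simp add: form_simps)
      ultimately have "form (b x) (b y) = d x * d y * q (K x) * form x y" by simp
      then show ?thesis
        using d2[OF that(1)] orth(1)[OF that] qX[OF that(1)] by (cases "x = y") simp_all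
    qed
    show "form (b x) z = - d x * inner (J x) z" if "x \<in> X" "z \<in> Z" for x z
      unfolding b_def using K(2)[OF that(2)] by (simp add: form_simps)
    show "form x z = d x * inner (J (b x)) z" if "x \<in> X" "z \<in> Z" for x z
    proof -
      have "inner (J (b x)) z = - d x * form (K (K x)) z"
        unfolding b_def using K(2)[OF that(2)] by (simp add: linear_scale[OF J_lin] linear_neg[OF J_lin])
      also have "form (K (K x)) z = - q (K x) * form x z"
        using K2[OF that(1)] form_simps(5) by metis
      finally show ?thesis using d2[OF that(1)] by (simp add: mult.assoc[symmetric])
    qed
    show "z = 0" if z: "z \<in> Z" "\<forall>x\<in>X. form x z = 0 \<and> form (b x) z = 0" for z
    proof (rule Xmax[OF z(1)])
      fix x assume x: "x \<in> X"
      have "form (b x) z = - d x * form (K x) z" unfolding b_def by (simp only: form_simps)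
      then show "form x z = 0 \<and> form (K x) z = 0" using z(2) x dpos[OF x] by simp
    qed
  qed
  then show ?thesis by blast
qed

end


section \<open>Eigenvalues of compact perturbations of the identity\<close>

text \<open>Bessel's inequality makes the squares summable: orthonormal sequences are weakly
  null.\<close>

lemma orthonormal_sequence_inner_tendsto_0:
  fixes f :: "nat \<Rightarrow> 'a::real_inner"
  assumes f: "\<And>k. norm (f k) = 1" "\<And>j k. j \<noteq> k \<Longrightarrow> inner (f j) (f k) = 0"
  shows "(\<lambda>k. inner g (f k)) \<longlonglongrightarrow> 0"
proof -
  have inj: "inj f"
  proof (rule injI)
    fix j k assume "f j = f k"
    then show "j = k" using f(1)[of j] f(2)[of j k] by (metis norm_eq_1 zero_neq_one)
  qed
  have "(\<Sum>k<n. (inner g (f k))\<^sup>2) \<le> (norm g)\<^sup>2" for n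
  proof -
    have "(\<Sum>b\<in>f ` {..<n}. (inner b g)\<^sup>2) \<le> (norm g)\<^sup>2"
      by (rule bessel) (auto simp: pairwise_def Linear_Algebra.orthogonal_def f inj_eq[OF inj])
    then show ?thesis
      by (simp add: sum.reindex inj_on_subset[OF inj] inner_commute)
  qed
  then have "summable (\<lambda>k. (inner g (f k))\<^sup>2)" by (intro summableI_nonneg_bounded) auto
  then have "(\<lambda>k. (inner g (f k))\<^sup>2) \<longlonglongrightarrow> 0" by (rule summable_LIMSEQ_zero)
  then have "(\<lambda>k. sqrt ((inner g (f k))\<^sup>2)) \<longlonglongrightarrow> sqrt 0" by (rule tendsto_real_sqrt)
  then show ?thesis by (simp add: tendsto_rabs_zero_iff)
qed

locale compact_perturbation =
  fixes D :: "'h::{real_inner, complete_space} \<Rightarrow> 'h"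
  assumes D_bl: "bounded_linear D"
    and D_sym: "inner (D x) y = inner x (D y)"
    and D_compact: "compact_on UNIV (\<lambda>x. D x - x)"
begin

lemmas D_lin = bounded_linear.linear[OF D_bl]

lemma eigenvectors_orthogonal:
  assumes "D x = a *\<^sub>R x" "D y = b *\<^sub>R y" "a \<noteq> b"
  shows "inner x y = 0"
  using D_sym[of x y] assms by simp

text \<open>On each member \<open>D - I\<close> has norm at least c - 1, but compactness with
  \<epsilon> = (c - 1) / 2 bounds it by (c - 1) / 2 plus a null sequence. So eigenvalues above 1 can
  accumulate only at 1.\<close>

lemma no_infinite_eigensequence:
  assumes "c > 1" "\<And>k::nat. norm (f k) = 1" "\<And>j k. j \<noteq> k \<Longrightarrow> inner (f j) (f k) = 0"
    "\<And>k. D (f k) = a k *\<^sub>R f k" "\<And>k. a k \<ge> c"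
  shows False
proof -
  obtain fs where fs: "\<And>x. norm (D x - x) \<le> (c - 1) / 2 * norm x + (\<Sum>g\<leftarrow>fs. \<bar>inner g x\<bar>)"
    using compact_onD[OF D_compact, of "(c - 1) / 2"] assms(1) by auto
  have "(\<lambda>k. \<Sum>g\<leftarrow>fs. \<bar>inner g (f k)\<bar>) \<longlonglongrightarrow> 0"
  proof (induction fs)
    case (Cons g fs)
    have "(\<lambda>k. \<bar>inner g (f k)\<bar>) \<longlonglongrightarrow> 0"
      by (rule tendsto_rabs_zero[OF orthonormal_sequence_inner_tendsto_0[OF assms(2,3)]])
    from tendsto_add[OF this Cons.IH] show ?case by simp
  qed simp
  moreover have "(c - 1) / 2 \<le> (\<Sum>g\<leftarrow>fs. \<bar>inner g (f k)\<bar>)" for k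
  proof -
    have "D (f k) - f k = (a k - 1) *\<^sub>R f k" by (simp add: assms(4) algebra_simps)
    then have "norm (D (f k) - f k) = a k - 1" using assms(1) assms(5)[of k] assms(2)[of k] by simp
    then have "a k - 1 \<le> (c - 1) / 2 + (\<Sum>g\<leftarrow>fs. \<bar>inner g (f k)\<bar>)"
      using fs[of "f k"] assms(2)[of k] by simp
    then show ?thesis using assms(5)[of k] by (simp add: field_simps)
  qed
  ultimately have "(c - 1) / 2 \<le> 0" by (intro LIMSEQ_le_const) auto
  then show False using assms(1) by simp
qed

text \<open>\<open>max_eigenvector\<close> for \<open>D - I\<close> and the ambient inner
  product.\<close>

lemma max_eigenvector_above_1:
  assumes N: "subspace N" "closed N" "D ` N \<subseteq> N" and u: "u \<in> N" "inner u u < inner u (D u)"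
  obtains x c where "x \<in> N" "norm x = 1" "c > 1" "D x = c *\<^sub>R x"
    "\<And>y. y \<in> N \<Longrightarrow> inner y (D y) \<le> c * inner y y"
proof -
  interpret coercive_form "\<lambda>x::'h. x" 1 by (rule coercive_form_id)
  have G: "bounded_linear (\<lambda>x. D x - x)" by (intro bounded_linear_sub D_bl bounded_linear_ident)
  have GN: "(\<lambda>x. D x - x) ` N \<subseteq> N" using N(3) by (intro image_subsetI subspace_diff[OF N(1)]) blast+
  have sym: "form (D x - x) y = form x (D y - y)" for x y
    by (simp add: form_def inner_simps D_sym)
  have pos: "form u (D u - u) > 0" using u(2) by (simp add: form_def inner_simps)
  obtain x g where x: "x \<in> N" "x \<noteq> 0" "g > 0" "D x - x = g *\<^sub>R x"
      "\<And>y. y \<in> N \<Longrightarrow> form y (D y - y) \<le> g * q y"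
    using max_eigenvector[OF N(1,2) G GN compact_on_subset[OF D_compact subset_UNIV] sym u(1) pos] by blast
  have Dx: "D x = (1 + g) *\<^sub>R x" using x(4) by (simp add: algebra_simps)
  show ?thesis
  proof (rule that)
    show "(1 / norm x) *\<^sub>R x \<in> N" by (rule subspace_scale[OF N(1) x(1)])
    show "norm ((1 / norm x) *\<^sub>R x) = 1" using x(2) by simp
    show "1 + g > 1" using x(3) by simp
    show "D ((1 / norm x) *\<^sub>R x) = (1 + g) *\<^sub>R ((1 / norm x) *\<^sub>R x)"
      by (simp add: linear_scale[OF D_lin] Dx)
    show "inner y (D y) \<le> (1 + g) * inner y y" if "y \<in> N" for y
      using x(5)[OF that] by (simp add: form_def inner_simps algebra_simps)
  qed
qed

section \<open>Greedy extraction of the eigenvalues above 1\<close>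

definition orth :: "(nat \<Rightarrow> 'h) \<Rightarrow> nat set \<Rightarrow> 'h set" where
  "orth f I = {u. \<forall>j\<in>I. inner (f j) u = 0}"

lemma orth_subspace: "subspace (orth f I)"
  by (auto simp: orth_def subspace_def inner_simps)

lemma orth_closed: "closed (orth f I)"
proof -
  have "orth f I = (\<Inter>j\<in>I. {u. inner (f j) u = 0})" by (auto simp: orth_def)
  then show ?thesis by (auto intro!: closed_INT closed_Collect_eq continuous_intros)
qed

lemma orth_invariant:
  assumes "\<And>j. j \<in> I \<Longrightarrow> \<exists>c. D (f j) = c *\<^sub>R f j"
  shows "D ` orth f I \<subseteq> orth f I"
proof (intro image_subsetI)
  fix u assume u: "u \<in> orth f I"
  have "inner (f j) (D u) = 0" if j: "j \<in> I" for j
  proof -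
    obtain c where "D (f j) = c *\<^sub>R f j" using assms j by blast
    then show ?thesis using u j D_sym[of "f j" u] by (simp add: orth_def)
  qed
  then show "D u \<in> orth f I" by (simp add: orth_def)
qed

definition exceeds :: "'h set \<Rightarrow> bool" where "exceeds N \<longleftrightarrow> (\<exists>u\<in>N. inner u u < inner u (D u))"

text \<open>The implication leaves \<open>r\<close> free once nothing exceeds 1 any more. A choice
  then exists at every stage, and one recursion produces finite and infinite lists alike.\<close>

definition greedy :: "(nat \<Rightarrow> 'h) \<Rightarrow> nat \<Rightarrow> 'h \<Rightarrow> bool" where
  "greedy f k r \<longleftrightarrow> (exceeds (orth f {..<k}) \<longrightarrow> r \<in> orth f {..<k} \<and> norm r = 1 \<and>
     (\<exists>c>1. D r = c *\<^sub>R r \<and> (\<forall>u\<in>orth f {..<k}. inner u (D u) \<le> c * inner u u)))"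

lemma exceeds_orth_antimono: "exceeds (orth f {..<k}) \<Longrightarrow> j \<le> k \<Longrightarrow> exceeds (orth f {..<j})"
  unfolding exceeds_def orth_def by force

lemma greedy_sequence: "\<exists>f. \<forall>k. greedy f k (f k)"
proof (rule dependent_wellorder_choice)
  show "greedy f x r = greedy g x r" if "\<And>y. y < x \<Longrightarrow> f y = g y" for r f g x
    using that by (simp add: greedy_def orth_def)
next
  fix k f assume IH: "\<And>y. y < k \<Longrightarrow> greedy f y (f y)"
  show "\<exists>r. greedy f k r"
  proof (cases "exceeds (orth f {..<k})")
    case True
    have eig: "\<exists>c. D (f j) = c *\<^sub>R f j" if "j \<in> {..<k}" for j
      using IH[of j] exceeds_orth_antimono[OF True, of j] that by (auto simp: greedy_def)
    obtain u where u: "u \<in> orth f {..<k}" "inner u u < inner u (D u)"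
      using True unfolding exceeds_def by blast
    obtain x c where "x \<in> orth f {..<k}" "norm x = 1" "c > 1" "D x = c *\<^sub>R x"
      "\<And>y. y \<in> orth f {..<k} \<Longrightarrow> inner y (D y) \<le> c * inner y y"
      using max_eigenvector_above_1[OF orth_subspace orth_closed orth_invariant[OF eig] u] by blast
    then show ?thesis unfolding greedy_def by blast
  qed (simp add: greedy_def)
qed

text \<open>\<open>R\<close> is the first stage at which the form of \<open>D\<close> no longer
  exceeds the identity on the remaining complement. The last two conjuncts record the extremality of
  the choices, from which monotonicity and completeness of the list will follow.\<close>

lemma greedy_eigenvectors:
  "\<exists>(R::enat) f c.
    (\<forall>k. enat k < R \<longrightarrow> norm (f k) = 1 \<and> D (f k) = c k *\<^sub>R f k \<and> c k > 1) \<and>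
    (\<forall>j k. j < k \<longrightarrow> enat k < R \<longrightarrow> inner (f j) (f k) = 0) \<and>
    (\<forall>k u. enat k < R \<longrightarrow> (\<forall>j<k. inner (f j) u = 0) \<longrightarrow> inner u (D u) \<le> c k * inner u u) \<and>
    (\<forall>m u. R = enat m \<longrightarrow> (\<forall>j<m. inner (f j) u = 0) \<longrightarrow> inner u (D u) \<le> inner u u)"
proof -
  obtain f where f: "\<And>k. greedy f k (f k)" using greedy_sequence by blast
  define E where "E k = exceeds (orth f {..<k})" for k
  have E_anti: "E k \<Longrightarrow> j \<le> k \<Longrightarrow> E j" for j k unfolding E_def by (rule exceeds_orth_antimono)
  define R where "R = (if \<exists>m. \<not> E m then enat (LEAST m. \<not> E m) else \<infinity>)"
  have E_R: "E k \<longleftrightarrow> enat k < R" for k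
  proof (cases "\<exists>m. \<not> E m")
    case True
    then have "\<not> E (LEAST m. \<not> E m)" by (rule LeastI_ex)
    then have "E k \<longleftrightarrow> k < (LEAST m. \<not> E m)"
      using E_anti not_less_Least[of k "\<lambda>m. \<not> E m"] by (meson not_le)
    then show ?thesis using True by (simp add: R_def)
  qed (simp add: R_def)
  have "\<forall>k. \<exists>c. E k \<longrightarrow> c > 1 \<and> D (f k) = c *\<^sub>R f k \<and> (\<forall>u\<in>orth f {..<k}. inner u (D u) \<le> c * inner u u)"
    using f unfolding greedy_def E_def by blast
  then obtain c where c: "\<And>k. E k \<Longrightarrow> c k > 1 \<and> D (f k) = c k *\<^sub>R f k \<and>
      (\<forall>u\<in>orth f {..<k}. inner u (D u) \<le> c k * inner u u)" by metis
  have f': "f k \<in> orth f {..<k}" "norm (f k) = 1" if "E k" for k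
    using f[of k] that unfolding greedy_def E_def by blast+
  show ?thesis
  proof (intro exI[of _ R] exI[of _ f] exI[of _ c] conjI allI impI)
    show "norm (f k) = 1" "D (f k) = c k *\<^sub>R f k" "c k > 1" if "enat k < R" for k
      using c f' E_R that by blast+
    show "inner (f j) (f k) = 0" if "j < k" "enat k < R" for j k
      using f'(1)[of k] E_R that by (simp add: orth_def)
    show "inner u (D u) \<le> c k * inner u u" if "enat k < R" "\<forall>j<k. inner (f j) u = 0" for k u
      using c[of k] E_R that by (simp add: orth_def)
    show "inner u (D u) \<le> inner u u" if "R = enat m" "\<forall>j<m. inner (f j) u = 0" for m u
    proof -
      have "\<not> E m" using E_R[of m] that(1) by simp
      moreover have "u \<in> orth f {..<m}" using that(2) by (simp add: orth_def)
      ultimately show ?thesis unfolding E_def exceeds_def by (meson not_le)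
    qed
  qed
qed

text \<open>Indices start at 0 and satisfy \<open>enat k < R\<close>, whereas
  \<open>eigenvalues_above_1\<close> counts from 1 and includes \<open>R\<close>.\<close>

definition eigensystem :: "enat \<Rightarrow> (nat \<Rightarrow> 'h) \<Rightarrow> (nat \<Rightarrow> real) \<Rightarrow> bool" where
  "eigensystem R f c \<longleftrightarrow>
    (\<forall>k. enat k < R \<longrightarrow> norm (f k) = 1 \<and> D (f k) = c k *\<^sub>R f k \<and> c k > 1) \<and>
    (\<forall>j k. j \<noteq> k \<longrightarrow> enat j < R \<longrightarrow> enat k < R \<longrightarrow> inner (f j) (f k) = 0) \<and>
    (\<forall>j k. j \<le> k \<longrightarrow> enat k < R \<longrightarrow> c k \<le> c j) \<and>
    (\<forall>e>1. finite {k. enat k < R \<and> c k = e} \<and>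
       {x. D x = e *\<^sub>R x} = span (f ` {k. enat k < R \<and> c k = e}))"

lemma eigensystemD:
  assumes "eigensystem R f c"
  shows "enat k < R \<Longrightarrow> norm (f k) = 1 \<and> D (f k) = c k *\<^sub>R f k \<and> c k > 1"
    and "j \<noteq> k \<Longrightarrow> enat j < R \<Longrightarrow> enat k < R \<Longrightarrow> inner (f j) (f k) = 0"
    and "j \<le> k \<Longrightarrow> enat k < R \<Longrightarrow> c k \<le> c j"
    and "e > 1 \<Longrightarrow> finite {k. enat k < R \<and> c k = e}"
    and "e > 1 \<Longrightarrow> {x. D x = e *\<^sub>R x} = span (f ` {k. enat k < R \<and> c k = e})"
  using assms unfolding eigensystem_def by simp_all

text \<open>The point is completeness of the greedy list. An eigenvector for e > 1, minus its
  projection to the listed ones, is orthogonal to every \<open>f k\<close>; extremality at a stage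
  where the eigenvalues have dropped below e, or at the final stage, forces it to vanish.\<close>

lemma eigensystem_exists: "\<exists>R f c. eigensystem R f c"
proof -
  obtain R f c where sys:
      "(\<forall>k. enat k < R \<longrightarrow> norm (f k) = 1 \<and> D (f k) = c k *\<^sub>R f k \<and> c k > 1) \<and>
       (\<forall>j k. j < k \<longrightarrow> enat k < R \<longrightarrow> inner (f j) (f k) = 0) \<and>
       (\<forall>k u. enat k < R \<longrightarrow> (\<forall>j<k. inner (f j) u = 0) \<longrightarrow> inner u (D u) \<le> c k * inner u u) \<and>
       (\<forall>m u. R = enat m \<longrightarrow> (\<forall>j<m. inner (f j) u = 0) \<longrightarrow> inner u (D u) \<le> inner u u)"
    using greedy_eigenvectors by (elim exE)
  have f: "norm (f k) = 1 \<and> D (f k) = c k *\<^sub>R f k \<and> c k > 1" if "enat k < R" for k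
    using sys that by simp
  have f0: "inner (f j) (f k) = 0" if "j < k" "enat k < R" for j k using sys that by simp
  have top: "inner u (D u) \<le> c k * inner u u" if "enat k < R" "\<And>j. j < k \<Longrightarrow> inner (f j) u = 0" for k u
    using sys that by simp
  have bot: "inner u (D u) \<le> inner u u" if "R = enat m" "\<And>j. j < m \<Longrightarrow> inner (f j) u = 0" for m u
    using sys that by simp
  have less: "enat j < R" if "j \<le> k" "enat k < R" for j k using that by (meson enat_ord_simps(1) le_less_trans)
  have orth: "inner (f j) (f k) = 0" if "j \<noteq> k" "enat j < R" "enat k < R" for j k
    using f0[of j k] f0[of k j] that by (metis inner_commute nat_neq_iff)
  have anti: "c k \<le> c j" if "j \<le> k" "enat k < R" for j k
  proof -
    have "inner (f k) (D (f k)) \<le> c j * inner (f k) (f k)"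
    proof (rule top[OF less[OF that]])
      show "inner (f i) (f k) = 0" if "i < j" for i
        using f0[of i k] that \<open>j \<le> k\<close> \<open>enat k < R\<close> by simp
    qed
    moreover have "inner (f k) (f k) = 1" using f[OF that(2)] by (simp add: norm_eq_1)
    ultimately show ?thesis using f[OF that(2)] by simp
  qed
  \<comment> \<open>The implication covers both cases: either the list has ended before
    \<open>k\<close>, or its entry there is below \<open>e\<close>.\<close>
  have no_inf: "\<exists>k. enat k < R \<longrightarrow> c k < e" if "e > 1" for e
  proof (rule ccontr)
    assume "\<nexists>k. enat k < R \<longrightarrow> c k < e"
    then have "\<forall>k. enat k < R \<and> \<not> c k < e" by blast
    then have all: "enat k < R" "c k \<ge> e" for k by (simp_all add: not_less)
    show False by (rule no_infinite_eigensequence[OF that, of f c]) (use f orth all in blast)+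
  qed
  have fin: "finite {k. enat k < R \<and> c k \<ge> e}" if e: "e > 1" for e
  proof -
    obtain m where "enat m < R \<longrightarrow> c m < e" using no_inf[OF e] by blast
    have "k \<le> m" if k: "enat k < R" "c k \<ge> e" for k
    proof (rule ccontr)
      assume "\<not> k \<le> m"
      then have mk: "m \<le> k" by simp
      then show False using less[OF mk k(1)] anti[OF mk k(1)] k(2) \<open>enat m < R \<longrightarrow> c m < e\<close> by simp
    qed
    then have "{k. enat k < R \<and> c k \<ge> e} \<subseteq> {..m}" by blast
    then show ?thesis using finite_subset by blast
  qed
  have sp: "{x. D x = e *\<^sub>R x} = span (f ` {k. enat k < R \<and> c k = e})" if e: "e > 1" for e
  proof
    define I where "I = {k. enat k < R \<and> c k = e}"
    have finI: "finite I" unfolding I_def by (rule finite_subset[OF _ fin[OF e]]) auto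
    show "{x. D x = e *\<^sub>R x} \<subseteq> span (f ` {k. enat k < R \<and> c k = e})"
    proof
      fix x assume "x \<in> {x. D x = e *\<^sub>R x}"
      then have x: "D x = e *\<^sub>R x" by simp
      define p where "p = (\<Sum>k\<in>I. inner (f k) x *\<^sub>R f k)"
      define y where "y = x - p"
      have "D p = e *\<^sub>R p"
        unfolding p_def by (auto simp: linear_sum[OF D_lin] linear_scale[OF D_lin] scaleR_sum_right I_def f
            intro!: sum.cong)
      then have y: "D y = e *\<^sub>R y" unfolding y_def by (simp add: linear_diff[OF D_lin] x scaleR_diff_right)
      have y0: "inner (f k) y = 0" if k: "enat k < R" for k
      proof (cases "k \<in> I")
        case True
        have "inner (f k) p = (\<Sum>j\<in>I. if j = k then inner (f k) x else 0)"
          unfolding p_def inner_sum_right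
        proof (rule sum.cong[OF refl])
          fix j assume "j \<in> I"
          then have "enat j < R" by (simp add: I_def)
          moreover have "inner (f k) (f k) = 1" using f[OF k] by (simp add: norm_eq_1)
          ultimately show "inner (f k) (inner (f j) x *\<^sub>R f j) = (if j = k then inner (f k) x else 0)"
            using orth[of k j] k by simp
        qed
        then show ?thesis using finI True by (simp add: y_def inner_diff_right)
      next
        case False
        then show ?thesis using eigenvectors_orthogonal[of "f k" "c k" y e] f[OF k] y k by (simp add: I_def)
      qed
      have "y = 0"
      proof (rule ccontr)
        assume "y \<noteq> 0"
        then have yy: "inner y y > 0" by simp
        have le: "e * inner y y \<le> c k * inner y y" if "enat k < R" for k
          using top[OF that, of y] y0 less that y by (metis inner_scaleR_right less_imp_le)
        show False
        proof (cases R)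
          case (enat m)
          have "inner y (D y) \<le> inner y y" by (rule bot[OF enat]) (use y0 enat in simp)
          then show False using y yy e by simp
        next
          case infinity
          obtain k where "enat k < R \<longrightarrow> c k < e" using no_inf[OF e] by blast
          then show False using le[of k] infinity yy by simp
        qed
      qed
      then have "x = p" by (simp add: y_def)
      moreover have "p \<in> span (f ` {k. enat k < R \<and> c k = e})"
        unfolding p_def I_def by (intro span_sum span_scale span_base imageI)
      ultimately show "x \<in> span (f ` {k. enat k < R \<and> c k = e})" by simp
    qed
    show "span (f ` {k. enat k < R \<and> c k = e}) \<subseteq> {x. D x = e *\<^sub>R x}"
    proof (rule span_minimal)
      show "subspace {x. D x = e *\<^sub>R x}"
        by (rule subspaceI)
          (simp_all add: linear_add[OF D_lin] linear_scale[OF D_lin] linear_0[OF D_lin] scaleR_add_right scaleR_left_commute)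
      show "f ` {k. enat k < R \<and> c k = e} \<subseteq> {x. D x = e *\<^sub>R x}" using f by blast
    qed
  qed
  have "finite {k. enat k < R \<and> c k = e}" if "e > 1" for e
    by (rule finite_subset[OF _ fin[OF that]]) auto
  then have "eigensystem R f c"
    unfolding eigensystem_def using f orth anti sp by simp
  then show ?thesis by blast
qed

lemma edim_span_orthonormal:
  fixes f :: "nat \<Rightarrow> 'h"
  assumes "finite I" "\<And>k. k \<in> I \<Longrightarrow> norm (f k) = 1"
    "\<And>j k. j \<noteq> k \<Longrightarrow> j \<in> I \<Longrightarrow> k \<in> I \<Longrightarrow> inner (f j) (f k) = 0"
  shows "edim (span (f ` I)) = enat (card I)"
proof -
  have inj: "inj_on f I"
  proof (rule inj_onI)
    fix j k assume "j \<in> I" "k \<in> I" "f j = f k"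
    then show "j = k" using assms(2)[of j] assms(3)[of j k] by (metis norm_eq_1 zero_neq_one)
  qed
  have "independent (f ` I)"
  proof (rule pairwise_orthogonal_independent)
    show "pairwise orthogonal (f ` I)"
      using assms(3) by (auto simp: pairwise_def Linear_Algebra.orthogonal_def inj_on_eq_iff[OF inj])
    show "0 \<notin> f ` I" using assms(2) by (metis imageE norm_zero zero_neq_one)
  qed
  then have "dim (span (f ` I)) = card I"
    using dim_eq_card_independent card_image[OF inj] by (metis dim_span)
  moreover have "\<exists>B. finite B \<and> span (f ` I) \<subseteq> span B" using assms(1) by blast
  ultimately show ?thesis by (simp add: edim_def)
qed

lemma eigenvalues_above_1_exists: "\<exists>R d. eigenvalues_above_1 D R d"
proof -
  obtain R f c where sys: "eigensystem R f c" using eigensystem_exists by blast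
  note f = eigensystemD(1)[OF sys] and orth = eigensystemD(2)[OF sys] and anti = eigensystemD(3)[OF sys]
    and fin = eigensystemD(4)[OF sys] and sp = eigensystemD(5)[OF sys]
  \<comment> \<open>Position k of the eigenvalue list, counted from 1, is index k - 1 of the
    eigensystem.\<close>
  have shift: "enat k \<le> R \<longleftrightarrow> enat (k - 1) < R" if "1 \<le> k" for k
    using Suc_ile_eq[of "k - 1" R] that by simp
  have "ecard {k. 1 \<le> k \<and> enat k \<le> R \<and> c (k - 1) = e} = multiplicity_op D e" if e: "e > 1" for e
  proof -
    let ?I = "{k. enat k < R \<and> c k = e}"
    have "{k. 1 \<le> k \<and> enat k \<le> R \<and> c (k - 1) = e} = Suc ` ?I"
    proof (intro equalityI subsetI)
      fix k assume "k \<in> {k. 1 \<le> k \<and> enat k \<le> R \<and> c (k - 1) = e}"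
      then have "k = Suc (k - 1)" "k - 1 \<in> ?I" using shift by auto
      then show "k \<in> Suc ` ?I" by blast
    qed (auto simp: Suc_ile_eq)
    then have "ecard {k. 1 \<le> k \<and> enat k \<le> R \<and> c (k - 1) = e} = enat (card ?I)"
      using fin[OF e] by (simp add: ecard_def card_image)
    moreover have "multiplicity_op D e = enat (card ?I)"
      unfolding multiplicity_op_def sp[OF e]
      by (rule edim_span_orthonormal[OF fin[OF e]]) (use f orth in auto)
    ultimately show ?thesis by simp
  qed
  then have "eigenvalues_above_1 D R (\<lambda>k. c (k - 1))"
    unfolding eigenvalues_above_1_def using f anti shift by (auto simp: Suc_le_eq)
  then show ?thesis by blast
qed

text \<open>The list \<open>d\<close> is known only through order and multiplicities, while
  eigenvectors come from the greedy list. Equal finite multiplicities give a bijection of indices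
  for each eigenvalue, which rearranges the eigenvectors along \<open>d\<close>.\<close>

lemma eigenvalues_above_1_eigenvectors:
  assumes ev: "eigenvalues_above_1 D R d"
  obtains f where
    "\<And>k. 1 \<le> k \<Longrightarrow> enat k \<le> R \<Longrightarrow> norm (f k) = 1 \<and> D (f k) = d k *\<^sub>R f k"
    "\<And>j k. j \<noteq> k \<Longrightarrow> 1 \<le> j \<Longrightarrow> enat j \<le> R \<Longrightarrow> 1 \<le> k \<Longrightarrow> enat k \<le> R \<Longrightarrow> inner (f j) (f k) = 0"
    "\<And>k u. (\<And>j. 1 \<le> j \<Longrightarrow> j < k \<Longrightarrow> enat j \<le> R \<Longrightarrow> inner (f j) u = 0) \<Longrightarrow> 1 \<le> k \<Longrightarrow>
       inner u (D u) \<le> (if enat k \<le> R then d k else 1) * inner u u"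
proof -
  obtain R0 f c where sys: "eigensystem R0 f c" using eigensystem_exists by blast
  note f = eigensystemD(1)[OF sys] and orth = eigensystemD(2)[OF sys]
    and fin = eigensystemD(4)[OF sys] and sp = eigensystemD(5)[OF sys]
  define I where "I e = {k. 1 \<le> k \<and> enat k \<le> R \<and> d k = e}" for e
  define I0 where "I0 e = {k. enat k < R0 \<and> c k = e}" for e
  have d1: "d k > 1" if "1 \<le> k" "enat k \<le> R" for k
    using ev that unfolding eigenvalues_above_1_def by blast
  have danti: "d k \<le> d j" if "1 \<le> j" "j \<le> k" "enat k \<le> R" for j k
    using ev that unfolding eigenvalues_above_1_def by blast
  have "\<exists>h. bij_betw h (I e) (I0 e)" if e: "e > 1" for e
  proof -
    have "ecard (I e) = multiplicity_op D e"
      using ev e unfolding eigenvalues_above_1_def I_def by blast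
    also have "\<dots> = enat (card (I0 e))"
      unfolding multiplicity_op_def sp[OF e] I0_def
      by (rule edim_span_orthonormal[OF fin[OF e]]) (use f orth in auto)
    finally have "finite (I e)" "card (I e) = card (I0 e)"
      by (auto simp: ecard_def split: if_splits)
    then show ?thesis using fin[OF e] unfolding I0_def by (intro finite_same_card_bij) auto
  qed
  then obtain h where h: "\<And>e. e > 1 \<Longrightarrow> bij_betw (h e) (I e) (I0 e)" by metis
  define f' where "f' k = f (h (d k) k)" for k
  have hk: "enat (h (d k) k) < R0" "c (h (d k) k) = d k" if k: "1 \<le> k" "enat k \<le> R" for k
  proof -
    have "k \<in> I (d k)" using k by (simp add: I_def)
    then have "h (d k) k \<in> I0 (d k)" using h[OF d1[OF k]] by (meson bij_betwE)
    then show "enat (h (d k) k) < R0" "c (h (d k) k) = d k" by (auto simp: I0_def)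
  qed
  have f1: "norm (f' k) = 1 \<and> D (f' k) = d k *\<^sub>R f' k" if k: "1 \<le> k" "enat k \<le> R" for k
    using f[OF hk(1)[OF k]] hk(2)[OF k] by (simp add: f'_def)
  have f2: "inner (f' j) (f' k) = 0" if jk: "j \<noteq> k" "1 \<le> j" "enat j \<le> R" "1 \<le> k" "enat k \<le> R" for j k
  proof (cases "d j = d k")
    case True
    have "j \<in> I (d k)" "k \<in> I (d k)" using jk True by (auto simp: I_def)
    then have "h (d k) j \<noteq> h (d k) k"
      using h[OF d1[OF jk(4,5)]] jk(1) by (meson bij_betw_def inj_on_eq_iff)
    then show ?thesis
      unfolding f'_def using orth hk(1)[OF jk(2,3)] hk(1)[OF jk(4,5)] True by simp
  next
    case False
    then show ?thesis using eigenvectors_orthogonal f1 jk by blast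
  qed
  have img: "f ` I0 e = f' ` I e" if e: "e > 1" for e
  proof -
    have "f' ` I e = f ` (h e ` I e)" by (auto simp: f'_def I_def image_image)
    then show ?thesis using h[OF e] by (simp add: bij_betw_def)
  qed
  have f3: "inner u (D u) \<le> (if enat k \<le> R then d k else 1) * inner u u"
    if u: "\<And>j. 1 \<le> j \<Longrightarrow> j < k \<Longrightarrow> enat j \<le> R \<Longrightarrow> inner (f' j) u = 0" and k: "1 \<le> k" for k u
  proof (rule ccontr)
    let ?t = "if enat k \<le> R then d k else 1"
    assume "\<not> ?thesis"
    then have gt: "?t * inner u u < inner u (D u)" by simp
    have t1: "?t \<ge> 1" using d1 k by (simp add: less_imp_le)
    define L where "L = {j. 1 \<le> j \<and> j < k \<and> enat j \<le> R}"
    have uN: "u \<in> orth f' L" using u by (simp add: orth_def L_def)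
    have inv: "D ` orth f' L \<subseteq> orth f' L" by (rule orth_invariant) (use f1 in \<open>auto simp: L_def\<close>)
    have "1 * inner u u \<le> ?t * inner u u" using t1 by (intro mult_right_mono) auto
    then have "inner u u < inner u (D u)" using gt by linarith
    \<comment> \<open>If the bound failed, a maximal eigenvector in the complement would have an
      eigenvalue \<open>a\<close> above the threshold. All listed vectors for \<open>a\<close> have
      an index below \<open>k\<close>, so this eigenvector would be orthogonal to its own
      eigenspace.\<close>
    from max_eigenvector_above_1[OF orth_subspace orth_closed inv uN this]
    obtain x a where x: "x \<in> orth f' L" "norm x = 1" "a > 1" "D x = a *\<^sub>R x"
      "\<And>y. y \<in> orth f' L \<Longrightarrow> inner y (D y) \<le> a * inner y y" by blast
    have "?t * inner u u < a * inner u u" using gt x(5)[OF uN] by linarith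
    then have a: "?t < a" by (meson inner_ge_zero less_le_not_le mult_right_mono not_le)
    have "x \<in> span (f' ` I a)" using sp[OF x(3)] x(4) img[OF x(3)] by (auto simp: I0_def)
    moreover have "I a \<subseteq> L"
    proof
      fix j assume j: "j \<in> I a"
      then have j': "1 \<le> j" "enat j \<le> R" "d j = a" by (auto simp: I_def)
      have "j < k"
      proof (cases "enat k \<le> R")
        case True
        then show ?thesis using a danti[OF k _ j'(2)] j' by (metis not_le)
      next
        case False
        then show ?thesis using j'(2) by (meson enat_ord_simps(1) not_le order_trans)
      qed
      then show "j \<in> L" using j' by (simp add: L_def)
    qed
    then have "inner x y = 0" if "y \<in> f' ` I a" for y
      using x(1) that by (auto simp: orth_def inner_commute)
    then have "\<forall>y\<in>f' ` I a. orthogonal x y" by (simp add: Linear_Algebra.orthogonal_def)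
    ultimately have "orthogonal x x" by (metis orthogonal_to_span)
    then show False using x(2) by (simp add: Linear_Algebra.orthogonal_def)
  qed
  show ?thesis by (rule that[OF f1 f2 f3])
qed

end


section \<open>Min-max characterisation of symplectic eigenvalues\<close>

text \<open>Induction on the conditions. When a kernel vector \<open>x1\<close> of the old
  conditions misses the new one, a second vector not proportional to it is found by omitting a basis
  vector that occurs in \<open>x1\<close>; a combination of the two meets the new condition.\<close>

lemma common_kernel:
  fixes B :: "'a::real_inner set"
  assumes "finite C" "finite B" "independent B" "card C < card B"
  shows "\<exists>x\<in>span B. x \<noteq> 0 \<and> (\<forall>v\<in>C. inner v x = 0)"
  using assms
proof (induction C arbitrary: B rule: finite_induct)
  case empty
  then obtain b where b: "b \<in> B" by fastforce
  then have "b \<noteq> 0" using empty.prems(2) dependent_zero by blast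
  then show ?case using b span_base by auto
next
  case (insert v C)
  have IH: "\<exists>x\<in>span (B - {b}). x \<noteq> 0 \<and> (\<forall>v\<in>C. inner v x = 0)" if "b \<in> B" for b
  proof (rule insert.IH)
    show "independent (B - {b})" using insert.prems(2) by (rule independent_mono) blast
    show "card C < card (B - {b})" using insert.prems insert.hyps that by simp
  qed (use insert.prems in simp)
  have "B \<noteq> {}" using insert.prems(3) by auto
  then obtain b where b: "b \<in> B" by blast
  obtain x1 where x1: "x1 \<in> span (B - {b})" "x1 \<noteq> 0" "\<forall>v\<in>C. inner v x1 = 0" using IH[OF b] by blast
  have x1B: "x1 \<in> span B" using x1(1) span_mono[of "B - {b}" B] by blast
  show ?case
  proof (cases "inner v x1 = 0")
    case True
    then show ?thesis using x1 x1B by auto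
  next
    case False
    obtain r where r: "x1 = (\<Sum>b\<in>B. r b *\<^sub>R b)" using x1B insert.prems(1) by (auto simp: span_finite)
    have "\<exists>b\<in>B. r b \<noteq> 0"
    proof (rule ccontr)
      assume "\<not> ?thesis"
      then have "x1 = 0" unfolding r by (intro sum.neutral) auto
      then show False using x1(2) by simp
    qed
    then obtain b1 where b1: "b1 \<in> B" "r b1 \<noteq> 0" by blast
    have notin: "x1 \<notin> span (B - {b1})"
    proof
      assume in_span: "x1 \<in> span (B - {b1})"
      have "x1 = r b1 *\<^sub>R b1 + (\<Sum>b\<in>B - {b1}. r b *\<^sub>R b)"
        unfolding r using insert.prems(1) b1(1) by (rule sum.remove)
      then have "r b1 *\<^sub>R b1 = x1 - (\<Sum>b\<in>B - {b1}. r b *\<^sub>R b)" by simp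
      also have "\<dots> \<in> span (B - {b1})"
        by (intro span_diff in_span span_sum span_scale span_base) auto
      finally have "(1 / r b1) *\<^sub>R (r b1 *\<^sub>R b1) \<in> span (B - {b1})" by (rule span_scale)
      then have "b1 \<in> span (B - {b1})" using b1(2) by simp
      then show False using insert.prems(2) b1(1) unfolding dependent_def by blast
    qed
    obtain x2 where x2: "x2 \<in> span (B - {b1})" "x2 \<noteq> 0" "\<forall>v\<in>C. inner v x2 = 0" using IH[OF b1(1)] by blast
    have x2B: "x2 \<in> span B" using x2(1) span_mono[of "B - {b1}" B] by blast
    define x where "x = inner v x2 *\<^sub>R x1 - inner v x1 *\<^sub>R x2"
    have "x \<noteq> 0"
    proof
      assume "x = 0"
      then have eq: "inner v x2 *\<^sub>R x1 = inner v x1 *\<^sub>R x2" by (simp add: x_def)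
      have v2: "inner v x2 \<noteq> 0" using eq False x2(2) by auto
      have "x1 = (1 / inner v x2) *\<^sub>R (inner v x2 *\<^sub>R x1)" using v2 by simp
      also have "\<dots> \<in> span (B - {b1})" unfolding eq by (intro span_scale x2)
      finally show False using notin by simp
    qed
    moreover have "x \<in> span B" unfolding x_def by (intro span_diff span_scale x1B x2B)
    moreover have "\<forall>w\<in>insert v C. inner w x = 0"
      using x1(3) x2(3) by (auto simp: x_def inner_diff_right)
    ultimately show ?thesis by blast
  qed
qed

text \<open>\<open>symp_lower S J Z k c\<close> expresses that the \<open>k\<close>-th symplectic eigenvalue of the form
  \<open>inner x (S x)\<close> on \<open>Z\<close> is at least \<open>c\<close>. The min-max principle behind it concerns the doubled
  eigenvalues \<open>1 / d\<^sub>k\<^sup>2\<close> of the pencil of \<open>J\<^sup>T S\<^sup>-\<^sup>1 J\<close> and \<open>S\<close>; the supremum over \<open>z\<close> replaces the inverse.\<close>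

definition symp_lower :: "('k::real_inner \<Rightarrow> 'k) \<Rightarrow> ('k \<Rightarrow> 'k) \<Rightarrow> 'k set \<Rightarrow> nat \<Rightarrow> real \<Rightarrow> bool" where
  "symp_lower S J Z k c \<longleftrightarrow> (\<exists>V. finite V \<and> independent V \<and> card V = 2 * k \<and> V \<subseteq> Z \<and>
     (\<forall>x\<in>span V. \<forall>z\<in>Z. (c * inner (J x) z)\<^sup>2 \<le> inner x (S x) * inner z (S z)))"

section \<open>Symplectic systems and the bounds they give\<close>

lemma (in coercive_form) form_orthogonal_independent:
  assumes "\<And>i. i \<in> I \<Longrightarrow> form (w i) (w i) \<noteq> 0" "\<And>i j. i \<in> I \<Longrightarrow> j \<in> I \<Longrightarrow> i \<noteq> j \<Longrightarrow> form (w i) (w j) = 0"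
  shows "inj_on w I" "independent (w ` I)"
proof -
  show inj: "inj_on w I" using assms by (metis inj_onI)
  show "independent (w ` I)"
    unfolding dependent_def
  proof
    assume "\<exists>a\<in>w ` I. a \<in> span (w ` I - {a})"
    then obtain i where i: "i \<in> I" "w i \<in> span (w ` I - {w i})" by blast
    have "span (w ` I - {w i}) \<subseteq> {x. form (w i) x = 0}"
    proof (rule span_minimal)
      show "w ` I - {w i} \<subseteq> {x. form (w i) x = 0}" using assms(2) i(1) by auto
      show "subspace {x. form (w i) x = 0}" by (rule subspaceI) (auto simp: form_simps)
    qed
    then show False using i assms(1) by blast
  qed
qed

context gaussian_form
begin

text \<open>Here \<open>inner (J (b i)) (a i) = 1\<close>, so \<open>a\<close> and \<open>b\<close>
  are a symplectic basis of their span in which the form is diagonal, each \<open>d i\<close>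
  occurring twice. Natural numbers as indices allow finite and infinite systems.\<close>

definition symplectic_system :: "nat set \<Rightarrow> (nat \<Rightarrow> 'k) \<Rightarrow> (nat \<Rightarrow> 'k) \<Rightarrow> (nat \<Rightarrow> real) \<Rightarrow> bool" where
  "symplectic_system I a b d \<longleftrightarrow>
     (\<forall>i\<in>I. a i \<in> Z \<and> b i \<in> Z \<and> d i > 0) \<and>
     (\<forall>i\<in>I. \<forall>j\<in>I. form (a i) (a j) = (if i = j then d i else 0) \<and>
        form (b i) (b j) = (if i = j then d i else 0) \<and> form (a i) (b j) = 0) \<and>
     (\<forall>i\<in>I. \<forall>z\<in>Z. form (a i) z = d i * inner (J (b i)) z \<and> form (b i) z = - d i * inner (J (a i)) z)"

lemma symplectic_systemD:
  assumes "symplectic_system I a b d" "i \<in> I"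
  shows "a i \<in> Z" "b i \<in> Z" "d i > 0"
    "j \<in> I \<Longrightarrow> form (a i) (a j) = (if i = j then d i else 0)"
    "j \<in> I \<Longrightarrow> form (b i) (b j) = (if i = j then d i else 0)"
    "j \<in> I \<Longrightarrow> form (a i) (b j) = 0" "j \<in> I \<Longrightarrow> form (b i) (a j) = 0"
    "z \<in> Z \<Longrightarrow> form (a i) z = d i * inner (J (b i)) z"
    "z \<in> Z \<Longrightarrow> form (b i) z = - d i * inner (J (a i)) z"
proof -
  have 1: "\<forall>i\<in>I. a i \<in> Z \<and> b i \<in> Z \<and> d i > 0"
    and 2: "\<forall>i\<in>I. \<forall>j\<in>I. form (a i) (a j) = (if i = j then d i else 0) \<and>
        form (b i) (b j) = (if i = j then d i else 0) \<and> form (a i) (b j) = 0"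
    and 3: "\<forall>i\<in>I. \<forall>z\<in>Z. form (a i) z = d i * inner (J (b i)) z \<and> form (b i) z = - d i * inner (J (a i)) z"
    using assms(1) unfolding symplectic_system_def by blast+
  show "a i \<in> Z" "b i \<in> Z" "d i > 0" using 1 assms(2) by blast+
  show "form (a i) (a j) = (if i = j then d i else 0)" if "j \<in> I" using 2 assms(2) that by blast
  show "form (b i) (b j) = (if i = j then d i else 0)" if "j \<in> I" using 2 assms(2) that by blast
  show "form (a i) (b j) = 0" if "j \<in> I" using 2 assms(2) that by blast
  show "form (b i) (a j) = 0" if "j \<in> I" using 2 assms(2) that form_sym[of "b i" "a j"] by metis
  show "form (a i) z = d i * inner (J (b i)) z" if "z \<in> Z" using 3 assms(2) that by blast
  show "form (b i) z = - d i * inner (J (a i)) z" if "z \<in> Z" using 3 assms(2) that by blast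
qed


lemma symplectic_system_independent:
  assumes sys: "symplectic_system I a b d" and I: "finite I"
  shows "independent (a ` I \<union> b ` I)" "card (a ` I \<union> b ` I) = 2 * card I"
proof -
  define w where "w p = (if snd p then a (fst p) else b (fst p))" for p :: "nat \<times> bool"
  have img: "w ` (I \<times> UNIV) = a ` I \<union> b ` I"
  proof
    show "w ` (I \<times> UNIV) \<subseteq> a ` I \<union> b ` I" by (auto simp: w_def)
    have "a i = w (i, True)" "b i = w (i, False)" for i by (simp_all add: w_def)
    then show "a ` I \<union> b ` I \<subseteq> w ` (I \<times> UNIV)" by blast
  qed
  have w: "form (w p) (w r) = (if p = r then d (fst p) else 0)" if pr: "p \<in> I \<times> UNIV" "r \<in> I \<times> UNIV" for p r
  proof -
    have "fst p \<in> I" "fst r \<in> I" using pr by auto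
    then show ?thesis
      using symplectic_systemD(4-7)[OF sys, of "fst p" "fst r"]
      by (cases "snd p"; cases "snd r") (simp_all add: w_def prod_eq_iff)
  qed
  have 1: "form (w p) (w p) \<noteq> 0" if p: "p \<in> I \<times> UNIV" for p
  proof -
    have "fst p \<in> I" using p by auto
    then show ?thesis using w[OF p p] symplectic_systemD(3)[OF sys] by force
  qed
  have 2: "form (w p) (w r) = 0" if "p \<in> I \<times> UNIV" "r \<in> I \<times> UNIV" "p \<noteq> r" for p r
    using w that by simp
  show "independent (a ` I \<union> b ` I)" using form_orthogonal_independent(2)[of "I \<times> UNIV" w, OF 1 2] img by simp
  have "card (w ` (I \<times> UNIV)) = card (I \<times> (UNIV::bool set))"
    by (rule card_image) (rule form_orthogonal_independent(1)[OF 1 2])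
  then show "card (a ` I \<union> b ` I) = 2 * card I" using img by (simp add: card_cartesian_product)
qed

lemma symplectic_system_span:
  assumes sys: "symplectic_system I a b d" and I: "finite I" and x: "x \<in> span (a ` I \<union> b ` I)"
  obtains s t where "x = (\<Sum>i\<in>I. s i *\<^sub>R a i + t i *\<^sub>R b i)"
proof -
  have inj: "inj_on a I" "inj_on b I"
    using form_orthogonal_independent(1)[of I a] form_orthogonal_independent(1)[of I b]
      symplectic_systemD(3-5)[OF sys] by (metis less_irrefl)+
  obtain y z where yz: "x = y + z" "y \<in> span (a ` I)" "z \<in> span (b ` I)"
    using x unfolding span_Un by blast
  obtain u where u: "y = (\<Sum>v\<in>a ` I. u v *\<^sub>R v)" using yz(2) I by (auto simp: span_finite)
  obtain u' where u': "z = (\<Sum>v\<in>b ` I. u' v *\<^sub>R v)" using yz(3) I by (auto simp: span_finite)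
  have "x = (\<Sum>i\<in>I. u (a i) *\<^sub>R a i + u' (b i) *\<^sub>R b i)"
    unfolding yz(1) u u' by (simp add: sum.reindex inj sum.distrib)
  then show ?thesis by (rule that)
qed

lemma symplectic_system_expansion:
  assumes sys: "symplectic_system I a b d" and I: "finite I"
    and x: "x = (\<Sum>i\<in>I. s i *\<^sub>R a i + t i *\<^sub>R b i)"
  shows "q x = (\<Sum>i\<in>I. d i * ((s i)\<^sup>2 + (t i)\<^sup>2))"
    and "i \<in> I \<Longrightarrow> form (a i) x = d i * s i" "i \<in> I \<Longrightarrow> form (b i) x = d i * t i"
    and "\<exists>x'\<in>Z. (\<forall>z\<in>Z. form x' z = inner (J x) z) \<and> q x' = (\<Sum>i\<in>I. ((s i)\<^sup>2 + (t i)\<^sup>2) / d i)"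
proof -
  have coeff: "form (a i) (\<Sum>i\<in>I. s i *\<^sub>R a i + t i *\<^sub>R b i) = d i * s i"
      "form (b i) (\<Sum>i\<in>I. s i *\<^sub>R a i + t i *\<^sub>R b i) = d i * t i" if "i \<in> I" for i s t
  proof -
    have "form (a i) (\<Sum>i\<in>I. s i *\<^sub>R a i + t i *\<^sub>R b i) = (\<Sum>j\<in>I. if j = i then d i * s i else 0)"
      unfolding form_sum using symplectic_systemD(4,6)[OF sys that]
      by (intro sum.cong) (auto simp: form_simps)
    then show "form (a i) (\<Sum>i\<in>I. s i *\<^sub>R a i + t i *\<^sub>R b i) = d i * s i" using I that by simp
    have "form (b i) (\<Sum>i\<in>I. s i *\<^sub>R a i + t i *\<^sub>R b i) = (\<Sum>j\<in>I. if j = i then d i * t i else 0)"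
      unfolding form_sum using symplectic_systemD(5,7)[OF sys that]
      by (intro sum.cong) (auto simp: form_simps)
    then show "form (b i) (\<Sum>i\<in>I. s i *\<^sub>R a i + t i *\<^sub>R b i) = d i * t i" using I that by simp
  qed
  have q_eq: "q (\<Sum>i\<in>I. s i *\<^sub>R a i + t i *\<^sub>R b i) = (\<Sum>i\<in>I. d i * ((s i)\<^sup>2 + (t i)\<^sup>2))" for s t
  proof -
    have "q (\<Sum>i\<in>I. s i *\<^sub>R a i + t i *\<^sub>R b i) =
        (\<Sum>i\<in>I. s i * form (a i) (\<Sum>i\<in>I. s i *\<^sub>R a i + t i *\<^sub>R b i) + t i * form (b i) (\<Sum>i\<in>I. s i *\<^sub>R a i + t i *\<^sub>R b i))"
      unfolding form_sum(1) by (simp add: form_simps)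
    also have "\<dots> = (\<Sum>i\<in>I. d i * ((s i)\<^sup>2 + (t i)\<^sup>2))"
      using coeff by (intro sum.cong) (auto simp: power2_eq_square algebra_simps)
    finally show ?thesis .
  qed
  show "q x = (\<Sum>i\<in>I. d i * ((s i)\<^sup>2 + (t i)\<^sup>2))" unfolding x by (rule q_eq)
  show "i \<in> I \<Longrightarrow> form (a i) x = d i * s i" "i \<in> I \<Longrightarrow> form (b i) x = d i * t i"
    unfolding x by (rule coeff, assumption)+
  \<comment> \<open>This is \<open>K x\<close> in coordinates: \<open>K (a i)\<close> is
    \<open>- b i / d i\<close> and \<open>K (b i)\<close> is \<open>a i / d i\<close>, up to
    notation for scaling.\<close>
  define x' where "x' = (\<Sum>i\<in>I. (t i / d i) *\<^sub>R a i + (- s i / d i) *\<^sub>R b i)"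
  have "x' \<in> Z"
    unfolding x'_def using symplectic_systemD(1,2)[OF sys]
    by (intro subspace_sum[OF Z(1)] subspace_add[OF Z(1)] subspace_scale[OF Z(1)]) auto
  moreover have "form x' z = inner (J x) z" if z: "z \<in> Z" for z
  proof -
    have "form x' z = (\<Sum>i\<in>I. (t i / d i) * form (a i) z + (- s i / d i) * form (b i) z)"
      unfolding x'_def form_sum by (simp add: form_simps)
    also have "\<dots> = (\<Sum>i\<in>I. t i * inner (J (b i)) z + s i * inner (J (a i)) z)"
    proof (rule sum.cong[OF refl])
      fix i assume i: "i \<in> I"
      show "(t i / d i) * form (a i) z + (- s i / d i) * form (b i) z = t i * inner (J (b i)) z + s i * inner (J (a i)) z"
        using symplectic_systemD(3)[OF sys i] symplectic_systemD(8,9)[OF sys i z] by simp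
    qed
    also have "\<dots> = inner (J x) z"
      unfolding x
      by (simp add: linear_sum[OF J_lin] linear_add[OF J_lin] linear_scale[OF J_lin] inner_sum_left inner_add_left
          sum.distrib)
    finally show ?thesis .
  qed
  moreover have "q x' = (\<Sum>i\<in>I. ((s i)\<^sup>2 + (t i)\<^sup>2) / d i)"
    unfolding x'_def q_eq
  proof (rule sum.cong[OF refl])
    fix i assume i: "i \<in> I"
    have "d i * ((t i / d i)\<^sup>2 + (- s i / d i)\<^sup>2) = ((s i)\<^sup>2 + (t i)\<^sup>2) * (d i / (d i * d i))"
      by (simp add: power2_eq_square add_divide_distrib algebra_simps)
    then show "d i * ((t i / d i)\<^sup>2 + (- s i / d i)\<^sup>2) = ((s i)\<^sup>2 + (t i)\<^sup>2) / d i"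
      using symplectic_systemD(3)[OF sys i] by simp
  qed
  ultimately show "\<exists>x'\<in>Z. (\<forall>z\<in>Z. form x' z = inner (J x) z) \<and> q x' = (\<Sum>i\<in>I. ((s i)\<^sup>2 + (t i)\<^sup>2) / d i)"
    by blast
qed

text \<open>With x' representing the functional \<open>inner (J x)\<close>, Cauchy-Schwarz bounds
  the squared pairing by \<open>q x' * q z\<close>, and \<open>c\<^sup>2 * q x' \<le> q x\<close>
  holds term by term because c^2 / d i \<le> d i.\<close>

lemma symp_lower_system:
  assumes sys: "symplectic_system I a b d" and I: "finite I" "card I = k"
    and c: "c > 0" "\<And>i. i \<in> I \<Longrightarrow> c \<le> d i"
  shows "symp_lower S J Z k c"
  unfolding symp_lower_def
proof (intro exI[of _ "a ` I \<union> b ` I"] conjI ballI)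
  show "finite (a ` I \<union> b ` I)" using I by simp
  show "independent (a ` I \<union> b ` I)" "card (a ` I \<union> b ` I) = 2 * k"
    using symplectic_system_independent[OF sys I(1)] I(2) by auto
  show "a ` I \<union> b ` I \<subseteq> Z" using symplectic_systemD(1,2)[OF sys] by blast
next
  fix x z assume x: "x \<in> span (a ` I \<union> b ` I)" and z: "z \<in> Z"
  obtain s t where st: "x = (\<Sum>i\<in>I. s i *\<^sub>R a i + t i *\<^sub>R b i)"
    using symplectic_system_span[OF sys I(1) x] .
  obtain x' where x': "\<forall>z\<in>Z. form x' z = inner (J x) z" "q x' = (\<Sum>i\<in>I. ((s i)\<^sup>2 + (t i)\<^sup>2) / d i)"
    using symplectic_system_expansion(4)[OF sys I(1) st] by blast
  have "c\<^sup>2 * q x' \<le> q x"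
    unfolding x'(2) symplectic_system_expansion(1)[OF sys I(1) st] sum_distrib_left
  proof (rule sum_mono)
    fix i assume i: "i \<in> I"
    have d: "d i > 0" by (rule symplectic_systemD(3)[OF sys i])
    have "c * c \<le> d i * d i" using c(1) c(2)[OF i] d by (intro mult_mono) auto
    then have "c\<^sup>2 / d i \<le> d i" using d by (simp add: divide_le_eq power2_eq_square)
    then have "c\<^sup>2 / d i * ((s i)\<^sup>2 + (t i)\<^sup>2) \<le> d i * ((s i)\<^sup>2 + (t i)\<^sup>2)" by (rule mult_right_mono) simp
    then show "c\<^sup>2 * (((s i)\<^sup>2 + (t i)\<^sup>2) / d i) \<le> d i * ((s i)\<^sup>2 + (t i)\<^sup>2)" by simp
  qed
  then have "c\<^sup>2 * q x' * q z \<le> q x * q z" by (intro mult_right_mono q_nonneg)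
  moreover have "(form x' z)\<^sup>2 \<le> q x' * q z" by (rule form_cauchy_schwarz)
  then have "c\<^sup>2 * (form x' z)\<^sup>2 \<le> c\<^sup>2 * (q x' * q z)" by (rule mult_left_mono) simp
  ultimately show "(c * inner (J x) z)\<^sup>2 \<le> inner x (S x) * inner z (S z)"
    using x'(1) z by (simp add: power_mult_distrib form_def mult.assoc)
qed

lemma symp_lower_one:
  "finite V \<Longrightarrow> independent V \<Longrightarrow> card V = 2 * k \<Longrightarrow> V \<subseteq> Z \<Longrightarrow> symp_lower S J Z k 1"
  unfolding symp_lower_def using uncertainty by auto

text \<open>The upper half of the principle in abstract form: a \<open>2 k\<close>-dimensional space
  contains a nonzero vector killed by fewer than \<open>2 k\<close> functionals, and one test vector
  for it caps \<open>c\<close>.\<close>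

lemma symp_lower_le:
  assumes low: "symp_lower S J Z k c" and t: "t > 0" and C: "finite C" "card C < 2 * k"
    and witness: "\<And>x. x \<in> Z \<Longrightarrow> x \<noteq> 0 \<Longrightarrow> (\<And>v. v \<in> C \<Longrightarrow> inner v x = 0) \<Longrightarrow>
      \<exists>z\<in>Z. inner (J x) z \<noteq> 0 \<and> q x * q z \<le> (t * inner (J x) z)\<^sup>2"
  shows "c \<le> t"
proof -
  obtain V where V: "finite V" "independent V" "card V = 2 * k" "V \<subseteq> Z"
    and bound: "\<And>x z. x \<in> span V \<Longrightarrow> z \<in> Z \<Longrightarrow> (c * inner (J x) z)\<^sup>2 \<le> inner x (S x) * inner z (S z)"
    using low unfolding symp_lower_def by blast
  obtain x where x: "x \<in> span V" "x \<noteq> 0" "\<forall>v\<in>C. inner v x = 0"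
    using common_kernel[OF C(1) V(1,2)] C(2) V(3) by auto
  have "x \<in> Z" using span_minimal[OF V(4) Z(1)] x(1) by blast
  then obtain z where z: "z \<in> Z" "inner (J x) z \<noteq> 0" "q x * q z \<le> (t * inner (J x) z)\<^sup>2"
    using witness[of x] x by blast
  have "(c * inner (J x) z)\<^sup>2 \<le> (t * inner (J x) z)\<^sup>2"
    using bound[OF x(1) z(1)] z(3) by (simp add: form_def)
  then have "c\<^sup>2 * (inner (J x) z)\<^sup>2 \<le> t\<^sup>2 * (inner (J x) z)\<^sup>2" by (simp add: power_mult_distrib)
  then have "c\<^sup>2 \<le> t\<^sup>2" using z(2) by simp
  then show ?thesis using t by (intro power2_le_imp_le[of c t]) auto
qed

text \<open>The first k - 1 pairs are removed by 2 (k - 1) functionals. On the rest the representer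
  x' is the test vector, since it attains equality in Cauchy-Schwarz.\<close>

lemma symp_lower_system_le:
  assumes sys: "symplectic_system {..<n} a b d" and Z_span: "Z \<subseteq> span (a ` {..<n} \<union> b ` {..<n})"
    and anti: "\<And>i j. i \<le> j \<Longrightarrow> j < n \<Longrightarrow> d j \<le> d i" and k: "1 \<le> k" "k \<le> n"
    and low: "symp_lower S J Z k c"
  shows "c \<le> d (k - 1)"
proof -
  \<comment> \<open>\<open>inner (S (a i)) x = form (a i) x\<close> is \<open>d i\<close> times the
    coordinate \<open>s i\<close>; likewise \<open>b i\<close> reads off \<open>t i\<close>.\<close>
  define C where "C = (\<lambda>i. S (a i)) ` {..<k - 1} \<union> (\<lambda>i. S (b i)) ` {..<k - 1}"
  have "card C \<le> card ((\<lambda>i. S (a i)) ` {..<k - 1}) + card ((\<lambda>i. S (b i)) ` {..<k - 1})"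
    unfolding C_def by (rule card_Un_le)
  also have "\<dots> \<le> (k - 1) + (k - 1)"
    using card_image_le[of "{..<k - 1}" "\<lambda>i. S (a i)"] card_image_le[of "{..<k - 1}" "\<lambda>i. S (b i)"]
    by (intro add_mono) auto
  finally have cardC: "card C < 2 * k" using k by simp
  have kn: "k - 1 \<in> {..<n}" using k by simp
  show ?thesis
  proof (rule symp_lower_le[OF low _ _ cardC])
    show dpos: "d (k - 1) > 0" by (rule symplectic_systemD(3)[OF sys kn])
    show "finite C" by (simp add: C_def)
    fix x assume xZ: "x \<in> Z" and x0: "x \<noteq> 0" and xC: "\<And>v. v \<in> C \<Longrightarrow> inner v x = 0"
    obtain s t where st: "x = (\<Sum>i<n. s i *\<^sub>R a i + t i *\<^sub>R b i)"
      using symplectic_system_span[OF sys] xZ Z_span by blast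
    obtain x' where x': "x' \<in> Z" "\<forall>z\<in>Z. form x' z = inner (J x) z" "q x' = (\<Sum>i<n. ((s i)\<^sup>2 + (t i)\<^sup>2) / d i)"
      using symplectic_system_expansion(4)[OF sys _ st] by auto
    have zero: "s i = 0 \<and> t i = 0" if "i < k - 1" for i
    proof -
      have i: "i \<in> {..<n}" using that k by simp
      have "form (a i) x = 0" "form (b i) x = 0"
        using xC that by (auto simp: C_def form_def S_sym[symmetric])
      then show ?thesis
        using symplectic_system_expansion(2,3)[OF sys _ st i] symplectic_systemD(3)[OF sys i] by auto
    qed
    have "q x \<le> (d (k - 1))\<^sup>2 * q x'"
      unfolding x'(3) symplectic_system_expansion(1)[OF sys finite_lessThan st] sum_distrib_left
    proof (rule sum_mono)
      fix i assume i: "i \<in> {..<n}"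
      have di: "d i > 0" by (rule symplectic_systemD(3)[OF sys i])
      show "d i * ((s i)\<^sup>2 + (t i)\<^sup>2) \<le> (d (k - 1))\<^sup>2 * (((s i)\<^sup>2 + (t i)\<^sup>2) / d i)"
      proof (cases "i < k - 1")
        case False
        then have "d i \<le> d (k - 1)" using anti i by simp
        then have "d i * d i \<le> d (k - 1) * d (k - 1)" using di by (intro mult_mono) auto
        then have "d i \<le> (d (k - 1))\<^sup>2 / d i" using di by (simp add: le_divide_eq power2_eq_square)
        then have "d i * ((s i)\<^sup>2 + (t i)\<^sup>2) \<le> (d (k - 1))\<^sup>2 / d i * ((s i)\<^sup>2 + (t i)\<^sup>2)"
          by (rule mult_right_mono) simp
        then show ?thesis by simp
      qed (simp add: zero)
    qed
    then have "q x * q x' \<le> (d (k - 1))\<^sup>2 * q x' * q x'" by (intro mult_right_mono q_nonneg)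
    moreover have "inner (J x) x' = q x'" using x'(1,2) by simp
    moreover have "x' \<noteq> 0"
    proof
      assume "x' = 0"
      then have "inner (J x) (J x) = 0" using x'(2) J_in_Z[OF xZ] form_simps(7) by metis
      then show False using x0 by (simp only: J_isometry inner_eq_zero_iff)
    qed
    ultimately show "\<exists>z\<in>Z. inner (J x) z \<noteq> 0 \<and> q x * q z \<le> (d (k - 1) * inner (J x) z)\<^sup>2"
      using x'(1) q_eq_0[of x'] by (intro bexI[of _ x']) (auto simp: power2_eq_square ac_simps)
  qed
qed

end


section \<open>Gaussian covariance operators and their Williamson forms\<close>

text \<open>The real part of condition (i) at x + i y: multiplication by i turns (J x, J y) into (-
  J y, J x), and the two cross terms agree as \<open>J\<close> is skew.\<close>

lemma gaussian_covariance_uncertainty: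
  assumes "gaussian_covariance_op S"
  shows "2 * inner (symp_J x) y \<le> inner x (S x) + inner y (S y)"
proof -
  have "c_positive (\<lambda>z. complexify S z - c_scale \<i> (complexify symp_J z))"
    using assms by (simp add: gaussian_covariance_op_def)
  then have "c_inner (x, y) (complexify S (x, y) - c_scale \<i> (complexify symp_J (x, y))) \<in> \<real>\<^sub>\<ge>\<^sub>0"
    unfolding c_positive_def by blast
  then have "0 \<le> inner x (S x + symp_J y) + inner y (S y - symp_J x)"
    by (simp add: complex_nonneg_Reals_iff c_inner_def complexify_def c_scale_def)
  then show ?thesis
    using symp_J_skew[of x y] by (simp add: inner_add_right inner_diff_right inner_commute[of y])
qed

text \<open>One \<delta> serves every \<open>Z\<close>, so the constants in the limit argument do
  not depend on the truncation.\<close>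

lemma gaussian_covariance_form:
  fixes S :: "'h::{real_inner, complete_space} \<times> 'h \<Rightarrow> 'h \<times> 'h"
  assumes S: "gaussian_covariance_op S"
  obtains \<delta> where "\<And>Z. subspace Z \<Longrightarrow> closed Z \<Longrightarrow> symp_J ` Z \<subseteq> Z \<Longrightarrow> gaussian_form S \<delta> symp_J Z"
proof -
  have sym: "symmetric_op S" and inv: "invertible_op S" and hs: "hilbert_schmidt (\<lambda>z. S z - z)"
    using S by (simp_all add: gaussian_covariance_op_def)
  then have S_bl: "bounded_linear S" and S_sym: "inner (S x) y = inner x (S y)" for x y
    unfolding symmetric_op_def by blast+
  have lin: "linear S" by (rule bounded_linear.linear[OF S_bl])
  have nonneg: "0 \<le> inner x (S x)" for x
    using gaussian_covariance_uncertainty[OF S, of x 0] by simp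
  \<comment> \<open>Inserting - t z for all real t turns the additive inequality into its product
    form, by the discriminant.\<close>
  have unc: "(inner (symp_J x) z)\<^sup>2 \<le> inner x (S x) * inner z (S z)" for x z
  proof (rule quadratic_nonneg_discrim)
    fix t :: real
    show "0 \<le> inner x (S x) + 2 * inner (symp_J x) z * t + inner z (S z) * t\<^sup>2"
      using gaussian_covariance_uncertainty[OF S, of x "- t *\<^sub>R z"]
      by (simp add: linear_neg[OF lin] linear_scale[OF lin] power2_eq_square algebra_simps)
  qed
  have cs: "(inner x (S z))\<^sup>2 \<le> inner x (S x) * inner z (S z)" for x z
  proof (rule quadratic_nonneg_discrim)
    fix t :: real
    have "inner z (S x) = inner x (S z)" by (metis S_sym inner_commute)
    then show "0 \<le> inner x (S x) + 2 * inner x (S z) * t + inner z (S z) * t\<^sup>2"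
      using nonneg[of "x + t *\<^sub>R z"]
      by (simp add: linear_add[OF lin] linear_scale[OF lin] inner_simps power2_eq_square algebra_simps)
  qed
  obtain B where B: "bounded_linear B" "S \<circ> B = id"
    using inv unfolding invertible_op_def by blast
  obtain K where K: "K > 0" "\<And>x. norm (B x) \<le> norm x * K"
    using bounded_linear.pos_bounded[OF B(1)] by blast
  have SB: "S (B z) = z" for z using B(2) by (metis comp_apply id_apply)
  \<comment> \<open>Coercivity comes from the bounded inverse \<open>B\<close>: Cauchy-Schwarz at z
    and \<open>B z\<close> gives |z|^4 \<le> inner z (S z) * K |z|^2.\<close>
  have coercive: "(1 / K) * (norm z)\<^sup>2 \<le> inner z (S z)" for z
  proof (cases "z = 0")
    case False
    have "inner (B z) (S (B z)) \<le> norm (B z) * norm z" unfolding SB by (rule norm_cauchy_schwarz)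
    also have "\<dots> \<le> (norm z * K) * norm z" by (intro mult_right_mono K) auto
    finally have 1: "inner (B z) (S (B z)) \<le> K * (norm z)\<^sup>2" by (simp add: power2_eq_square ac_simps)
    have "((norm z)\<^sup>2)\<^sup>2 \<le> inner z (S z) * inner (B z) (S (B z))"
      using cs[of z "B z"] unfolding SB by (simp add: power2_norm_eq_inner)
    also have "\<dots> \<le> inner z (S z) * (K * (norm z)\<^sup>2)" by (intro mult_left_mono 1 nonneg)
    finally have "(norm z)\<^sup>2 \<le> inner z (S z) * K"
      using False by (simp add: power2_eq_square)
    then show ?thesis using K(1) by (simp add: field_simps)
  qed (simp add: linear_0[OF lin])
  have compact: "compact_on UNIV (\<lambda>z. S z - z)"
    by (rule hilbert_schmidt_compact_on[OF hs])
  have "gaussian_form S (1 / K) symp_J Z" if "subspace Z" "closed Z" "symp_J ` Z \<subseteq> Z" for Z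
    by (intro gaussian_form.intro coercive_form.intro gaussian_form_axioms.intro S_bl S_sym coercive symp_J_bl
        symp_J_J symp_J_skew unc compact that) (use K in simp)
  then show ?thesis by (rule that)
qed

lemma symplectic_op_inverse:
  fixes M :: "'h::{real_inner, complete_space} \<times> 'h \<Rightarrow> 'h \<times> 'h"
  assumes "symplectic_op M"
  shows "bounded_linear M" "\<exists>N. bounded_linear N \<and> M \<circ> N = id \<and> N \<circ> M = id"
    "inner (symp_J (M x)) (M y) = inner (symp_J x) y"
proof -
  have inv: "invertible_op M" and J: "adjoint M \<circ> symp_J \<circ> M = symp_J"
    using assms by (simp_all add: symplectic_op_def)
  then show M: "bounded_linear M" and "\<exists>N. bounded_linear N \<and> M \<circ> N = id \<and> N \<circ> M = id"
    unfolding invertible_op_def by blast+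
  show "inner (symp_J (M x)) (M y) = inner (symp_J x) y"
    using adjoint_inner[OF M, of y "symp_J (M x)"] fun_cong[OF J, of x] by (simp add: inner_commute)
qed

lemma map_prod_symp_J:
  assumes "linear D"
  shows "symp_J (map_prod D D z) = map_prod D D (symp_J z)"
  by (cases z) (simp add: symp_J_def linear_neg[OF assms])

lemma inner_map_prod: "inner x (map_prod D D y) = inner (fst x) (D (fst y)) + inner (snd x) (D (snd y))"
  by (cases x; cases y) simp

context gaussian_form
begin


text \<open>The operator is J (S - I) J S - (S - I), again by J^2 = -1, and each term has a compact
  factor.\<close>

lemma compact_JSJS: "compact_on UNIV (\<lambda>z. J (S (J (S z))) + z)"
proof -
  have "compact_on UNIV (\<lambda>z. J (S (J (S z)) - J (S z)) + - (S z - z))"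
  proof (rule compact_on_add)
    have "compact_on UNIV (\<lambda>z. S (J (S z)) - J (S z))"
      by (rule compact_on_right[OF bounded_linear_compose[OF J_bl S_bl] compact subset_UNIV])
    then show "compact_on UNIV (\<lambda>z. J (S (J (S z)) - J (S z)))" by (rule compact_on_left[OF J_bl])
    show "compact_on UNIV (\<lambda>z. - (S z - z))" by (rule compact_on_le[OF compact]) (simp only: norm_minus_cancel)
  qed
  then show ?thesis by (simp add: linear_diff[OF J_lin])
qed

end

text \<open>D^2 - I = (D + I) (D - I), and D + I does not shrink norms when D is
  nonnegative.\<close>

lemma norm_diff_le_norm_square_diff:
  assumes "positive_op D"
  shows "norm (D x - x) \<le> norm (D (D x) - x)"
proof -
  define y where "y = D x - x"
  have "bounded_linear D" using assms by (simp add: positive_op_def symmetric_op_def)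
  then have lin: "linear D" by (rule bounded_linear.linear)
  have eq: "D (D x) - x = D y + y" by (simp add: y_def linear_diff[OF lin])
  have "0 \<le> inner y (D y)" using assms by (simp add: positive_op_def)
  moreover have "(norm (D y + y))\<^sup>2 = (norm (D y))\<^sup>2 + 2 * inner y (D y) + (norm y)\<^sup>2"
    by (simp add: power2_norm_eq_inner inner_add_left inner_add_right inner_commute)
  ultimately have "(norm y)\<^sup>2 \<le> (norm (D y + y))\<^sup>2"
    using zero_le_power2[of "norm (D y)"] by linarith
  then show ?thesis unfolding eq y_def[symmetric] by (rule power2_le_imp_le) simp
qed

section \<open>Bounds for an operator in Williamson form\<close>

locale williamson_form = gaussian_form S \<delta> symp_J UNIV
  for S :: "'h::{real_inner, complete_space} \<times> 'h \<Rightarrow> 'h \<times> 'h" and \<delta> +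
  fixes D :: "'h \<Rightarrow> 'h"
  assumes williamson: "williamson_op S D"
begin

lemma D_positive: "positive_op D" using williamson by (simp add: williamson_op_def)

lemma D_bl: "bounded_linear D" using D_positive by (simp add: positive_op_def symmetric_op_def)

lemmas D_lin = bounded_linear.linear[OF D_bl]

lemma D_symmetric: "inner (D x) y = inner x (D y)"
  using D_positive by (simp add: positive_op_def symmetric_op_def)

definition conjugator :: "('h \<times> 'h \<Rightarrow> 'h \<times> 'h) \<Rightarrow> ('h \<times> 'h \<Rightarrow> 'h \<times> 'h) \<Rightarrow> bool" where
  "conjugator M N \<longleftrightarrow> symplectic_op M \<and> S = adjoint M \<circ> map_prod D D \<circ> M \<and>
     bounded_linear N \<and> M \<circ> N = id \<and> N \<circ> M = id"

lemma conjugator_exists: "\<exists>M N. conjugator M N"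
  using williamson symplectic_op_inverse(2) unfolding williamson_op_def conjugator_def by metis

lemma conjugatorD:
  assumes "conjugator M N"
  shows "bounded_linear M" "bounded_linear N" "M (N x) = x" "N (M x) = x"
    "inner (symp_J (M x)) (M y) = inner (symp_J x) y"
    "form x y = inner (M x) (map_prod D D (M y))"
proof -
  have M: "symplectic_op M" and S: "S = adjoint M \<circ> map_prod D D \<circ> M"
    and N: "bounded_linear N" "M \<circ> N = id" "N \<circ> M = id"
    using assms unfolding conjugator_def by blast+
  show bl: "bounded_linear M" by (rule symplectic_op_inverse(1)[OF M])
  show "inner (symp_J (M x)) (M y) = inner (symp_J x) y" by (rule symplectic_op_inverse(3)[OF M])
  show "bounded_linear N" by (rule N)
  show "M (N x) = x" "N (M x) = x" using fun_cong[OF N(2)] fun_cong[OF N(3)] by simp_all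
  have "S y = adjoint M (map_prod D D (M y))" by (subst S) simp
  then show "form x y = inner (M x) (map_prod D D (M y))"
    unfolding form_def adjoint_inner[OF bl] by simp
qed

lemma D_compact_perturbation: "compact_perturbation D"
proof (rule compact_perturbation.intro)
  show "bounded_linear D" by (rule D_bl)
  show "inner (D x) y = inner x (D y)" for x y by (rule D_symmetric)
  obtain M N where MN: "conjugator M N" using conjugator_exists by blast
  note M = conjugatorD[OF MN]
  \<comment> \<open>From \<open>adjoint M\<close> J M = J follows that J after
    \<open>adjoint M\<close> equals \<open>N\<close> after J. This isolates the doubled D, which
    commutes with J.\<close>
  have JS: "symp_J (S z) = N (symp_J (map_prod D D (M z)))" for z
  proof -
    have "inner y (symp_J (S z)) = inner y (N (symp_J (map_prod D D (M z))))" for y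
    proof -
      have "inner y (symp_J (S z)) = - form (symp_J y) z" by (simp add: form_def symp_J_skew)
      also have "\<dots> = - inner (M (symp_J y)) (map_prod D D (M z))" by (simp add: M(6))
      also have "\<dots> = inner (M (symp_J y)) (symp_J (M (N (symp_J (map_prod D D (M z))))))" by (simp add: M(3))
      also have "\<dots> = - inner (symp_J (symp_J y)) (N (symp_J (map_prod D D (M z))))"
        using symp_J_skew[of "M (symp_J y)" "M (N (symp_J (map_prod D D (M z))))"]
          M(5)[of "symp_J y" "N (symp_J (map_prod D D (M z)))"] by linarith
      finally show ?thesis by simp
    qed
    then show ?thesis using vector_eq_ldot by blast
  qed
  have lins: "linear M" "linear N" using M(1,2) bounded_linear.linear by blast+
  have "compact_on UNIV (\<lambda>w. M (- (symp_J (S (symp_J (S (N w)))) + N w)))"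
  proof (rule compact_on_left[OF M(1)])
    have "compact_on UNIV (\<lambda>w. symp_J (S (symp_J (S (N w)))) + N w)"
      by (rule compact_on_right[OF M(2) compact_JSJS subset_UNIV])
    then show "compact_on UNIV (\<lambda>w. - (symp_J (S (symp_J (S (N w)))) + N w))"
      by (rule compact_on_le) (simp only: norm_minus_cancel)
  qed
  moreover have "M (- (symp_J (S (symp_J (S (N w)))) + N w)) = map_prod D D (map_prod D D w) - w" for w
  proof -
    have "symp_J (S (symp_J (S (N w)))) = N (symp_J (map_prod D D (symp_J (map_prod D D w))))"
      by (simp add: JS M(3))
    also have "\<dots> = N (- map_prod D D (map_prod D D w))"
      by (simp add: map_prod_symp_J[OF D_lin, symmetric])
    finally show ?thesis
      by (simp add: linear_neg[OF lins(2)] linear_neg[OF lins(1)] linear_diff[OF lins(1)] linear_add[OF lins(1)] M(3))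
  qed
  ultimately have D2: "compact_on UNIV (\<lambda>w. map_prod D D (map_prod D D w) - w)" by simp
  \<comment> \<open>The embedding of the first component recovers \<open>D\<close> from its
    double.\<close>
  have "bounded_linear (\<lambda>x::'h. (x, 0::'h))"
    by (intro bounded_linear_Pair bounded_linear_ident bounded_linear_zero)
  from compact_on_right[OF this D2 subset_UNIV]
  show "compact_on UNIV (\<lambda>x. D x - x)"
  proof (rule compact_on_le)
    fix x :: 'h
    show "norm (D x - x) \<le> norm (map_prod D D (map_prod D D (x, 0)) - (x, 0))"
      using norm_diff_le_norm_square_diff[OF D_positive, of x] by (simp add: linear_0[OF D_lin] norm_prod_def)
  qed
qed

text \<open>The first k eigenvectors, placed in either component and pulled back through the inverse
  of \<open>M\<close>, form a symplectic system with values \<open>d i\<close>.\<close>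

lemma symp_lower_eigenvalue:
  assumes ev: "eigenvalues_above_1 D R d" and k: "1 \<le> k" "enat k \<le> R"
  shows "symp_lower S symp_J UNIV k (d k)"
proof -
  interpret D: compact_perturbation D by (rule D_compact_perturbation)
  obtain M N where MN: "conjugator M N" using conjugator_exists by blast
  note M = conjugatorD[OF MN]
  obtain f where f: "\<And>k. 1 \<le> k \<Longrightarrow> enat k \<le> R \<Longrightarrow> norm (f k) = 1 \<and> D (f k) = d k *\<^sub>R f k"
    "\<And>j k. j \<noteq> k \<Longrightarrow> 1 \<le> j \<Longrightarrow> enat j \<le> R \<Longrightarrow> 1 \<le> k \<Longrightarrow> enat k \<le> R \<Longrightarrow> inner (f j) (f k) = 0"
    using D.eigenvalues_above_1_eigenvectors[OF ev] by metis
  have le: "enat i \<le> R" if "i \<in> {1..k}" for i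
    using that k(2) by (meson atLeastAtMost_iff enat_ord_simps(1) order_trans)
  define a where "a i = N (f i, 0)" for i
  define b where "b i = N (0, f i)" for i
  have d1: "d i > 1" "d k \<le> d i" if "i \<in> {1..k}" for i
    using ev le[OF that] that k(2) unfolding eigenvalues_above_1_def by auto
  have fa: "form (a i) z = d i * inner (f i) (fst (M z))" "form (b i) z = d i * inner (f i) (snd (M z))"
    if i: "i \<in> {1..k}" for i z
    using f(1)[of i] le[OF i] i
    by (auto simp: M(6) a_def b_def M(3) inner_map_prod D_symmetric[symmetric] linear_0[OF D_lin])
  have ff: "inner (f i) (f j) = (if i = j then 1 else 0)" if "i \<in> {1..k}" "j \<in> {1..k}" for i j
    using f(1)[of i] f(2)[of i j] le that by (auto simp: norm_eq_1)
  have Jab: "inner (symp_J (b i)) z = inner (f i) (fst (M z))" "inner (symp_J (a i)) z = - inner (f i) (snd (M z))" for i z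
  proof -
    have "inner (symp_J (N w)) z = inner (symp_J w) (M z)" for w using M(5)[of "N w" z] by (simp add: M(3))
    then show "inner (symp_J (b i)) z = inner (f i) (fst (M z))" "inner (symp_J (a i)) z = - inner (f i) (snd (M z))"
      by (simp_all add: a_def b_def symp_J_def inner_prod_def)
  qed
  have "symplectic_system {1..k} a b d"
    unfolding symplectic_system_def
  proof (intro conjI ballI)
    fix i assume i: "i \<in> {1..k}"
    show "d i > 0" using d1(1)[OF i] by simp
    show "form (a i) z = d i * inner (symp_J (b i)) z" "form (b i) z = - d i * inner (symp_J (a i)) z" for z
      by (simp_all add: fa[OF i] Jab)
    fix j assume j: "j \<in> {1..k}"
    show "form (a i) (a j) = (if i = j then d i else 0)" "form (b i) (b j) = (if i = j then d i else 0)"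
      "form (a i) (b j) = 0"
      using ff[OF i j] unfolding fa[OF i] by (simp_all add: a_def b_def M(3))
  qed auto
  then show ?thesis
    by (rule symp_lower_system) (use d1[of k] d1(2) k in auto)
qed

text \<open>The eigenvectors above 1 need not span, so no expansion is available. Instead y = M x is
  considered: when both components are orthogonal to the first k - 1 eigenvectors, the form of
  \<open>D\<close> on them is at most t times the identity.\<close>

lemma symp_lower_imp_le:
  assumes ev: "eigenvalues_above_1 D R d" and k: "1 \<le> k" and low: "symp_lower S symp_J UNIV k c"
  shows "c \<le> (if enat k \<le> R then d k else 1)"
proof -
  interpret D: compact_perturbation D by (rule D_compact_perturbation)
  obtain M N where MN: "conjugator M N" using conjugator_exists by blast
  note M = conjugatorD[OF MN]
  obtain f where f: "\<And>k u. (\<And>j. 1 \<le> j \<Longrightarrow> j < k \<Longrightarrow> enat j \<le> R \<Longrightarrow> inner (f j) u = 0) \<Longrightarrow> 1 \<le> k \<Longrightarrow>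
       inner u (D u) \<le> (if enat k \<le> R then d k else 1) * inner u u"
    using D.eigenvalues_above_1_eigenvectors[OF ev] by metis
  define t where "t = (if enat k \<le> R then d k else 1)"
  have "d k > 1" if "enat k \<le> R" using ev k that unfolding eigenvalues_above_1_def by blast
  then have t: "t > 0" unfolding t_def by auto
  \<comment> \<open>At most 2 (k - 1) functionals; \<open>adjoint M\<close> moves the conditions on
    \<open>M x\<close> back to \<open>x\<close>. If k exceeds R + 1, some \<open>f j\<close> are
    arbitrary vectors, and the extra conditions do no harm.\<close>
  define C where "C = (\<lambda>j. adjoint M (f j, 0)) ` {1..<k} \<union> (\<lambda>j. adjoint M (0, f j)) ` {1..<k}"
  have "card C \<le> card ((\<lambda>j. adjoint M (f j, 0)) ` {1..<k}) + card ((\<lambda>j. adjoint M (0, f j)) ` {1..<k})"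
    unfolding C_def by (rule card_Un_le)
  also have "\<dots> \<le> (k - 1) + (k - 1)"
    using card_image_le[of "{1..<k}" "\<lambda>j. adjoint M (f j, 0)"] card_image_le[of "{1..<k}" "\<lambda>j. adjoint M (0, f j)"]
    by (intro add_mono) auto
  finally have cardC: "card C < 2 * k" using k by simp
  show ?thesis
    unfolding t_def[symmetric]
  proof (rule symp_lower_le[OF low t _ cardC])
    show "finite C" by (simp add: C_def)
    fix x assume x0: "x \<noteq> 0" and xC: "\<And>v. v \<in> C \<Longrightarrow> inner v x = 0"
    define y where "y = M x"
    have y0: "y \<noteq> 0"
    proof
      assume "y = 0"
      then have "x = N 0" using M(4)[of x] by (simp add: y_def)
      then show False using x0 linear_0[OF bounded_linear.linear[OF M(2)]] by simp
    qed
    have orth: "inner (f j) (fst y) = 0 \<and> inner (f j) (snd y) = 0" if "1 \<le> j" "j < k" for j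
    proof -
      have "inner x (adjoint M (f j, 0)) = 0" "inner x (adjoint M (0, f j)) = 0"
        using xC that by (auto simp: C_def inner_commute[of x])
      then show ?thesis
        unfolding adjoint_inner[OF M(1), symmetric] y_def by (simp add: inner_prod_def inner_commute)
    qed
    have bound: "inner (fst y) (D (fst y)) + inner (snd y) (D (snd y)) \<le> t * inner y y"
    proof -
      have "inner (fst y) (D (fst y)) \<le> t * inner (fst y) (fst y)"
        unfolding t_def by (rule f) (use orth k in auto)
      moreover have "inner (snd y) (D (snd y)) \<le> t * inner (snd y) (snd y)"
        unfolding t_def by (rule f) (use orth k in auto)
      ultimately show ?thesis by (simp add: inner_prod_def distrib_left)
    qed
    \<comment> \<open>In the coordinates of \<open>M\<close> the test vector is J y: it pairs with y
      to |y|^2, and swapping components leaves the value of the doubled D unchanged.\<close>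
    define z where "z = N (symp_J y)"
    have Jxz: "inner (symp_J x) z = inner y y"
      using M(5)[of x z] by (simp add: z_def M(3) y_def[symmetric] symp_J_skew)
    have qx: "q x = inner (fst y) (D (fst y)) + inner (snd y) (D (snd y))"
      unfolding M(6) y_def[symmetric] inner_map_prod by simp
    have qz: "q z = inner (fst y) (D (fst y)) + inner (snd y) (D (snd y))"
      unfolding M(6) z_def M(3) inner_map_prod by (simp add: symp_J_def linear_neg[OF D_lin])
    have "q x * q z \<le> (t * inner y y) * (t * inner y y)"
      using bound q_nonneg[of x] t unfolding qx qz by (intro mult_mono) auto
    then show "\<exists>z\<in>UNIV. inner (symp_J x) z \<noteq> 0 \<and> q x * q z \<le> (t * inner (symp_J x) z)\<^sup>2"
      using Jxz y0 by (intro bexI[of _ z]) (auto simp: power2_eq_square)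
  qed
qed

end


section \<open>Orthonormal sequences\<close>

lemma bounded_linear_eq_on_dense:
  assumes f: "bounded_linear f" and g: "bounded_linear g"
    and dense: "closure (span B) = UNIV" and eq: "\<And>b. b \<in> B \<Longrightarrow> f b = g b"
  shows "f x = g x"
proof -
  note lin = bounded_linear.linear[OF f] bounded_linear.linear[OF g]
  have "subspace {x. f x = g x}"
    by (rule subspaceI) (simp_all add: linear_add[OF lin(1)] linear_add[OF lin(2)] linear_scale[OF lin(1)]
        linear_scale[OF lin(2)] linear_0[OF lin(1)] linear_0[OF lin(2)])
  then have "span B \<subseteq> {x. f x = g x}" using eq by (intro span_minimal) auto
  moreover have "closed {x. f x = g x}"
    by (intro closed_Collect_eq linear_continuous_on f g)
  ultimately have "closure (span B) \<subseteq> {x. f x = g x}" by (rule closure_minimal)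
  then show ?thesis using dense by blast
qed

locale hilbert_sequence =
  fixes e :: "nat \<Rightarrow> 'h::{real_inner, complete_space}"
  assumes inner_e: "inner (e i) (e j) = (if i = j then 1 else 0)"
    and dense: "closure (span (range e)) = UNIV"
begin

lemma inj_e: "inj e"
proof (rule injI)
  fix i j assume "e i = e j"
  then show "i = j" using inner_e[of i j] inner_e[of i i] by (metis zero_neq_one)
qed

lemma bessel_e: "finite A \<Longrightarrow> (\<Sum>i\<in>A. (inner (e i) x)\<^sup>2) \<le> (norm x)\<^sup>2"
proof -
  assume A: "finite A"
  have "(\<Sum>b\<in>e ` A. (inner b x)\<^sup>2) \<le> (norm x)\<^sup>2"
    by (rule bessel) (use A in \<open>auto simp: pairwise_def Linear_Algebra.orthogonal_def norm_eq_1 inner_e\<close>)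
  then show ?thesis by (simp add: sum.reindex inj_on_subset[OF inj_e])
qed

lemma summable_e: "summable (\<lambda>i. (inner (e i) x)\<^sup>2)"
  by (rule summableI_nonneg_bounded[of _ "(norm x)\<^sup>2"]) (simp_all add: bessel_e)

lemma eq_on_basis:
  assumes "bounded_linear f" "bounded_linear g" "\<And>i. f (e i) = g (e i)"
  shows "f x = g x"
  by (rule bounded_linear_eq_on_dense[OF assms(1,2) dense]) (use assms(3) in auto)

lemma eq_on_pair_basis:
  assumes f: "bounded_linear f" and g: "bounded_linear g"
    and "\<And>i. f (e i, 0) = g (e i, 0)" "\<And>i. f (0, e i) = g (0, e i)"
  shows "f z = g z"
proof -
  have L: "bounded_linear (\<lambda>x::'h. (x, 0::'h))" "bounded_linear (\<lambda>x::'h. (0::'h, x))"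
    by (intro bounded_linear_Pair bounded_linear_ident bounded_linear_zero)+
  have "f (x, 0) = g (x, 0)" for x
    by (rule eq_on_basis[of "\<lambda>x. f (x, 0)" "\<lambda>x. g (x, 0)"])
      (intro bounded_linear_compose[OF f L(1)] bounded_linear_compose[OF g L(1)] assms)+
  moreover have "f (0, y) = g (0, y)" for y
    by (rule eq_on_basis[of "\<lambda>x. f (0, x)" "\<lambda>x. g (0, x)"])
      (intro bounded_linear_compose[OF f L(2)] bounded_linear_compose[OF g L(2)] assms)+
  moreover have "z = (fst z, 0) + (0, snd z)" by simp
  ultimately show ?thesis
    using linear_add[OF bounded_linear.linear[OF f], of "(fst z, 0)" "(0, snd z)"]
      linear_add[OF bounded_linear.linear[OF g], of "(fst z, 0)" "(0, snd z)"] by metis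
qed

text \<open>The assumed estimate makes the partial sums Cauchy. It is a hypothesis because the
  images in the main application are orthogonal for the form of \<open>S\<close>, not for the
  ambient inner product.\<close>

lemma series_operator:
  fixes v :: "nat \<Rightarrow> 'k::{real_inner, complete_space}"
  assumes C: "C \<ge> 0" "\<And>c A. finite A \<Longrightarrow> (norm (\<Sum>i\<in>A. c i *\<^sub>R v i))\<^sup>2 \<le> C * (\<Sum>i\<in>A. (c i)\<^sup>2)"
  shows "\<exists>T. bounded_linear T \<and> (\<forall>i. T (e i) = v i)"
proof -
  define s where "s x n = (\<Sum>i<n. inner (e i) x *\<^sub>R v i)" for x n
  have diff: "(norm (s x n - s x m))\<^sup>2 \<le> C * (\<Sum>i\<in>{m..<n}. (inner (e i) x)\<^sup>2)" if "m \<le> n" for x m n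
  proof -
    have "s x n - s x m = (\<Sum>i\<in>{m..<n}. inner (e i) x *\<^sub>R v i)"
      unfolding s_def lessThan_atLeast0 by (rule sum_diff_nat_ivl[OF le0 that])
    then show ?thesis using C(2) by simp
  qed
  have cauchy: "Cauchy (s x)" for x
  proof (rule CauchyI')
    fix r :: real assume r: "r > 0"
    \<comment> \<open>\<open>C + 1\<close> in place of \<open>C\<close> admits
      \<open>C = 0\<close>.\<close>
    have "r\<^sup>2 / (C + 1) > 0" using r C(1) by simp
    from summable_e[of x, unfolded summable_Cauchy, rule_format, OF this]
    obtain M where M: "\<And>m n. m \<ge> M \<Longrightarrow> norm (\<Sum>i\<in>{m..<n}. (inner (e i) x)\<^sup>2) < r\<^sup>2 / (C + 1)"
      by blast
    show "\<exists>M. \<forall>m\<ge>M. \<forall>n>m. dist (s x m) (s x n) < r"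
    proof (intro exI allI impI)
      fix m n assume mn: "m \<ge> M" "n > m"
      have "(norm (s x n - s x m))\<^sup>2 \<le> C * (\<Sum>i\<in>{m..<n}. (inner (e i) x)\<^sup>2)" using diff mn by simp
      also have "\<dots> \<le> C * (r\<^sup>2 / (C + 1))" using M[OF mn(1), of n] C(1) by (intro mult_left_mono) auto
      also have "\<dots> < r\<^sup>2" using r C(1) by (simp add: pos_divide_less_eq)
      finally have "norm (s x n - s x m) < r" using r power2_less_imp_less by force
      then show "dist (s x m) (s x n) < r" by (simp add: dist_norm norm_minus_commute)
    qed
  qed
  define T where "T x = lim (s x)" for x
  have T: "s x \<longlonglongrightarrow> T x" for x
    unfolding T_def using cauchy[of x] by (simp add: Cauchy_convergent_iff convergent_LIMSEQ_iff)
  have "bounded_linear T"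
  proof (rule bounded_linear_intro[where K="sqrt C"])
    show "T (x + y) = T x + T y" for x y
    proof (rule LIMSEQ_unique[OF T])
      have "s (x + y) = (\<lambda>n. s x n + s y n)"
        by (simp add: s_def fun_eq_iff inner_add_right scaleR_add_left sum.distrib)
      then show "s (x + y) \<longlonglongrightarrow> T x + T y" using tendsto_add[OF T[of x] T[of y]] by simp
    qed
    show "T (a *\<^sub>R x) = a *\<^sub>R T x" for a x
    proof (rule LIMSEQ_unique[OF T])
      have "s (a *\<^sub>R x) = (\<lambda>n. a *\<^sub>R s x n)"
        by (simp add: s_def fun_eq_iff scaleR_sum_right)
      then show "s (a *\<^sub>R x) \<longlonglongrightarrow> a *\<^sub>R T x" using tendsto_scaleR[OF tendsto_const T[of x]] by simp
    qed
    show "norm (T x) \<le> norm x * sqrt C" for x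
    proof (rule LIMSEQ_le_const2)
      show "(\<lambda>n. norm (s x n)) \<longlonglongrightarrow> norm (T x)" by (intro tendsto_norm T)
      have "norm (s x n) \<le> norm x * sqrt C" for n
      proof -
        have "(norm (s x n))\<^sup>2 \<le> C * (\<Sum>i<n. (inner (e i) x)\<^sup>2)" unfolding s_def by (rule C(2)) simp
        also have "\<dots> \<le> C * (norm x)\<^sup>2" using C(1) bessel_e by (intro mult_left_mono) auto
        also have "\<dots> = (norm x * sqrt C)\<^sup>2" using C(1) by (simp add: power_mult_distrib)
        finally show ?thesis by (rule power2_le_imp_le) (use C(1) in simp)
      qed
      then show "\<exists>N. \<forall>n\<ge>N. norm (s x n) \<le> norm x * sqrt C" by blast
    qed
  qed
  moreover have "T (e j) = v j" for j
  proof (rule LIMSEQ_unique[OF T])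
    have "s (e j) n = v j" if "n \<ge> Suc j" for n
    proof -
      have "s (e j) n = (\<Sum>i<n. if i = j then v j else 0)"
        unfolding s_def by (intro sum.cong) (auto simp: inner_e)
      then show ?thesis using that by simp
    qed
    then show "s (e j) \<longlonglongrightarrow> v j" by (intro tendsto_eventually) (use eventually_sequentially in blast)
  qed
  ultimately show ?thesis by blast
qed

lemma diagonal_operator:
  assumes d: "\<And>i. \<bar>d i\<bar> \<le> C"
  shows "\<exists>D. bounded_linear D \<and> (\<forall>i. D (e i) = d i *\<^sub>R e i)"
proof (rule series_operator[of "C\<^sup>2"])
  fix c :: "nat \<Rightarrow> real" and A :: "nat set" assume A: "finite A"
  have "(norm (\<Sum>i\<in>A. c i *\<^sub>R d i *\<^sub>R e i))\<^sup>2 = (norm (\<Sum>b\<in>e ` A. (c (inv_into UNIV e b) * d (inv_into UNIV e b)) *\<^sub>R b))\<^sup>2"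
    by (simp add: sum.reindex inj_on_subset[OF inj_e] inj_e)
  also have "\<dots> = (\<Sum>b\<in>e ` A. (c (inv_into UNIV e b) * d (inv_into UNIV e b))\<^sup>2)"
    by (rule orthonormal_norm_sum) (use A in \<open>auto simp: pairwise_def Linear_Algebra.orthogonal_def norm_eq_1 inner_e\<close>)
  also have "\<dots> = (\<Sum>i\<in>A. (d i)\<^sup>2 * (c i)\<^sup>2)"
    by (simp add: sum.reindex inj_on_subset[OF inj_e] inj_e power_mult_distrib mult.commute)
  also have "\<dots> \<le> (\<Sum>i\<in>A. C\<^sup>2 * (c i)\<^sup>2)"
  proof (intro sum_mono mult_right_mono)
    show "(d i)\<^sup>2 \<le> C\<^sup>2" for i using power_mono[OF d[of i], of 2] by simp
  qed simp
  finally show "(norm (\<Sum>i\<in>A. c i *\<^sub>R d i *\<^sub>R e i))\<^sup>2 \<le> C\<^sup>2 * (\<Sum>i\<in>A. (c i)\<^sup>2)"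
    by (simp add: sum_distrib_left)
qed simp

lemma positive_diagonal_operator:
  assumes d: "\<And>i. 1 \<le> d i" "\<And>i. d i \<le> C"
  shows "\<exists>D. positive_op D \<and> invertible_op D \<and> (\<forall>i. D (e i) = d i *\<^sub>R e i)"
proof -
  have "\<bar>d i\<bar> \<le> C" for i using d[of i] by simp
  from diagonal_operator[of d C, OF this]
  obtain D where D: "bounded_linear D" "\<And>i. D (e i) = d i *\<^sub>R e i" by blast
  have "\<bar>1 / d i\<bar> \<le> 1" for i using d(1)[of i] by simp
  from diagonal_operator[of "\<lambda>i. 1 / d i" 1, OF this]
  obtain E where E: "bounded_linear E" "\<And>i. E (e i) = (1 / d i) *\<^sub>R e i" by blast
  \<comment> \<open>The diagonal square root \<open>Q\<close>: writing \<open>inner (D x) y\<close>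
    as \<open>inner (Q x) (Q y)\<close> yields symmetry and positivity at once.\<close>
  have "\<bar>sqrt (d i)\<bar> \<le> sqrt C" for i
    using real_sqrt_le_mono[OF d(2)[of i]] d(1)[of i] by simp
  from diagonal_operator[of "\<lambda>i. sqrt (d i)" "sqrt C", OF this]
  obtain Q where Q: "bounded_linear Q" "\<And>i. Q (e i) = sqrt (d i) *\<^sub>R e i" by blast
  have lin: "linear D" "linear E" "linear Q" using D(1) E(1) Q(1) bounded_linear.linear by blast+
  have dpos: "d i > 0" for i using d(1)[of i] by simp
  have "D (E x) = x" for x
    by (rule eq_on_basis[OF bounded_linear_compose[OF D(1) E(1)] bounded_linear_ident])
      (use dpos in \<open>simp add: E D linear_scale[OF lin(1)] less_imp_neq[THEN not_sym]\<close>)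
  moreover have "E (D x) = x" for x
    by (rule eq_on_basis[OF bounded_linear_compose[OF E(1) D(1)] bounded_linear_ident])
      (use dpos in \<open>simp add: E D linear_scale[OF lin(2)] less_imp_neq[THEN not_sym]\<close>)
  ultimately have inv: "invertible_op D"
    unfolding invertible_op_def using D(1) E(1) by (auto simp: fun_eq_iff)
  have QQ: "inner (D x) y = inner (Q x) (Q y)" for x y
  proof (rule eq_on_basis[of "\<lambda>x. inner (D x) y" "\<lambda>x. inner (Q x) (Q y)"])
    show "bounded_linear (\<lambda>x. inner (D x) y)" "bounded_linear (\<lambda>x. inner (Q x) (Q y))"
      by (rule bounded_linear_compose[OF bounded_linear_inner_left D(1)],
          rule bounded_linear_compose[OF bounded_linear_inner_left Q(1)])
    fix i
    show "inner (D (e i)) y = inner (Q (e i)) (Q y)"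
    proof (rule eq_on_basis[of "\<lambda>y. inner (D (e i)) y" "\<lambda>y. inner (Q (e i)) (Q y)"])
      show "bounded_linear (\<lambda>y. inner (D (e i)) y)" by (rule bounded_linear_inner_right)
      show "bounded_linear (\<lambda>y. inner (Q (e i)) (Q y))"
        by (rule bounded_linear_compose[OF bounded_linear_inner_right Q(1)])
      show "inner (D (e i)) (e j) = inner (Q (e i)) (Q (e j))" for j
        using dpos[of i] by (auto simp: D Q inner_e)
    qed
  qed
  have "positive_op D"
    unfolding positive_op_def symmetric_op_def
  proof (intro conjI allI D(1))
    show "inner (D x) y = inner x (D y)" for x y by (metis QQ inner_commute)
    show "0 \<le> inner x (D x)" for x using QQ[of x x] by (simp add: inner_commute)
  qed
  with inv D(2) show ?thesis by blast
qed

end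

section \<open>From frames to symplectic systems\<close>

context gaussian_form
begin

lemma symplectic_frameD:
  assumes fr: "symplectic_frame X b d C"
  shows "x \<in> X \<Longrightarrow> x \<in> Z" "x \<in> X \<Longrightarrow> b x \<in> Z" "x \<in> X \<Longrightarrow> 1 \<le> d x" "x \<in> X \<Longrightarrow> d x \<le> C"
    "x \<in> X \<Longrightarrow> y \<in> X \<Longrightarrow> form x y = (if x = y then 1 else 0)"
    "x \<in> X \<Longrightarrow> y \<in> X \<Longrightarrow> form (b x) (b y) = (if x = y then 1 else 0)"
    "x \<in> X \<Longrightarrow> y \<in> X \<Longrightarrow> form x (b y) = 0" "x \<in> X \<Longrightarrow> y \<in> X \<Longrightarrow> form (b x) y = 0"
    "x \<in> X \<Longrightarrow> z \<in> Z \<Longrightarrow> form x z = d x * inner (J (b x)) z"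
    "x \<in> X \<Longrightarrow> z \<in> Z \<Longrightarrow> form (b x) z = - d x * inner (J x) z"
    "z \<in> Z \<Longrightarrow> (\<And>x. x \<in> X \<Longrightarrow> form x z = 0 \<and> form (b x) z = 0) \<Longrightarrow> z = 0"
proof -
  note frd = fr[unfolded symplectic_frame_def]
  note c1 = conjunct1[OF frd] and c2 = conjunct1[OF conjunct2[OF frd]]
    and c3 = conjunct1[OF conjunct2[OF conjunct2[OF frd]]]
    and c4 = conjunct1[OF conjunct2[OF conjunct2[OF conjunct2[OF frd]]]]
    and c5 = conjunct2[OF conjunct2[OF conjunct2[OF conjunct2[OF frd]]]]
  note c3' = c3[THEN bspec, THEN bspec] and c4' = c4[THEN bspec, THEN bspec]
  show "x \<in> X \<Longrightarrow> x \<in> Z" using c1 by blast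
  show "x \<in> X \<Longrightarrow> b x \<in> Z" "x \<in> X \<Longrightarrow> 1 \<le> d x" "x \<in> X \<Longrightarrow> d x \<le> C" using c2 by blast+
  show "x \<in> X \<Longrightarrow> y \<in> X \<Longrightarrow> form x y = (if x = y then 1 else 0)" by (rule c3'[THEN conjunct1])
  show "x \<in> X \<Longrightarrow> y \<in> X \<Longrightarrow> form (b x) (b y) = (if x = y then 1 else 0)"
    by (rule c3'[THEN conjunct2, THEN conjunct1])
  show "x \<in> X \<Longrightarrow> y \<in> X \<Longrightarrow> form x (b y) = 0" by (rule c3'[THEN conjunct2, THEN conjunct2])
  show "x \<in> X \<Longrightarrow> y \<in> X \<Longrightarrow> form (b x) y = 0"
    by (subst form_sym) (rule c3'[THEN conjunct2, THEN conjunct2])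
  show "x \<in> X \<Longrightarrow> z \<in> Z \<Longrightarrow> form x z = d x * inner (J (b x)) z" by (rule c4'[THEN conjunct1])
  show "x \<in> X \<Longrightarrow> z \<in> Z \<Longrightarrow> form (b x) z = - d x * inner (J x) z" by (rule c4'[THEN conjunct2])
  show "z \<in> Z \<Longrightarrow> (\<And>x. x \<in> X \<Longrightarrow> form x z = 0 \<and> form (b x) z = 0) \<Longrightarrow> z = 0" using c5 by simp
qed

text \<open>A frame pair has pairing 1 / d; the factor sqrt d on both vectors makes it a symplectic
  pair with form value d.\<close>

lemma symplectic_frame_system:
  assumes fr: "symplectic_frame X b d C" and g: "inj_on g I" "g ` I \<subseteq> X"
  shows "symplectic_system I (\<lambda>i. sqrt (d (g i)) *\<^sub>R g i) (\<lambda>i. sqrt (d (g i)) *\<^sub>R b (g i)) (\<lambda>i. d (g i))"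
  unfolding symplectic_system_def
proof (intro conjI ballI)
  fix i assume i: "i \<in> I"
  have gi: "g i \<in> X" using g(2) i by blast
  note X = symplectic_frameD(1-3)[OF fr gi]
  show "sqrt (d (g i)) *\<^sub>R g i \<in> Z" "sqrt (d (g i)) *\<^sub>R b (g i) \<in> Z"
    by (intro subspace_scale[OF Z(1)] X)+
  show dpos: "d (g i) > 0" using X(3) by simp
  show "form (sqrt (d (g i)) *\<^sub>R g i) z = d (g i) * inner (J (sqrt (d (g i)) *\<^sub>R b (g i))) z"
    "form (sqrt (d (g i)) *\<^sub>R b (g i)) z = - d (g i) * inner (J (sqrt (d (g i)) *\<^sub>R g i)) z" if z: "z \<in> Z" for z
  proof -
    note 1 = symplectic_frameD(9,10)[OF fr gi z]
    show "form (sqrt (d (g i)) *\<^sub>R g i) z = d (g i) * inner (J (sqrt (d (g i)) *\<^sub>R b (g i))) z"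
      "form (sqrt (d (g i)) *\<^sub>R b (g i)) z = - d (g i) * inner (J (sqrt (d (g i)) *\<^sub>R g i)) z"
      by (simp_all only: form_simps 1 linear_scale[OF J_lin] inner_scaleR_left) simp_all
  qed
  fix j assume j: "j \<in> I"
  have gj: "g j \<in> X" using g(2) j by blast
  note 2 = symplectic_frameD(5-7)[OF fr gi gj]
  have 3: "g i = g j \<longleftrightarrow> i = j" using g(1) i j by (rule inj_on_eq_iff)
  have 4: "sqrt (d (g i)) * sqrt (d (g i)) = d (g i)" using dpos by simp
  show "form (sqrt (d (g i)) *\<^sub>R g i) (sqrt (d (g j)) *\<^sub>R g j) = (if i = j then d (g i) else 0)"
    "form (sqrt (d (g i)) *\<^sub>R b (g i)) (sqrt (d (g j)) *\<^sub>R b (g j)) = (if i = j then d (g i) else 0)"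
    "form (sqrt (d (g i)) *\<^sub>R g i) (sqrt (d (g j)) *\<^sub>R b (g j)) = 0"
    unfolding form_simps 2 3 using 4 by auto
qed

text \<open>Subtract the form-orthogonal projection to the finite frame; completeness of the frame
  kills the rest.\<close>

lemma symplectic_frame_finite_span:
  assumes fr: "symplectic_frame X b d C" and X: "finite X" and z: "z \<in> Z"
  shows "z \<in> span (X \<union> b ` X)"
proof -
  note XZ = symplectic_frameD(1,2)[OF fr] and ff = symplectic_frameD(5-8)[OF fr]
  define p where "p = (\<Sum>x\<in>X. form x z *\<^sub>R x + form (b x) z *\<^sub>R b x)"
  have "z - p \<in> Z"
    unfolding p_def
    by (intro subspace_diff[OF Z(1) z] subspace_sum[OF Z(1)] subspace_add[OF Z(1)] subspace_scale[OF Z(1)] XZ)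
  moreover have "form x (z - p) = 0 \<and> form (b x) (z - p) = 0" if x: "x \<in> X" for x
  proof -
    have "form x p = (\<Sum>y\<in>X. if y = x then form x z else 0)"
      unfolding p_def form_sum by (intro sum.cong) (use ff x in \<open>auto simp: form_simps\<close>)
    moreover have "form (b x) p = (\<Sum>y\<in>X. if y = x then form (b x) z else 0)"
      unfolding p_def form_sum by (intro sum.cong) (use ff x in \<open>auto simp: form_simps\<close>)
    ultimately show ?thesis using X x by (simp add: form_simps)
  qed
  ultimately have "z - p = 0" by (rule symplectic_frameD(11)[OF fr])
  then have "z = p" by simp
  moreover have "p \<in> span (X \<union> b ` X)" unfolding p_def by (intro span_sum span_add span_scale span_base) auto
  ultimately show ?thesis by simp
qed

end


section \<open>Existence of the Williamson form\<close>

lemma (in coercive_form) form_bessel: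
  assumes "finite F" "\<And>x y. x \<in> F \<Longrightarrow> y \<in> F \<Longrightarrow> form x y = (if x = y then 1 else 0)"
  shows "(\<Sum>x\<in>F. (form x v)\<^sup>2) \<le> q v"
proof -
  define p where "p = (\<Sum>x\<in>F. form x v *\<^sub>R x)"
  have xp: "form x p = form x v" if x: "x \<in> F" for x
  proof -
    have "form x p = (\<Sum>y\<in>F. if y = x then form x v else 0)"
      unfolding p_def form_sum by (intro sum.cong) (use assms(2) x in \<open>auto simp: form_simps\<close>)
    then show ?thesis using assms(1) x by simp
  qed
  have "form p p = (\<Sum>x\<in>F. form x v * form x p)" by (subst (1) p_def) (simp add: form_sum form_simps)
  also have "\<dots> = (\<Sum>x\<in>F. (form x v)\<^sup>2)" by (intro sum.cong) (simp_all add: xp power2_eq_square)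
  finally have pp: "form p p = (\<Sum>x\<in>F. (form x v)\<^sup>2)" .
  have "form p v = (\<Sum>x\<in>F. (form x v)\<^sup>2)"
    unfolding p_def form_sum by (simp add: form_simps power2_eq_square)
  moreover have "0 \<le> q (v - p)" by (rule q_nonneg)
  ultimately show ?thesis using pp form_sym[of v p] by (simp add: form_simps)
qed

text \<open>By Bessel's inequality, only finitely many members can have a squared coefficient above
  1 / (n + 1).\<close>

lemma (in coercive_form) form_orthonormal_countable_support:
  assumes "\<And>x y. x \<in> X \<Longrightarrow> y \<in> X \<Longrightarrow> form x y = (if x = y then 1 else 0)"
  shows "countable {x \<in> X. form x v \<noteq> 0}"
proof -
  have fin: "finite {x \<in> X. 1 / (real n + 1) < (form x v)\<^sup>2}" for n
  proof (rule ccontr)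
    assume inf: "infinite {x \<in> X. 1 / (real n + 1) < (form x v)\<^sup>2}"
    obtain m where m: "q v * (real n + 1) < real m" using reals_Archimedean2 by blast
    obtain F where F: "finite F" "card F = m" "F \<subseteq> {x \<in> X. 1 / (real n + 1) < (form x v)\<^sup>2}"
      using infinite_arbitrarily_large[OF inf] by metis
    have "real m * (1 / (real n + 1)) = (\<Sum>x\<in>F. 1 / (real n + 1))" using F(2) by simp
    also have "\<dots> \<le> (\<Sum>x\<in>F. (form x v)\<^sup>2)" using F(3) by (intro sum_mono) auto
    also have "\<dots> \<le> q v" by (rule form_bessel[OF F(1)]) (use F(3) assms in blast)
    finally show False using m by (simp add: field_simps)
  qed
  have "{x \<in> X. form x v \<noteq> 0} \<subseteq> (\<Union>n. {x \<in> X. 1 / (real n + 1) < (form x v)\<^sup>2})"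
  proof
    fix x assume x: "x \<in> {x \<in> X. form x v \<noteq> 0}"
    then have "(form x v)\<^sup>2 > 0" by simp
    then obtain n where "1 / (real n + 1) < (form x v)\<^sup>2"
      using reals_Archimedean[of "(form x v)\<^sup>2"] by (auto simp: inverse_eq_divide add.commute)
    then show "x \<in> (\<Union>n. {x \<in> X. 1 / (real n + 1) < (form x v)\<^sup>2})" using x by blast
  qed
  then show ?thesis by (rule countable_subset) (simp add: fin countable_finite)
qed

locale williamson_existence = gaussian_form S \<delta> symp_J UNIV + hilbert_sequence e
  for S :: "'h::{real_inner, complete_space} \<times> 'h \<Rightarrow> 'h \<times> 'h" and \<delta> and e :: "nat \<Rightarrow> 'h"
begin

text \<open>Zorn's lemma gives no hold on the size of a frame, but the Williamson operator lives on
  the space with basis \<open>e\<close>. Being infinite, and countable by the next lemma, the frame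
  can be matched with \<open>e\<close>.\<close>

lemma frame_infinite:
  assumes fr: "symplectic_frame X b d C"
  shows "infinite X"
proof
  assume X: "finite X"
  define T where "T = X \<union> b ` X"
  have "finite T" using X by (simp add: T_def)
  moreover have "independent (range (\<lambda>i. (e i, 0::'h)))"
  proof (rule pairwise_orthogonal_independent)
    show "pairwise orthogonal (range (\<lambda>i. (e i, 0::'h)))"
      by (auto simp: pairwise_def Linear_Algebra.orthogonal_def inner_e)
    have "e i \<noteq> 0" for i using inner_e[of i i] by auto
    then show "0 \<notin> range (\<lambda>i. (e i, 0::'h))" by (auto simp: zero_prod_def)
  qed
  moreover have "range (\<lambda>i. (e i, 0::'h)) \<subseteq> span T"
    unfolding T_def using symplectic_frame_finite_span[OF fr X] by blast
  ultimately have "finite (range (\<lambda>i. (e i, 0::'h)))" using independent_span_bound by blast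
  moreover have "inj (\<lambda>i. (e i, 0::'h))" using inj_e by (auto simp: inj_def)
  ultimately show False using finite_imageD by blast
qed

text \<open>A member has form value 1 with itself, so it is not form-orthogonal to all basis
  vectors, and each of these sees only countably many members.\<close>

lemma frame_countable:
  assumes fr: "symplectic_frame X b d C"
  shows "countable X"
proof -
  have "X \<subseteq> (\<Union>i. {x \<in> X. form x (e i, 0) \<noteq> 0}) \<union> (\<Union>i. {x \<in> X. form x (0, e i) \<noteq> 0})"
  proof (rule subsetI, rule ccontr)
    fix x assume x: "x \<in> X"
      and "x \<notin> (\<Union>i. {x \<in> X. form x (e i, 0) \<noteq> 0}) \<union> (\<Union>i. {x \<in> X. form x (0, e i) \<noteq> 0})"
    then have z: "form x (e i, 0) = 0" "form x (0, e i) = 0" for i by auto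
    have "bounded_linear (form x)"
      unfolding form_def by (rule bounded_linear_compose[OF bounded_linear_inner_right S_bl])
    then have "form x x = 0" using eq_on_pair_basis[of "form x" "\<lambda>_. 0" x] z by simp
    then show False using symplectic_frameD(5)[OF fr x x] by simp
  qed
  moreover have "countable {x \<in> X. form x v \<noteq> 0}" for v
    by (rule form_orthonormal_countable_support) (rule symplectic_frameD(5)[OF fr])
  ultimately show ?thesis by (meson countable_UN countable_Un countable_subset countableI_type)
qed

lemma system_series_operator:
  assumes v: "\<And>i j. form (v i) (v j) = (if i = j then d i else 0)" and d: "\<And>i. d i \<le> C" and C: "C \<ge> 0"
  shows "\<exists>T. bounded_linear T \<and> (\<forall>i. T (e i) = v i)"
proof (rule series_operator[of "C / \<delta>"])
  show "C / \<delta> \<ge> 0" using C delta_pos by simp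
  fix c :: "nat \<Rightarrow> real" and A :: "nat set" assume A: "finite A"
  define x where "x = (\<Sum>i\<in>A. c i *\<^sub>R v i)"
  have vx: "form (v i) x = c i * d i" if "i \<in> A" for i
  proof -
    have "form (v i) x = (\<Sum>j\<in>A. if j = i then c i * d i else 0)"
      unfolding x_def form_sum by (intro sum.cong) (auto simp: form_simps v)
    then show ?thesis using A that by simp
  qed
  have "q x = (\<Sum>i\<in>A. c i * form (v i) x)" by (subst (1) x_def) (simp add: form_sum form_simps)
  also have "\<dots> = (\<Sum>i\<in>A. d i * (c i)\<^sup>2)" by (intro sum.cong) (simp_all add: vx power2_eq_square)
  also have "\<dots> \<le> (\<Sum>i\<in>A. C * (c i)\<^sup>2)" using d by (intro sum_mono mult_right_mono) auto
  finally have "\<delta> * (norm x)\<^sup>2 \<le> C * (\<Sum>i\<in>A. (c i)\<^sup>2)"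
    using form_coercive[of x] by (simp add: sum_distrib_left)
  then show "(norm (\<Sum>i\<in>A. c i *\<^sub>R v i))\<^sup>2 \<le> C / \<delta> * (\<Sum>i\<in>A. (c i)\<^sup>2)"
    using delta_pos by (simp add: x_def field_simps)
qed

text \<open>\<open>N\<close> sends the standard symplectic basis to the system, and M = - J N^T J is
  the inverse that a symplectic \<open>N\<close> must have. M N = I is symplecticity; N M = I does
  not follow from it in infinite dimension and comes from totality of the system.\<close>

lemma system_williamson:
  assumes sys: "symplectic_system UNIV a b d" and d: "\<And>i. 1 \<le> d i" "\<And>i. d i \<le> C"
    and total: "\<And>z. (\<And>i. form (a i) z = 0 \<and> form (b i) z = 0) \<Longrightarrow> z = 0"
  shows "\<exists>D. williamson_op S D"
proof -
  note sysD = symplectic_systemD[OF sys UNIV_I]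
  have C: "C \<ge> 0" using d[of 0] by simp
  obtain A where A: "bounded_linear A" "\<And>i. A (e i) = a i"
    using system_series_operator[of a d C, OF sysD(4)[OF UNIV_I] d(2) C] by blast
  obtain B where B: "bounded_linear B" "\<And>i. B (e i) = b i"
    using system_series_operator[of b d C, OF sysD(5)[OF UNIV_I] d(2) C] by blast
  obtain D where D: "positive_op D" "invertible_op D" "\<And>i. D (e i) = d i *\<^sub>R e i"
    using positive_diagonal_operator[of d C] d by blast
  have D_bl: "bounded_linear D" using D(1) by (simp add: positive_op_def symmetric_op_def)
  have D_lin: "linear D" by (rule bounded_linear.linear[OF D_bl])
  define N where "N z = A (fst z) + B (snd z)" for z
  have N_bl: "bounded_linear N"
    unfolding N_def by (intro bounded_linear_add bounded_linear_compose[OF A(1)] bounded_linear_compose[OF B(1)]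
        bounded_linear_fst bounded_linear_snd)
  have N_lin: "linear N" by (rule bounded_linear.linear[OF N_bl])
  have A0: "A 0 = 0" "B 0 = 0"
    using A(1) B(1) by (auto simp: bounded_linear.linear linear_0)
  have N: "N (e i, 0) = a i" "N (0, e i) = b i" for i by (simp_all add: N_def A0 A B)
  have dpos: "d i > 0" for i using d(1)[of i] by simp
  have Jab: "inner (symp_J (a i)) (a j) = 0" "inner (symp_J (b i)) (b j) = 0"
    "inner (symp_J (b i)) (a j) = (if i = j then 1 else 0)" "inner (symp_J (a i)) (b j) = - (if i = j then 1 else 0)" for i j
  proof -
    have 1: "form (a i) z = d i * inner (symp_J (b i)) z" "form (b i) z = - d i * inner (symp_J (a i)) z" for z
      by (rule sysD(8)[OF UNIV_I], rule sysD(9)[OF UNIV_I])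
    show "inner (symp_J (a i)) (a j) = 0" "inner (symp_J (b i)) (b j) = 0"
      using 1[of "a j"] 1[of "b j"] sysD(4-7)[of j i, OF UNIV_I] dpos[of i] by (auto split: if_splits)
    have 2: "inner (symp_J (b i)) (a j) = (if i = j then 1 else 0)" for i j
      using sysD(8)[OF UNIV_I, of i "a j"] sysD(4)[of j i, OF UNIV_I] dpos[of i] by (auto split: if_splits)
    then show "inner (symp_J (b i)) (a j) = (if i = j then 1 else 0)" .
    show "inner (symp_J (a i)) (b j) = - (if i = j then 1 else 0)"
      unfolding J_antisym[of "a i" "b j"] 2 by simp
  qed
  have NJ: "inner (symp_J (N u)) (N w) = inner (symp_J u) w" for u w
  proof (rule eq_on_pair_basis[of "\<lambda>u. inner (symp_J (N u)) (N w)" "\<lambda>u. inner (symp_J u) w"])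
    show "bounded_linear (\<lambda>u. inner (symp_J (N u)) (N w))" "bounded_linear (\<lambda>u. inner (symp_J u) w)"
      by (rule bounded_linear_compose[OF bounded_linear_inner_left bounded_linear_compose[OF symp_J_bl N_bl]],
          rule bounded_linear_compose[OF bounded_linear_inner_left symp_J_bl])
    have bl: "bounded_linear (\<lambda>w. inner y (N w))" "bounded_linear (\<lambda>w. inner y w)" for y
      by (rule bounded_linear_compose[OF bounded_linear_inner_right N_bl], rule bounded_linear_inner_right)
    fix i
    show "inner (symp_J (N (e i, 0))) (N w) = inner (symp_J (e i, 0)) w"
      by (rule eq_on_pair_basis[OF bl]) (simp_all add: N Jab, simp_all add: symp_J_def inner_e)
    show "inner (symp_J (N (0, e i))) (N w) = inner (symp_J (0, e i)) w"
      by (rule eq_on_pair_basis[OF bl]) (simp_all add: N Jab, simp_all add: symp_J_def inner_e)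
  qed
  \<comment> \<open>The right side is \<open>adjoint M\<close> applied to the doubled D, so this is
    the Williamson identity multiplied by \<open>N\<close> from the right.\<close>
  have SN: "S (N w) = - symp_J (N (symp_J (map_prod D D w)))" for w
  proof (rule eq_on_pair_basis[of "\<lambda>w. S (N w)" "\<lambda>w. - symp_J (N (symp_J (map_prod D D w)))"])
    show "bounded_linear (\<lambda>w. S (N w))" by (rule bounded_linear_compose[OF S_bl N_bl])
    have "map_prod D D = (\<lambda>w. (D (fst w), D (snd w)))" by (simp add: fun_eq_iff map_prod_def split_beta)
    then have "bounded_linear (map_prod D D)"
      by (simp add: bounded_linear_Pair bounded_linear_compose[OF D_bl] bounded_linear_fst bounded_linear_snd)
    then show "bounded_linear (\<lambda>w. - symp_J (N (symp_J (map_prod D D w))))"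
      by (intro bounded_linear_minus bounded_linear_compose[OF symp_J_bl] bounded_linear_compose[OF N_bl])
    fix i
    have Sa: "S (a i) = d i *\<^sub>R symp_J (b i)"
    proof (rule vector_eq_rdot[THEN iffD1], rule allI)
      fix z show "inner (S (a i)) z = inner (d i *\<^sub>R symp_J (b i)) z"
        using sysD(8)[of z i] by (simp add: form_def S_sym)
    qed
    have Sb: "S (b i) = - d i *\<^sub>R symp_J (a i)"
    proof (rule vector_eq_rdot[THEN iffD1], rule allI)
      fix z show "inner (S (b i)) z = inner (- d i *\<^sub>R symp_J (a i)) z"
        using sysD(9)[of z i] by (simp add: form_def S_sym)
    qed
    have 1: "symp_J (d i *\<^sub>R e i, 0) = - d i *\<^sub>R (0, e i)" "symp_J (0, d i *\<^sub>R e i) = d i *\<^sub>R (e i, 0)"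
      by (simp_all add: symp_J_def)
    show "S (N (e i, 0)) = - symp_J (N (symp_J (map_prod D D (e i, 0))))"
      by (simp only: map_prod_simp D linear_0[OF D_lin] 1 linear_scale[OF N_lin] N Sa linear_scale[OF symp_J_lin]) simp
    show "S (N (0, e i)) = - symp_J (N (symp_J (map_prod D D (0, e i))))"
      by (simp only: map_prod_simp D linear_0[OF D_lin] 1 linear_scale[OF N_lin] N Sb linear_scale[OF symp_J_lin]) simp
  qed
  define M where "M z = - symp_J (adjoint N (symp_J z))" for z
  have M_bl: "bounded_linear M"
    unfolding M_def by (intro bounded_linear_minus bounded_linear_compose[OF symp_J_bl]
        bounded_linear_compose[OF adjoint_bounded_linear[OF N_bl]] symp_J_bl)
  have M_adj: "inner (M x) y = inner x (- symp_J (N (symp_J y)))" for x y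
  proof -
    have "inner (M x) y = inner (adjoint N (symp_J x)) (symp_J y)" by (simp add: M_def symp_J_skew)
    also have "\<dots> = inner (N (symp_J y)) (symp_J x)"       by (subst inner_commute) (rule adjoint_inner[OF N_bl, symmetric])
    also have "\<dots> = inner (symp_J x) (N (symp_J y))" by (rule inner_commute)
    also have "\<dots> = inner x (- symp_J (N (symp_J y)))" by (simp add: symp_J_skew)
    finally show ?thesis .
  qed
  have adjM: "adjoint M = (\<lambda>y. - symp_J (N (symp_J y)))"
    by (rule adjoint_unique) (simp add: M_adj)
  have MN: "M (N w) = w" for w
  proof (rule vector_eq_rdot[THEN iffD1], rule allI)
    fix z
    have "inner (M (N w)) z = inner (symp_J (N w)) (N (symp_J z))"
      by (simp add: M_adj symp_J_skew)
    also have "\<dots> = inner (symp_J w) (symp_J z)" by (rule NJ)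
    finally show "inner (M (N w)) z = inner w z" by (simp add: J_isometry)
  qed
  define W where "W = {z. N (M z) = z}"
  have W: "subspace W" "closed W"
  proof -
    have bl: "bounded_linear (\<lambda>z. N (M z))" by (rule bounded_linear_compose[OF N_bl M_bl])
    note lin = bounded_linear.linear[OF bl]
    show "subspace W" unfolding W_def
      by (rule subspaceI) (simp_all add: linear_0[OF lin] linear_add[OF lin] linear_scale[OF lin])
    show "closed W" unfolding W_def
      by (rule closed_Collect_eq[OF linear_continuous_on[OF bl] linear_continuous_on[OF bounded_linear_ident]])
  qed
  have abW: "a i \<in> W" "b i \<in> W" for i unfolding W_def by (simp_all add: N(1)[symmetric] N(2)[symmetric] MN)
  have "W = UNIV"
  proof (rule ccontr)
    assume "W \<noteq> UNIV"
    then obtain v where v: "v \<noteq> 0" "\<forall>w\<in>W. inner v w = 0" using orthogonal_complement_nontrivial[OF W] by blast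
    \<comment> \<open>A vector v orthogonal to the fixed space \<open>W\<close> is represented in
      the form by m; this m is form-orthogonal to the whole system, hence 0.\<close>
    obtain m where m: "\<And>y. form m y = inner v y"
      using representer[OF subspace_UNIV closed_UNIV bounded_linear_inner_right[of v]] by auto
    have "m = 0"
    proof (rule total)
      fix i
      show "form (a i) m = 0 \<and> form (b i) m = 0"
        using m[of "a i"] m[of "b i"] v(2) abW[of i] form_sym[of "a i" m] form_sym[of "b i" m] by simp
    qed
    then have "inner v v = 0" using m[of v] by (simp add: form_simps)
    then show False using v(1) by simp
  qed
  then have NM: "N (M z) = z" for z unfolding W_def by blast
  have "symplectic_op M"
    unfolding symplectic_op_def invertible_op_def
  proof (intro conjI exI[of _ N] M_bl N_bl)
    show "M \<circ> N = id" "N \<circ> M = id" using MN NM by auto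
    show "adjoint M \<circ> symp_J \<circ> M = symp_J"
      by (simp add: fun_eq_iff adjM NM linear_neg[OF N_lin] linear_neg[OF symp_J_lin])
  qed
  moreover have "S = adjoint M \<circ> map_prod D D \<circ> M"
  proof
    fix z
    have "S z = S (N (M z))" by (simp only: NM)
    then show "S z = (adjoint M \<circ> map_prod D D \<circ> M) z" by (simp only: SN adjM o_apply)
  qed
  ultimately show ?thesis unfolding williamson_op_def using D by blast
qed

lemma williamson_op_exists: "\<exists>D. williamson_op S D"
proof -
  obtain X b d C where fr: "symplectic_frame X b d C" using symplectic_frame_exists by blast
  define g where "g = from_nat_into X"
  have bij: "bij_betw g UNIV X"
    unfolding g_def by (rule bij_betw_from_nat_into[OF frame_countable[OF fr] frame_infinite[OF fr]])
  then have g: "inj g" "range g = X" by (auto simp: bij_betw_def)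
  have gX: "g i \<in> X" for i using g(2) by blast
  have d: "1 \<le> d (g i)" "d (g i) \<le> C" for i using symplectic_frameD(3,4)[OF fr gX] by auto
  show ?thesis
  proof (rule system_williamson[OF symplectic_frame_system[OF fr g(1) equalityD1[OF g(2)]] d])
    fix z assume z: "\<And>i. form (sqrt (d (g i)) *\<^sub>R g i) z = 0 \<and> form (sqrt (d (g i)) *\<^sub>R b (g i)) z = 0"
    show "z = 0"
    proof (rule symplectic_frameD(11)[OF fr UNIV_I])
      fix x assume "x \<in> X"
      then obtain i where x: "x = g i" using g(2) by blast
      have "d (g i) \<noteq> 0" using d(1)[of i] by linarith
      then show "form x z = 0 \<and> form (b x) z = 0" using z[of i] by (simp add: form_simps x)
    qed
  qed
qed

end


section \<open>Williamson forms of truncations\<close>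

context hilbert_sequence
begin

lemma inner_trunc_vec:
  assumes "i < 2 * n" "j < 2 * n"
  shows "inner (trunc_vec e n i) (trunc_vec e n j) = (if i = j then 1 else 0)"
  using assms by (auto simp: trunc_vec_def inner_e)

lemma trunc_vec_independent: "independent (trunc_vec e n ` {..<2 * n})" "card (trunc_vec e n ` {..<2 * n}) = 2 * n"
proof -
  have inj: "inj_on (trunc_vec e n) {..<2 * n}"
  proof (rule inj_onI)
    fix i j assume "i \<in> {..<2 * n}" "j \<in> {..<2 * n}" "trunc_vec e n i = trunc_vec e n j"
    then show "i = j" using inner_trunc_vec[of i n j] inner_trunc_vec[of i n i] by (auto split: if_splits)
  qed
  then show "card (trunc_vec e n ` {..<2 * n}) = 2 * n" by (simp add: card_image)
  show "independent (trunc_vec e n ` {..<2 * n})"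
  proof (rule pairwise_orthogonal_independent)
    show "pairwise orthogonal (trunc_vec e n ` {..<2 * n})"
      by (auto simp: pairwise_def Linear_Algebra.orthogonal_def inner_trunc_vec)
    show "0 \<notin> trunc_vec e n ` {..<2 * n}"
      using inner_trunc_vec by (metis imageE inner_zero_left lessThan_iff zero_neq_one)
  qed
qed

lemma symp_J_trunc_vec:
  "symp_J (trunc_vec e n i) = (if i < n then - trunc_vec e n (i + n) else trunc_vec e n (i - n))" if "i < 2 * n"
  using that by (auto simp: trunc_vec_def symp_J_def)

definition trunc_space :: "nat \<Rightarrow> ('h \<times> 'h) set" where
  "trunc_space n = span (trunc_vec e n ` {..<2 * n})"

lemma trunc_vec_in: "i < 2 * n \<Longrightarrow> trunc_vec e n i \<in> trunc_space n"
  unfolding trunc_space_def by (intro span_base) simp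

lemma trunc_proj_bl: "bounded_linear (trunc_proj e n)"
  unfolding trunc_proj_def[abs_def]
  by (intro bounded_linear_sum bounded_linear_scaleR_left[THEN bounded_linear_compose] bounded_linear_inner_right)

lemmas trunc_proj_lin = bounded_linear.linear[OF trunc_proj_bl]

lemma trunc_proj_in: "trunc_proj e n z \<in> trunc_space n"
  unfolding trunc_proj_def trunc_space_def by (intro span_sum span_scale span_base) simp

lemma trunc_proj_trunc_vec: "i < 2 * n \<Longrightarrow> trunc_proj e n (trunc_vec e n i) = trunc_vec e n i"
proof -
  assume i: "i < 2 * n"
  have "trunc_proj e n (trunc_vec e n i) = (\<Sum>j<2 * n. if j = i then trunc_vec e n i else 0)"
    unfolding trunc_proj_def by (rule sum.cong) (use i in \<open>auto simp: inner_trunc_vec\<close>)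
  then show ?thesis using i by simp
qed

lemma trunc_space_eq: "trunc_space n = {z. trunc_proj e n z = z}"
proof
  have "subspace {z. trunc_proj e n z = z}"
    by (rule subspaceI)
      (simp_all add: linear_0[OF trunc_proj_lin] linear_add[OF trunc_proj_lin] linear_scale[OF trunc_proj_lin])
  then show "trunc_space n \<subseteq> {z. trunc_proj e n z = z}"
    unfolding trunc_space_def by (intro span_minimal) (auto simp: trunc_proj_trunc_vec)
  show "{z. trunc_proj e n z = z} \<subseteq> trunc_space n"
  proof (rule subsetI)
    fix z assume "z \<in> {z. trunc_proj e n z = z}"
    then show "z \<in> trunc_space n" using trunc_proj_in[of n z] by simp
  qed
qed

lemma trunc_proj_id: "z \<in> trunc_space n \<Longrightarrow> trunc_proj e n z = z"
  by (simp add: trunc_space_eq)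

lemma trunc_space_subspace: "subspace (trunc_space n)"
  unfolding trunc_space_def by (rule subspace_span)

lemma trunc_space_closed: "closed (trunc_space n)"
  unfolding trunc_space_eq
  by (rule closed_Collect_eq[OF linear_continuous_on[OF trunc_proj_bl] linear_continuous_on[OF bounded_linear_ident]])

lemma trunc_space_J: "symp_J ` trunc_space n \<subseteq> trunc_space n"
proof -
  have "symp_J (trunc_vec e n i) \<in> trunc_space n" if "i < 2 * n" for i
    using that by (auto simp: symp_J_trunc_vec intro!: trunc_vec_in subspace_neg[OF trunc_space_subspace])
  then have "span (symp_J ` trunc_vec e n ` {..<2 * n}) \<subseteq> trunc_space n"
    by (intro span_minimal trunc_space_subspace) auto
  then show ?thesis using linear_span_image[OF symp_J_lin] unfolding trunc_space_def by metis
qed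

lemma trunc_proj_symmetric: "inner (trunc_proj e n x) y = inner x (trunc_proj e n y)"
  unfolding trunc_proj_def inner_sum_left inner_sum_right
  by (intro sum.cong) (simp_all add: inner_commute)

text \<open>One definition for \<open>S\<close> and \<open>J\<close>, so that both matrix identities
  of a Williamson form translate into vectors in the same way.\<close>

definition trunc_mat :: "nat \<Rightarrow> ('h \<times> 'h \<Rightarrow> 'h \<times> 'h) \<Rightarrow> real mat" where
  "trunc_mat n L = Matrix.mat (2 * n) (2 * n) (\<lambda>(i, j). inner (trunc_vec e n i) (L (trunc_vec e n j)))"

lemma truncation_eq: "truncation e n S = trunc_mat n S"
  unfolding truncation_def trunc_mat_def
  by (rule cong_mat) (simp_all add: trunc_proj_symmetric[symmetric] trunc_proj_trunc_vec)

lemma symp_J_mat_eq: "symp_J_mat n = trunc_mat n symp_J"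
proof (rule eq_matI)
  fix i j assume "i < dim_row (trunc_mat n symp_J)" "j < dim_col (trunc_mat n symp_J)"
  then have ij: "i < 2 * n" "j < 2 * n" by (simp_all add: trunc_mat_def)
  have "inner (trunc_vec e n i) (symp_J (trunc_vec e n j)) =
      (if j < n then - (if i = j + n then 1 else 0) else (if i = j - n then 1 else 0))"
    using ij by (simp add: symp_J_trunc_vec inner_trunc_vec)
  then show "symp_J_mat n $$ (i, j) = trunc_mat n symp_J $$ (i, j)"
    using ij by (auto simp: trunc_mat_def symp_J_mat_def)
qed (simp_all add: trunc_mat_def symp_J_mat_def)

definition col_vec :: "nat \<Rightarrow> real mat \<Rightarrow> nat \<Rightarrow> 'h \<times> 'h" where
  "col_vec n M k = (\<Sum>i<2 * n. M $$ (i, k) *\<^sub>R trunc_vec e n i)"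

lemma col_vec_in: "col_vec n M k \<in> trunc_space n"
  unfolding col_vec_def trunc_space_def by (intro span_sum span_scale span_base) simp

text \<open>The dictionary between matrices and vectors: a congruence evaluates the bilinear form on
  the vectors whose coordinates are the columns of \<open>M\<close>.\<close>

lemma trunc_mat_congruence:
  assumes L: "linear L" and M: "M \<in> carrier_mat (2 * n) (2 * n)" and jk: "j < 2 * n" "k < 2 * n"
  shows "(transpose_mat M * trunc_mat n L * M) $$ (j, k) = inner (col_vec n M j) (L (col_vec n M k))"
proof -
  let ?t = "trunc_vec e n"
  have "(transpose_mat M * trunc_mat n L * M) $$ (j, k) =
      (\<Sum>l<2 * n. (\<Sum>i<2 * n. M $$ (i, j) * inner (?t i) (L (?t l))) * M $$ (l, k))"
    using M jk by (simp add: trunc_mat_def scalar_prod_def lessThan_atLeast0)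
  also have "\<dots> = (\<Sum>l<2 * n. inner (col_vec n M j) (L (?t l)) * M $$ (l, k))"
    by (simp add: col_vec_def inner_sum_left)
  also have "\<dots> = inner (col_vec n M j) (L (col_vec n M k))"
    by (simp add: col_vec_def[of n M k] linear_sum[OF L] linear_scale[OF L] inner_sum_right mult.commute)
  finally show ?thesis .
qed

lemma col_vec_coordinates:
  assumes "\<And>k. k < 2 * n \<Longrightarrow> v k \<in> trunc_space n"
    and "N = Matrix.mat (2 * n) (2 * n) (\<lambda>(i, k). inner (trunc_vec e n i) (v k))" and "k < 2 * n"
  shows "col_vec n N k = v k"
proof -
  have "col_vec n N k = trunc_proj e n (v k)"
    unfolding col_vec_def trunc_proj_def by (rule sum.cong) (use assms(2,3) in auto)
  then show ?thesis using trunc_proj_id[OF assms(1)[OF assms(3)]] by simp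
qed

lemma trunc_vec_in_span_columns:
  assumes M: "M \<in> carrier_mat (2 * n) (2 * n)" and N: "N \<in> carrier_mat (2 * n) (2 * n)" "N * M = 1\<^sub>m (2 * n)"
    and l: "l < 2 * n"
  shows "trunc_vec e n l \<in> span (col_vec n N ` {..<2 * n})"
proof -
  have "(\<Sum>k<2 * n. M $$ (k, l) *\<^sub>R col_vec n N k) =
      (\<Sum>i<2 * n. (\<Sum>k<2 * n. N $$ (i, k) * M $$ (k, l)) *\<^sub>R trunc_vec e n i)"
    unfolding col_vec_def scaleR_sum_right scaleR_sum_left
    by (subst sum.swap) (simp add: mult.commute)
  also have "\<dots> = (\<Sum>i<2 * n. if i = l then trunc_vec e n l else 0)"
  proof (rule sum.cong[OF refl])
    fix i assume i: "i \<in> {..<2 * n}"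
    have "(\<Sum>k<2 * n. N $$ (i, k) * M $$ (k, l)) = (N * M) $$ (i, l)"
      using M N(1) i l by (simp add: scalar_prod_def lessThan_atLeast0)
    then show "(\<Sum>k<2 * n. N $$ (i, k) * M $$ (k, l)) *\<^sub>R trunc_vec e n i = (if i = l then trunc_vec e n l else 0)"
      using N(2) i l by simp
  qed
  also have "\<dots> = trunc_vec e n l" using l by simp
  finally have "trunc_vec e n l = (\<Sum>k<2 * n. M $$ (k, l) *\<^sub>R col_vec n N k)" by simp
  also have "\<dots> \<in> span (col_vec n N ` {..<2 * n})" by (intro span_sum span_scale span_base) simp
  finally show ?thesis .
qed

end

section \<open>Block matrices and the Williamson form of a truncation\<close>

definition double_diag :: "real list \<Rightarrow> nat \<Rightarrow> real mat" where
  "double_diag ds n = four_block_mat (mat_diag n (\<lambda>i. ds ! i)) (0\<^sub>m n n) (0\<^sub>m n n) (mat_diag n (\<lambda>i. ds ! i))"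

lemma double_diag_carrier [simp]: "double_diag ds n \<in> carrier_mat (2 * n) (2 * n)"
  unfolding double_diag_def by (simp add: mat_diag_def mult_2)

lemma double_diag_index:
  assumes "i < n" "j < n"
  shows "double_diag ds n $$ (i, j) = (if i = j then ds ! i else 0)"
    "double_diag ds n $$ (n + i, n + j) = (if i = j then ds ! i else 0)"
    "double_diag ds n $$ (i, n + j) = 0" "double_diag ds n $$ (n + i, j) = 0"
  using assms by (simp_all add: double_diag_def mat_diag_def)

lemma symp_J_mat_carrier [simp]: "symp_J_mat n \<in> carrier_mat (2 * n) (2 * n)"
  unfolding symp_J_mat_def by (simp add: mult_2)

lemma symp_J_mat_index:
  assumes "i < n" "j < n"
  shows "symp_J_mat n $$ (i, j) = 0" "symp_J_mat n $$ (n + i, n + j) = 0"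
    "symp_J_mat n $$ (i, n + j) = (if i = j then 1 else 0)" "symp_J_mat n $$ (n + i, j) = (if i = j then - 1 else 0)"
  using assms by (simp_all add: symp_J_mat_def)

lemma double_index_cases:
  assumes "j < 2 * (n::nat)"
  obtains i where "i < n" "j = i" | i where "i < n" "j = n + i"
  using assms by (metis add_diff_inverse_nat less_diff_conv2 mult_2 not_less)

lemma double_index_split:
  fixes n j k :: nat
  assumes "\<And>i j. i < n \<Longrightarrow> j < n \<Longrightarrow> P i j \<and> P (n + i) (n + j) \<and> P i (n + j) \<and> P (n + i) j"
    and "j < 2 * n" "k < 2 * n"
  shows "P j k"
  by (rule double_index_cases[OF assms(2)]; rule double_index_cases[OF assms(3)]) (use assms(1) in blast)+

lemma symp_J_mat_square: "symp_J_mat n * symp_J_mat n = - 1\<^sub>m (2 * n)"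
proof (rule eq_matI)
  fix i j assume "i < dim_row (- 1\<^sub>m (2 * n) :: real mat)" "j < dim_col (- 1\<^sub>m (2 * n) :: real mat)"
  then have ij: "i < 2 * n" "j < 2 * n" by simp_all
  have "(symp_J_mat n * symp_J_mat n) $$ (i, j) = (\<Sum>k<2 * n. symp_J_mat n $$ (i, k) * symp_J_mat n $$ (k, j))"
    using ij carrier_matD[OF symp_J_mat_carrier[of n]] by (simp add: scalar_prod_def lessThan_atLeast0)
  also have "\<dots> = (\<Sum>k<2 * n. if k = (if i < n then i + n else i - n) then (if i = j then - 1 else 0) else 0)"
    by (rule sum.cong) (use ij in \<open>auto simp: symp_J_mat_def\<close>)
  also have "\<dots> = (if i = j then - 1 else 0)" using ij by (auto simp: less_imp_diff_less)
  finally show "(symp_J_mat n * symp_J_mat n) $$ (i, j) = (- 1\<^sub>m (2 * n)) $$ (i, j)" using ij by simp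
qed (use carrier_matD[OF symp_J_mat_carrier[of n]] in simp_all)

lemma congruence_inverse:
  fixes M N B :: "real mat"
  assumes "M \<in> carrier_mat m m" "N \<in> carrier_mat m m" "B \<in> carrier_mat m m" "M * N = 1\<^sub>m m"
  shows "transpose_mat N * (transpose_mat M * B * M) * N = B"
proof -
  have NM: "transpose_mat N * transpose_mat M = 1\<^sub>m m"
    using transpose_mult[OF assms(1,2)] assms(4) by simp
  have c: "transpose_mat N \<in> carrier_mat m m" "transpose_mat M \<in> carrier_mat m m" using assms by auto
  have "transpose_mat N * (transpose_mat M * B * M) * N = (transpose_mat N * transpose_mat M) * B * (M * N)"
    using assms(1-3) c by (simp add: assoc_mult_mat[of _ m m _ m _ m])
  then show ?thesis using assms(3,4) NM by simp
qed

locale truncated_form = gaussian_form S \<delta> symp_J Z + hilbert_sequence e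
  for S :: "'h::{real_inner, complete_space} \<times> 'h \<Rightarrow> 'h \<times> 'h" and \<delta> and Z and e :: "nat \<Rightarrow> 'h" +
  fixes n :: nat
  assumes Z_eq: "Z = trunc_space n"
begin

lemma truncation_carrier: "truncation e n S \<in> carrier_mat (2 * n) (2 * n)"
  by (simp add: truncation_eq trunc_mat_def)

lemma truncation_congruence:
  "N \<in> carrier_mat (2 * n) (2 * n) \<Longrightarrow> j < 2 * n \<Longrightarrow> k < 2 * n \<Longrightarrow>
    (transpose_mat N * truncation e n S * N) $$ (j, k) = form (col_vec n N j) (col_vec n N k)"
  unfolding truncation_eq form_def by (rule trunc_mat_congruence[OF S_lin])

lemma symp_J_mat_congruence:
  "N \<in> carrier_mat (2 * n) (2 * n) \<Longrightarrow> j < 2 * n \<Longrightarrow> k < 2 * n \<Longrightarrow>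
    (transpose_mat N * symp_J_mat n * N) $$ (j, k) = - inner (symp_J (col_vec n N j)) (col_vec n N k)"
  by (simp only: symp_J_mat_eq trunc_mat_congruence[OF symp_J_lin] symp_J_skew minus_minus)

text \<open>Gram values on spanning vectors determine, by linearity, the pairing identities against
  all of \<open>Z\<close>. The minus sign arises because the matrix of \<open>J\<close> has
  \<open>J\<close> on the second argument, the pairing on the first.\<close>

lemma gram_symplectic_system:
  assumes v: "\<And>k. k < 2 * n \<Longrightarrow> v k \<in> Z"
    and span: "Z \<subseteq> span (v ` {..<2 * n})"
    and S_gram: "\<And>j k. j < 2 * n \<Longrightarrow> k < 2 * n \<Longrightarrow> form (v j) (v k) = double_diag ds n $$ (j, k)"
    and J_gram: "\<And>j k. j < 2 * n \<Longrightarrow> k < 2 * n \<Longrightarrow> inner (symp_J (v j)) (v k) = - symp_J_mat n $$ (j, k)"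
    and ds: "\<And>i. i < n \<Longrightarrow> ds ! i > 0" and I: "I \<subseteq> {..<n}"
  shows "symplectic_system I v (\<lambda>i. v (n + i)) (\<lambda>i. ds ! i)"
  unfolding symplectic_system_def
proof (intro conjI ballI)
  fix i assume "i \<in> I"
  then have i: "i < n" using I by blast
  show "v i \<in> Z" "v (n + i) \<in> Z" "ds ! i > 0" using v ds i by auto
  {
    fix j assume j: "j < n"
    have "form (v i) (v j) = (if i = j then ds ! i else 0)" "form (v (n + i)) (v (n + j)) = (if i = j then ds ! i else 0)"
      "form (v i) (v (n + j)) = 0" "form (v (n + i)) (v j) = 0"
      using S_gram[of i j] S_gram[of "n + i" "n + j"] S_gram[of i "n + j"] S_gram[of "n + i" j]
        double_diag_index[OF i j] i j by simp_all
  } note sg = this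
  {
    fix j assume j: "j < n"
    have "inner (symp_J (v i)) (v j) = 0" "inner (symp_J (v (n + i))) (v (n + j)) = 0"
      "inner (symp_J (v i)) (v (n + j)) = - (if i = j then 1 else 0)" "inner (symp_J (v (n + i))) (v j) = (if i = j then 1 else 0)"
      using J_gram[of i j] J_gram[of "n + i" "n + j"] J_gram[of i "n + j"] J_gram[of "n + i" j]
        symp_J_mat_index[OF i j] i j by simp_all
  } note jg = this
  show "form (v i) (v j) = (if i = j then ds ! i else 0)" "form (v (n + i)) (v (n + j)) = (if i = j then ds ! i else 0)"
    "form (v i) (v (n + j)) = 0" if "j \<in> I" for j using sg(1-3)[of j] that I by auto
  have sub: "subspace {z. form (v i) z = ds ! i * inner (symp_J (v (n + i))) z}"
    "subspace {z. form (v (n + i)) z = - (ds ! i) * inner (symp_J (v i)) z}"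
    by (rule subspaceI; simp add: form_simps inner_add_right algebra_simps)+
  have "v k \<in> {z. form (v i) z = ds ! i * inner (symp_J (v (n + i))) z} \<and>
      v k \<in> {z. form (v (n + i)) z = - (ds ! i) * inner (symp_J (v i)) z}" if k: "k < 2 * n" for k
  proof (rule double_index_cases[OF k])
    fix j assume "j < n" "k = j"
    then show ?thesis using sg(1,4)[of j] jg(1,4)[of j] by simp
  next
    fix j assume "j < n" "k = n + j"
    then show ?thesis using sg(2,3)[of j] jg(2,3)[of j] by simp
  qed
  then have "span (v ` {..<2 * n}) \<subseteq> {z. form (v i) z = ds ! i * inner (symp_J (v (n + i))) z}"
    "span (v ` {..<2 * n}) \<subseteq> {z. form (v (n + i)) z = - (ds ! i) * inner (symp_J (v i)) z}"
    by (intro span_minimal sub; blast)+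
  then show "form (v i) z = ds ! i * inner (symp_J (v (n + i))) z" "form (v (n + i)) z = - (ds ! i) * inner (symp_J (v i)) z"
    if "z \<in> Z" for z using span that by blast+
qed

text \<open>The symplectic basis consists of the columns of \<open>N\<close>, the inverse of
  \<open>M\<close>: congruence by \<open>N\<close> diagonalises the truncation and preserves the
  matrix of \<open>J\<close>.\<close>

lemma williamson_mat_system:
  assumes "williamson_mat n (truncation e n S) ds"
  shows "\<exists>a b. (\<forall>I. I \<subseteq> {..<n} \<longrightarrow> symplectic_system I a b (\<lambda>i. ds ! i)) \<and>
    Z \<subseteq> span (a ` {..<n} \<union> b ` {..<n})"
proof -
  let ?A = "truncation e n S"
  obtain M where ds: "length ds = n" "\<forall>c\<in>set ds. 0 < c"
    and M: "symplectic_mat n M" "?A = transpose_mat M * double_diag ds n * M"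
    using assms unfolding williamson_mat_def double_diag_def by blast
  have Mc: "M \<in> carrier_mat (2 * n) (2 * n)" and inv: "invertible_mat M"
    and MJ: "transpose_mat M * symp_J_mat n * M = symp_J_mat n"
    using M(1) by (auto simp: symplectic_mat_def)
  obtain N where MN: "M * N = 1\<^sub>m (dim_row M)" "N * M = 1\<^sub>m (dim_row N)"
    using inv unfolding invertible_mat_def inverts_mat_def by blast
  have "dim_col (M * N) = 2 * n" "dim_col (N * M) = dim_row N" unfolding MN using Mc by auto
  then have Nc: "N \<in> carrier_mat (2 * n) (2 * n)" using Mc by (intro carrier_matI) auto
  have MN': "M * N = 1\<^sub>m (2 * n)" "N * M = 1\<^sub>m (2 * n)" using MN Mc Nc by auto
  define v where "v = col_vec n N"
  have "transpose_mat N * ?A * N = double_diag ds n"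
    unfolding M(2) by (rule congruence_inverse[OF Mc Nc double_diag_carrier MN'(1)])
  then have S_gram: "form (v j) (v k) = double_diag ds n $$ (j, k)" if "j < 2 * n" "k < 2 * n" for j k
    using truncation_congruence[OF Nc that] by (simp add: v_def)
  have "transpose_mat N * symp_J_mat n * N = symp_J_mat n"
    using congruence_inverse[OF Mc Nc symp_J_mat_carrier MN'(1)] unfolding MJ .
  then have J_gram: "inner (symp_J (v j)) (v k) = - symp_J_mat n $$ (j, k)" if "j < 2 * n" "k < 2 * n" for j k
    using symp_J_mat_congruence[OF Nc that] by (simp add: v_def)
  have span: "Z \<subseteq> span (v ` {..<2 * n})"
    unfolding Z_eq trunc_space_def v_def
    using trunc_vec_in_span_columns[OF Mc Nc MN'(2)] by (intro span_minimal subspace_span) auto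
  have vZ: "v k \<in> Z" for k unfolding v_def Z_eq by (rule col_vec_in)
  have "ds ! i > 0" if "i < n" for i using ds that by simp
  then have "symplectic_system I v (\<lambda>i. v (n + i)) (\<lambda>i. ds ! i)" if "I \<subseteq> {..<n}" for I
    using gram_symplectic_system[OF vZ span S_gram J_gram _ that] by blast
  moreover have "v ` {..<2 * n} \<subseteq> v ` {..<n} \<union> (\<lambda>i. v (n + i)) ` {..<n}"
  proof (rule image_subsetI)
    fix k assume "k \<in> {..<2 * n}"
    then have "k < 2 * n" by simp
    then show "v k \<in> v ` {..<n} \<union> (\<lambda>i. v (n + i)) ` {..<n}" by (rule double_index_cases) auto
  qed
  then have "Z \<subseteq> span (v ` {..<n} \<union> (\<lambda>i. v (n + i)) ` {..<n})" using span span_mono by blast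
  ultimately show ?thesis by blast
qed

lemma frame_finite:
  assumes fr: "symplectic_frame X b d C"
  shows "finite X"
proof -
  have "independent (id ` X)"
    by (rule form_orthogonal_independent(2)) (simp_all add: symplectic_frameD(5)[OF fr])
  moreover have "id ` X \<subseteq> span (trunc_vec e n ` {..<2 * n})"
    using symplectic_frameD(1)[OF fr] by (auto simp: Z_eq trunc_space_def)
  ultimately have "finite (id ` X)" using independent_span_bound[of "trunc_vec e n ` {..<2 * n}"] by blast
  then show ?thesis by simp
qed

text \<open>The rescaled frame and the truncated standard basis are both independent and both span
  \<open>Z\<close>, whence 2 m = 2 n.\<close>

lemma frame_card:
  assumes fr: "symplectic_frame X b d C" and g: "bij_betw g {..<m} X"
  shows "m = n"
proof -
  define a' where "a' i = sqrt (d (g i)) *\<^sub>R g i" for i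
  define b' where "b' i = sqrt (d (g i)) *\<^sub>R b (g i)" for i
  define T where "T = a' ` {..<m} \<union> b' ` {..<m}"
  have sys: "symplectic_system {..<m} a' b' (\<lambda>i. d (g i))"
    unfolding a'_def b'_def by (rule symplectic_frame_system[OF fr]) (use g in \<open>auto simp: bij_betw_def\<close>)
  have T: "finite T" "independent T" "card T = 2 * m"
    using symplectic_system_independent[OF sys] by (auto simp: T_def)
  have TZ: "T \<subseteq> Z" unfolding T_def using symplectic_systemD(1,2)[OF sys] by blast
  have "X \<union> b ` X \<subseteq> span T"
  proof -
    have "x \<in> span T \<and> b x \<in> span T" if x: "x \<in> X" for x
    proof -
      obtain i where i: "i < m" "x = g i" using g x by (auto simp: bij_betw_def)
      have "d x > 0" using symplectic_frameD(3)[OF fr x] by simp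
      then have "x = (1 / sqrt (d x)) *\<^sub>R a' i" "b x = (1 / sqrt (d x)) *\<^sub>R b' i"
        using i by (simp_all add: a'_def b'_def)
      moreover have "a' i \<in> span T" "b' i \<in> span T" using i by (auto simp: T_def intro!: span_base)
      ultimately show ?thesis by (metis span_scale)
    qed
    then show ?thesis by blast
  qed
  then have "span (X \<union> b ` X) \<subseteq> span T" by (rule span_minimal[OF _ subspace_span])
  then have ZT: "Z \<subseteq> span T" using symplectic_frame_finite_span[OF fr frame_finite[OF fr]] by blast
  have "card (trunc_vec e n ` {..<2 * n}) \<le> card T"
    using independent_span_bound[OF T(1) trunc_vec_independent(1)[of n]] ZT trunc_vec_in by (auto simp: Z_eq)
  moreover have "card T \<le> card (trunc_vec e n ` {..<2 * n})"
    using independent_span_bound[OF _ T(2), of "trunc_vec e n ` {..<2 * n}"] TZ by (simp add: Z_eq trunc_space_def)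
  ultimately show ?thesis using T(3) trunc_vec_independent(2)[of n] by simp
qed

text \<open>A frame of the truncated space supplies the columns of \<open>N\<close>; sorting it by
  decreasing \<open>d\<close> beforehand makes the list non-increasing.\<close>

lemma williamson_mat_exists: "\<exists>ds. williamson_mat n (truncation e n S) ds \<and> sorted_wrt (\<ge>) ds"
proof -
  let ?A = "truncation e n S"
  obtain X b d C where fr: "symplectic_frame X b d C" using symplectic_frame_exists by blast
  obtain l where l: "set l = X" "distinct l" using finite_distinct_list[OF frame_finite[OF fr]] by blast
  define xs where "xs = sort_key (\<lambda>x. - d x) l"
  have xs: "set xs = X" "distinct xs" "sorted (map (\<lambda>x. - d x) xs)" using l by (simp_all add: xs_def)
  have bij: "bij_betw ((!) xs) {..<length xs} X" using bij_betw_nth[OF xs(2) refl xs(1)[symmetric]] .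
  have len: "length xs = n" by (rule frame_card[OF fr bij])
  define ds where "ds = map d xs"
  have dsi: "ds ! i = d (xs ! i)" if "i < n" for i using that len by (simp add: ds_def)
  have sorted: "sorted_wrt (\<ge>) ds" using xs(3) by (simp add: ds_def sorted_wrt_map)

  have pos: "\<forall>c\<in>set ds. 0 < c"
  proof
    fix c assume "c \<in> set ds"
    then obtain x where "x \<in> X" "c = d x" using xs(1) by (auto simp: ds_def)
    then show "0 < c" using symplectic_frameD(3)[OF fr, of x] by simp
  qed
  define a where "a i = sqrt (d (xs ! i)) *\<^sub>R (xs ! i)" for i
  define b' where "b' i = sqrt (d (xs ! i)) *\<^sub>R b (xs ! i)" for i
  have sys: "symplectic_system {..<n} a b' (\<lambda>i. d (xs ! i))"
    unfolding a_def b'_def by (rule symplectic_frame_system[OF fr]) (use bij len in \<open>auto simp: bij_betw_def\<close>)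
  define v where "v k = (if k < n then a k else b' (k - n))" for k
  have vZ: "v k \<in> Z" if "k < 2 * n" for k
    using symplectic_systemD(1,2)[OF sys] that by (simp add: v_def)
  define N where "N = Matrix.mat (2 * n) (2 * n) (\<lambda>(i, k). inner (trunc_vec e n i) (v k))"
  have Nc: "N \<in> carrier_mat (2 * n) (2 * n)" by (simp add: N_def)
  have col: "col_vec n N k = v k" if "k < 2 * n" for k
    by (rule col_vec_coordinates[OF _ N_def that]) (use vZ in \<open>simp add: Z_eq\<close>)
  have NA: "transpose_mat N * ?A * N = double_diag ds n"
  proof (rule eq_matI)
    fix j k assume "j < dim_row (double_diag ds n)" "k < dim_col (double_diag ds n)"
    then have jk: "j < 2 * n" "k < 2 * n" using carrier_matD[OF double_diag_carrier[of ds n]] by simp_all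
    have "form (v j) (v k) = double_diag ds n $$ (j, k)"
    proof (rule double_index_split[OF _ jk])
      fix i j assume ij: "i < n" "j < n"
      then have "i \<in> {..<n}" "j \<in> {..<n}" by simp_all
      note sg = symplectic_systemD(4-7)[OF sys this]
      show "form (v i) (v j) = double_diag ds n $$ (i, j) \<and> form (v (n + i)) (v (n + j)) = double_diag ds n $$ (n + i, n + j) \<and>
          form (v i) (v (n + j)) = double_diag ds n $$ (i, n + j) \<and> form (v (n + i)) (v j) = double_diag ds n $$ (n + i, j)"
        using ij by (simp add: v_def sg double_diag_index[OF ij] dsi)
    qed
    then show "(transpose_mat N * ?A * N) $$ (j, k) = double_diag ds n $$ (j, k)"
      using truncation_congruence[OF Nc jk] col jk by simp
  qed (use Nc carrier_matD[OF double_diag_carrier[of ds n]] in simp_all)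
  have NJ: "transpose_mat N * symp_J_mat n * N = symp_J_mat n"
  proof (rule eq_matI)
    fix j k assume "j < dim_row (symp_J_mat n)" "k < dim_col (symp_J_mat n)"
    then have jk: "j < 2 * n" "k < 2 * n" using carrier_matD[OF symp_J_mat_carrier[of n]] by simp_all
    have "inner (symp_J (v j)) (v k) = - symp_J_mat n $$ (j, k)"
    proof (rule double_index_split[OF _ jk])
      fix i j assume ij: "i < n" "j < n"
      then have ij': "i \<in> {..<n}" "j \<in> {..<n}" by simp_all
      note sg = symplectic_systemD(4-7)[OF sys ij']
      have d: "d (xs ! i) \<noteq> 0" using symplectic_systemD(3)[OF sys ij'(1)] by simp
      have J: "inner (symp_J (b' i)) z = form (a i) z / d (xs ! i)" "inner (symp_J (a i)) z = - form (b' i) z / d (xs ! i)"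
        if "z \<in> Z" for z
        using symplectic_systemD(8,9)[OF sys ij'(1) that] d by simp_all
      have abZ: "a j \<in> Z" "b' j \<in> Z" by (rule symplectic_systemD(1,2)[OF sys ij'(2)])+
      have J_ab: "inner (symp_J (a i)) (a j) = 0" "inner (symp_J (b' i)) (b' j) = 0"
        "inner (symp_J (a i)) (b' j) = - (if i = j then 1 else 0)" "inner (symp_J (b' i)) (a j) = (if i = j then 1 else 0)"
        unfolding J[OF abZ(1)] J[OF abZ(2)] sg using d by (cases "i = j"; simp)+
      show "inner (symp_J (v i)) (v j) = - symp_J_mat n $$ (i, j) \<and>
          inner (symp_J (v (n + i))) (v (n + j)) = - symp_J_mat n $$ (n + i, n + j) \<and>
          inner (symp_J (v i)) (v (n + j)) = - symp_J_mat n $$ (i, n + j) \<and>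
          inner (symp_J (v (n + i))) (v j) = - symp_J_mat n $$ (n + i, j)"
        unfolding symp_J_mat_index[OF ij] using ij J_ab by (simp add: v_def)
    qed
    then show "(transpose_mat N * symp_J_mat n * N) $$ (j, k) = symp_J_mat n $$ (j, k)"
      using symp_J_mat_congruence[OF Nc jk] col jk by simp
  qed (use Nc carrier_matD[OF symp_J_mat_carrier[of n]] in simp_all)
  \<comment> \<open>For symplectic \<open>N\<close> the matrix - J N^T J is a left inverse; for
    square matrices it is then a right inverse as well.\<close>
  define M where "M = - (symp_J_mat n * (transpose_mat N * symp_J_mat n))"
  note Jc = symp_J_mat_carrier[of n]
  have NTc: "transpose_mat N \<in> carrier_mat (2 * n) (2 * n)" using Nc by simp
  have Mc: "M \<in> carrier_mat (2 * n) (2 * n)"     unfolding M_def using mult_carrier_mat[OF Jc mult_carrier_mat[OF NTc Jc]] by simp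
  have MN: "M * N = 1\<^sub>m (2 * n)"
  proof -
    have "M * N = - (symp_J_mat n * (transpose_mat N * symp_J_mat n) * N)"
      unfolding M_def using carrier_matD[OF Jc] carrier_matD[OF Nc] by (subst uminus_mult_left_mat) simp_all
    also have "symp_J_mat n * (transpose_mat N * symp_J_mat n) * N = symp_J_mat n * (transpose_mat N * symp_J_mat n * N)"
      by (rule assoc_mult_mat[OF Jc mult_carrier_mat[OF NTc Jc] Nc])
    finally show ?thesis unfolding NJ symp_J_mat_square by (intro eq_matI) simp_all
  qed
  have NM: "N * M = 1\<^sub>m (2 * n)" by (rule mat_mult_left_right_inverse[OF Mc Nc MN])
  have "symplectic_mat n M"
    unfolding symplectic_mat_def
  proof (intro conjI Mc)
    show "invertible_mat M" unfolding invertible_mat_def inverts_mat_def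
      using Mc Nc MN NM by auto
    show "transpose_mat M * symp_J_mat n * M = symp_J_mat n"
      using congruence_inverse[OF Nc Mc Jc NM] unfolding NJ .
  qed
  moreover have "?A = transpose_mat M * double_diag ds n * M"
    using congruence_inverse[OF Nc Mc truncation_carrier NM] unfolding NA by simp
  ultimately have "williamson_mat n ?A ds"
    unfolding williamson_mat_def using pos len by (auto simp: ds_def double_diag_def)
  with sorted show ?thesis by blast
qed

text \<open>The min-max principle on a truncated space, where a full symplectic basis exists. The
  chosen list enters through its defining property, which determines the k-th entry as the largest
  admissible \<open>c\<close>.\<close>

lemma symplectic_eigenvalue_mat:
  assumes k: "1 \<le> k" "k \<le> n"
  defines "c \<equiv> symplectic_eigenvalue_mat n (truncation e n S) k"
  shows "c > 0" "symp_lower S symp_J Z k c" "symp_lower S symp_J Z k c' \<Longrightarrow> c' \<le> c"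
proof -
  define ds where "ds = symplectic_eigenvalues_mat n (truncation e n S)"
  have "williamson_mat n (truncation e n S) ds \<and> sorted_wrt (\<ge>) ds"
    unfolding ds_def symplectic_eigenvalues_mat_def by (rule someI_ex[OF williamson_mat_exists])
  then have ds: "williamson_mat n (truncation e n S) ds" "sorted_wrt (\<ge>) ds" by simp_all
  have len: "length ds = n" and pos: "\<And>c. c \<in> set ds \<Longrightarrow> 0 < c" using ds(1) by (auto simp: williamson_mat_def)
  have c: "c = ds ! (k - 1)" by (simp add: c_def symplectic_eigenvalue_mat_def ds_def)
  have anti: "ds ! j \<le> ds ! i" if "i \<le> j" "j < n" for i j
    using sorted_wrt_nth_less[OF ds(2), of i j] that len by (cases "i = j") auto
  obtain a b where sys: "\<And>I. I \<subseteq> {..<n} \<Longrightarrow> symplectic_system I a b (\<lambda>i. ds ! i)"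
    and span: "Z \<subseteq> span (a ` {..<n} \<union> b ` {..<n})"
    using williamson_mat_system[OF ds(1)] by blast
  show c0: "c > 0" unfolding c using pos len k by simp
  have kn: "{..<k} \<subseteq> {..<n}" using k by auto
  show "symp_lower S symp_J Z k c"
    by (rule symp_lower_system[OF sys[OF kn]]) (use c0 k anti in \<open>auto simp: c\<close>)
  show "c' \<le> c" if "symp_lower S symp_J Z k c'"
    unfolding c by (rule symp_lower_system_le[OF sys[OF order_refl] span anti k that])
qed

end


section \<open>Convergence\<close>

text \<open>Gram-Schmidt, one vector at a time; \<open>w = 0\<close> means that the new vector adds
  nothing to the span.\<close>

lemma finite_orthonormal_span:
  fixes V :: "'a::real_inner set"
  assumes "finite V"
  shows "\<exists>U. finite U \<and> pairwise orthogonal U \<and> (\<forall>u\<in>U. norm u = 1) \<and> span U = span V"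
  using assms
proof induction
  case empty
  show ?case by (intro exI[of _ "{}"]) simp
next
  case (insert v V)
  then obtain U where U: "finite U" "pairwise orthogonal U" "\<forall>u\<in>U. norm u = 1" "span U = span V" by blast
  define p where "p = (\<Sum>u\<in>U. inner u v *\<^sub>R u)"
  define w where "w = v - p"
  have p: "p \<in> span U" unfolding p_def by (intro span_sum span_scale span_base)
  show ?case
  proof (cases "w = 0")
    case True
    then have "v \<in> span V" using p U(4) by (simp add: w_def)
    then have "span (insert v V) = span V" by (rule span_redundant)
    then show ?thesis using U by auto
  next
    case False
    have uw: "inner u w = 0" if u: "u \<in> U" for u
    proof -
      have "inner u p = (\<Sum>u'\<in>U. if u' = u then inner u v else 0)"
        unfolding p_def inner_sum_right
      proof (rule sum.cong[OF refl])
        fix u' assume u': "u' \<in> U"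
        have "inner u u = 1" using U(3) u by (simp add: norm_eq_1)
        then show "inner u (inner u' v *\<^sub>R u') = (if u' = u then inner u v else 0)"
          using U(2) u u' by (auto simp: pairwise_def Linear_Algebra.orthogonal_def)
      qed
      then show ?thesis using U(1) u by (simp add: w_def inner_diff_right)
    qed
    define r where "r = (1 / norm w) *\<^sub>R w"
    have "pairwise orthogonal (insert r U)"
      unfolding pairwise_insert
      using U(2) uw by (auto simp: Linear_Algebra.orthogonal_def r_def inner_commute)
    moreover have "\<forall>u\<in>insert r U. norm u = 1" using U(3) False by (simp add: r_def)
    moreover have "span (insert r U) = span (insert v V)"
    proof (subst span_eq, intro conjI insert_subsetI)
      have sub: "span U \<subseteq> span (insert v V)" using U(4) span_mono[of V "insert v V"] by blast
      have "w \<in> span (insert v V)" unfolding w_def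
        by (rule span_diff) (use p sub in \<open>auto intro: span_base\<close>)
      then show "r \<in> span (insert v V)" unfolding r_def by (rule span_scale)
      show "U \<subseteq> span (insert v V)" using sub span_superset[of U] by blast
      have sub2: "span U \<subseteq> span (insert r U)" by (rule span_mono) blast
      have "v = norm w *\<^sub>R r + p" using False by (simp add: r_def w_def)
      also have "\<dots> \<in> span (insert r U)"
        by (intro span_add span_scale) (use p sub2 in \<open>auto intro: span_base\<close>)
      finally show "v \<in> span (insert r U)" .
      show "V \<subseteq> span (insert r U)" using sub2 U(4) span_superset[of V] by blast
    qed
    ultimately show ?thesis using U(1) by (intro exI[of _ "insert r U"]) simp
  qed
qed

section \<open>Convergence of the truncating projections\<close>

context hilbert_sequence
begin

lemma norm_trunc_proj_le: "norm (trunc_proj e n z) \<le> norm z"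
proof (cases "trunc_proj e n z = 0")
  case False
  have "(norm (trunc_proj e n z))\<^sup>2 = inner z (trunc_proj e n z)"
    by (simp add: power2_norm_eq_inner trunc_proj_symmetric trunc_proj_id[OF trunc_proj_in])
  also have "\<dots> \<le> norm z * norm (trunc_proj e n z)" by (rule norm_cauchy_schwarz)
  finally show ?thesis using False by (simp add: power2_eq_square)
qed simp

lemma norm_trunc_proj_diff_le: "norm (z - trunc_proj e n z) \<le> 2 * norm z"
  using norm_trunc_proj_le[of n z] norm_triangle_ineq4[of z "trunc_proj e n z"] by simp

text \<open>The vectors on which convergence holds form a subspace that contains the basis and is
  closed because the projections are contractions.\<close>

lemma trunc_proj_tendsto: "(\<lambda>n. trunc_proj e n z) \<longlonglongrightarrow> z"
proof -
  define W where "W = {z. (\<lambda>n. trunc_proj e n z) \<longlonglongrightarrow> z}"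
  have sub: "subspace W"
    unfolding W_def
    by (rule subspaceI)
      (simp_all add: linear_0[OF trunc_proj_lin] linear_add[OF trunc_proj_lin] linear_scale[OF trunc_proj_lin]
        tendsto_add tendsto_scaleR)
  have basis: "(e i, 0) \<in> W" "(0, e i) \<in> W" for i
  proof -
    have "\<forall>\<^sub>F n in sequentially. trunc_proj e n (e i, 0) = (e i, 0)"
      using eventually_gt_at_top[of i]
    proof eventually_elim
      case (elim n)
      then show ?case using trunc_proj_trunc_vec[of i n] by (simp add: trunc_vec_def)
    qed
    then show "(e i, 0) \<in> W" unfolding W_def by (simp add: tendsto_eventually)
    have "\<forall>\<^sub>F n in sequentially. trunc_proj e n (0, e i) = (0, e i)"
      using eventually_gt_at_top[of i]
    proof eventually_elim
      case (elim n)
      then show ?case using trunc_proj_trunc_vec[of "n + i" n] by (simp add: trunc_vec_def)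
    qed
    then show "(0, e i) \<in> W" unfolding W_def by (simp add: tendsto_eventually)
  qed
  have "closed W"
    unfolding closed_sequential_limits
  proof (intro allI impI, elim conjE)
    fix x l assume x: "\<forall>n. x n \<in> W" and l: "x \<longlonglongrightarrow> l"
    show "l \<in> W"
      unfolding W_def mem_Collect_eq
    proof (rule LIMSEQ_I)
      fix r :: real assume r: "r > 0"
      obtain m where m: "norm (x m - l) < r / 3" using LIMSEQ_D[OF l, of "r / 3"] r by auto
      have "(\<lambda>n. trunc_proj e n (x m)) \<longlonglongrightarrow> x m" using x by (simp add: W_def)
      from LIMSEQ_D[OF this, of "r / 3"] r
      obtain M where M: "\<And>n. n \<ge> M \<Longrightarrow> norm (trunc_proj e n (x m) - x m) < r / 3" by auto
      have "norm (trunc_proj e n l - l) < r" if "n \<ge> M" for n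
      proof -
        have "trunc_proj e n l - l = trunc_proj e n (l - x m) + (trunc_proj e n (x m) - x m) + (x m - l)"
          by (simp add: linear_diff[OF trunc_proj_lin])
        then have "norm (trunc_proj e n l - l) \<le>
            norm (trunc_proj e n (l - x m)) + norm (trunc_proj e n (x m) - x m) + norm (x m - l)"
          by (metis norm_triangle_ineq norm_triangle_mono order_refl)
        then show ?thesis
          using norm_trunc_proj_le[of n "l - x m"] M[OF that] m norm_minus_commute[of l "x m"] by simp
      qed
      then show "\<exists>no. \<forall>n\<ge>no. norm (trunc_proj e n l - l) < r" by blast
    qed
  qed
  have "W = UNIV"
  proof (rule ccontr)
    assume "W \<noteq> UNIV"
    then obtain v where v: "v \<noteq> 0" "\<forall>w\<in>W. inner v w = 0"
      using orthogonal_complement_nontrivial[OF sub \<open>closed W\<close>] by blast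
    have "inner v v = 0"
      using eq_on_pair_basis[of "inner v" "\<lambda>_. 0" v] v(2) basis
      by (simp add: bounded_linear_inner_right bounded_linear_zero)
    then show False using v(1) by simp
  qed
  then show ?thesis unfolding W_def by blast
qed

lemma trunc_proj_uniform_on_span:
  assumes V: "finite V" and eps: "\<epsilon> > 0"
  shows "\<forall>\<^sub>F n in sequentially. \<forall>x\<in>span V. norm (x - trunc_proj e n x) \<le> \<epsilon> * norm x"
proof -
  obtain U where U: "finite U" "pairwise orthogonal U" "\<forall>u\<in>U. norm u = 1" "span U = span V"
    using finite_orthonormal_span[OF V] by blast
  have "(\<lambda>n. \<Sum>u\<in>U. norm (u - trunc_proj e n u)) \<longlonglongrightarrow> (\<Sum>u\<in>U. norm (u - u))"
    by (intro tendsto_sum tendsto_norm tendsto_diff tendsto_const trunc_proj_tendsto)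
  then have "\<forall>\<^sub>F n in sequentially. (\<Sum>u\<in>U. norm (u - trunc_proj e n u)) < \<epsilon>"
    using eps by (intro order_tendstoD(2)) auto
  then show ?thesis
  proof eventually_elim
    case (elim n)
    show ?case
    proof
      fix x assume "x \<in> span V"
      then have x: "x = (\<Sum>u\<in>U. inner u x *\<^sub>R u)" using orthonormal_expansion[OF U(1-3)] U(4) by simp
      have "x - trunc_proj e n x = (\<Sum>u\<in>U. inner u x *\<^sub>R (u - trunc_proj e n u))"
        by (subst (1 2) x) (simp add: linear_sum[OF trunc_proj_lin] linear_scale[OF trunc_proj_lin]
            scaleR_diff_right sum_subtractf)
      then have "norm (x - trunc_proj e n x) \<le> (\<Sum>u\<in>U. norm (inner u x *\<^sub>R (u - trunc_proj e n u)))"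
        by (simp only: norm_sum)
      also have "\<dots> \<le> (\<Sum>u\<in>U. norm x * norm (u - trunc_proj e n u))"
      proof (rule sum_mono)
        fix u assume "u \<in> U"
        then have "\<bar>inner u x\<bar> \<le> norm x" using U(3) Cauchy_Schwarz_ineq2[of u x] by simp
        then show "norm (inner u x *\<^sub>R (u - trunc_proj e n u)) \<le> norm x * norm (u - trunc_proj e n u)"
          by (simp add: mult_right_mono)
      qed
      also have "\<dots> \<le> norm x * \<epsilon>" using elim by (simp add: sum_distrib_left[symmetric] mult_left_mono)
      finally show "norm (x - trunc_proj e n x) \<le> \<epsilon> * norm x" by (simp add: mult.commute)
    qed
  qed
qed

text \<open>Symmetry moves the complementary projection onto the finitely many functionals of
  \<open>compact_on\<close>, where strong convergence suffices; z then enters through its norm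
  only.\<close>

lemma compact_on_trunc_proj_uniform:
  assumes A: "compact_on UNIV A" and eps: "\<epsilon> > 0"
  shows "\<forall>\<^sub>F n in sequentially. \<forall>z. norm (A (z - trunc_proj e n z)) \<le> \<epsilon> * norm z"
proof -
  \<comment> \<open>\<epsilon> / 4 because z - P z has norm at most 2 |z|; the functionals take the
    other \<epsilon> / 2.\<close>
  obtain fs where fs: "\<And>x. norm (A x) \<le> \<epsilon> / 4 * norm x + (\<Sum>f\<leftarrow>fs. \<bar>inner f x\<bar>)"
    using compact_onD[OF A, of "\<epsilon> / 4"] eps by auto
  have "(\<lambda>n. \<Sum>f\<leftarrow>fs. norm (f - trunc_proj e n f)) \<longlonglongrightarrow> 0"
  proof (induction fs)
    case (Cons f fs)
    have "(\<lambda>n. norm (f - trunc_proj e n f)) \<longlonglongrightarrow> norm (f - f)"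
      by (intro tendsto_norm tendsto_diff tendsto_const trunc_proj_tendsto)
    from tendsto_add[OF this Cons.IH] show ?case by simp
  qed simp
  then have "\<forall>\<^sub>F n in sequentially. (\<Sum>f\<leftarrow>fs. norm (f - trunc_proj e n f)) < \<epsilon> / 2"
    using eps by (intro order_tendstoD(2)) auto
  then show ?thesis
  proof eventually_elim
    case (elim n)
    show ?case
    proof
      fix z
      have "(\<Sum>f\<leftarrow>fs. \<bar>inner f (z - trunc_proj e n z)\<bar>) \<le> (\<Sum>f\<leftarrow>fs. norm (f - trunc_proj e n f) * norm z)"
      proof (rule sum_list_mono)
        fix f
        have "inner f (z - trunc_proj e n z) = inner (f - trunc_proj e n f) z"
          by (simp add: inner_diff_left inner_diff_right trunc_proj_symmetric)
        then show "\<bar>inner f (z - trunc_proj e n z)\<bar> \<le> norm (f - trunc_proj e n f) * norm z"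
          using Cauchy_Schwarz_ineq2[of "f - trunc_proj e n f" z] by simp
      qed
      also have "\<dots> \<le> \<epsilon> / 2 * norm z"
        unfolding sum_list_mult_const using elim by (intro mult_right_mono) auto
      finally have "norm (A (z - trunc_proj e n z)) \<le> \<epsilon> / 4 * norm (z - trunc_proj e n z) + \<epsilon> / 2 * norm z"
        using fs[of "z - trunc_proj e n z"] by linarith
      moreover have "\<epsilon> / 4 * norm (z - trunc_proj e n z) \<le> \<epsilon> / 4 * (2 * norm z)"
        using eps norm_trunc_proj_diff_le by (intro mult_left_mono) auto
      ultimately show "norm (A (z - trunc_proj e n z)) \<le> \<epsilon> * norm z" by simp
    qed
  qed
qed

end

section \<open>Transfer of the min-max condition between the space and its truncations\<close>

context williamson_existence
begin

text \<open>\<open>V\<close> is replaced by its image under the projection. Pairings with z in the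
  truncated space are unchanged, since J z stays there, and \<open>q\<close> loses at most the
  factor 1 - \<eta>, uniformly on the span.\<close>

lemma symp_lower_truncate:
  assumes low: "symp_lower S symp_J UNIV k c" and eta: "0 < \<eta>" "\<eta> < 1"
  shows "\<forall>\<^sub>F n in sequentially. symp_lower S symp_J (trunc_space n) k ((1 - \<eta>) * c)"
proof -
  obtain V where V: "finite V" "independent V" "card V = 2 * k"
    and bound: "\<And>x z. x \<in> span V \<Longrightarrow> (c * inner (symp_J x) z)\<^sup>2 \<le> q x * q z"
    using low unfolding symp_lower_def form_def by blast
  obtain C where C: "C > 0" "\<And>x y. \<bar>form x y\<bar> \<le> C * norm x * norm y" using form_bounded by blast
  \<comment> \<open>1 / 2 keeps the projection injective on the span of \<open>V\<close>; the second
    bound makes the loss 2 C \<epsilon> |x|^2 at most \<eta> q x, by coercivity.\<close>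
  define \<epsilon> where "\<epsilon> = min (1 / 2) (\<eta> * \<delta> / (2 * C))"
  have eps: "\<epsilon> > 0" "\<epsilon> < 1" "2 * C * \<epsilon> \<le> \<eta> * \<delta>"
    using eta C(1) delta_pos by (auto simp: \<epsilon>_def min_def field_simps)
  show ?thesis
    using trunc_proj_uniform_on_span[OF V(1) eps(1)]
  proof eventually_elim
    case (elim n)
    let ?P = "trunc_proj e n"
    have inj: "inj_on ?P (span V)"
    proof (rule inj_onI)
      fix x y assume xy: "x \<in> span V" "y \<in> span V" "?P x = ?P y"
      have "norm (x - y) \<le> \<epsilon> * norm (x - y)"
        using elim span_diff[OF xy(1,2)] xy(3) by (force simp: linear_diff[OF trunc_proj_lin])
      then have "norm (x - y) = 0" using eps(2) by (smt (verit) mult_le_cancel_right1 norm_ge_zero)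
      then show "x = y" by simp
    qed
    show ?case
      unfolding symp_lower_def
    proof (intro exI[of _ "?P ` V"] conjI ballI)
      show "finite (?P ` V)" using V(1) by simp
      show "independent (?P ` V)"
        by (rule linear_independent_injective_image[OF trunc_proj_lin V(2) inj])
      show "card (?P ` V) = 2 * k"
        using card_image[OF inj_on_subset[OF inj span_superset]] V(3) by simp
      show "?P ` V \<subseteq> trunc_space n" using trunc_proj_in by blast
      fix x' z assume x': "x' \<in> span (?P ` V)" and z: "z \<in> trunc_space n"
      obtain x where x: "x \<in> span V" "x' = ?P x"
        using x' linear_span_image[OF trunc_proj_lin, of n V] by blast
      have Jz: "symp_J z \<in> trunc_space n" using trunc_space_J z by blast
      have "inner (symp_J x') z = - inner x (?P (symp_J z))"
        by (simp only: x(2) symp_J_skew trunc_proj_symmetric)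
      then have J: "inner (symp_J x') z = inner (symp_J x) z"
        by (simp only: trunc_proj_id[OF Jz] symp_J_skew)
      have "q x - q x' = form (x - x') x + form x' (x - x')"
        by (simp add: form_simps form_sym[of x' x])
      also have "\<dots> \<le> C * norm (x - x') * norm x + C * norm x' * norm (x - x')"
        using C(2)[of "x - x'" x] C(2)[of x' "x - x'"] by linarith
      also have "\<dots> \<le> C * (\<epsilon> * norm x) * norm x + C * norm x * (\<epsilon> * norm x)"
        using elim x C(1) norm_trunc_proj_le[of n x] eps(1)
        by (intro add_mono mult_mono mult_nonneg_nonneg) auto
      also have "\<dots> = 2 * C * \<epsilon> * (norm x)\<^sup>2" by (simp add: power2_eq_square)
      also have "\<dots> \<le> \<eta> * \<delta> * (norm x)\<^sup>2" using eps(3) by (intro mult_right_mono) auto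
      also have "\<dots> \<le> \<eta> * q x" using form_coercive[of x] eta(1) by (simp add: mult.assoc)
      finally have qx: "(1 - \<eta>) * q x \<le> q x'" by (simp add: left_diff_distrib)
      have "((1 - \<eta>) * c * inner (symp_J x') z)\<^sup>2 = (1 - \<eta>)\<^sup>2 * (c * inner (symp_J x) z)\<^sup>2"
        by (simp add: J power_mult_distrib)
      also have "\<dots> \<le> (1 - \<eta>)\<^sup>2 * (q x * q z)" by (intro mult_left_mono bound x(1)) simp
      \<comment> \<open>One factor 1 - \<eta> is given away, so that no square root appears in the
        new constant.\<close>
      also have "\<dots> \<le> (1 - \<eta>) * (q x * q z)"
        using eta q_nonneg by (intro mult_right_mono) (auto simp: power2_eq_square mult_left_le)
      also have "\<dots> = ((1 - \<eta>) * q x) * q z" by simp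
      also have "\<dots> \<le> q x' * q z" by (intro mult_right_mono qx q_nonneg)
      finally show "((1 - \<eta>) * c * inner (symp_J x') z)\<^sup>2 \<le> inner x' (S x') * inner z (S z)"
        by (simp add: form_def)
    qed
  qed
qed

text \<open>In q z = |z|^2 + inner z ((S - I) z) the first term cannot grow under a projection, and
  the second changes little, uniformly in z, by compactness. Coercivity turns the error into a
  multiple of q z.\<close>

lemma q_trunc_proj_le:
  assumes eta: "\<eta> > 0"
  shows "\<forall>\<^sub>F n in sequentially. \<forall>z. q (trunc_proj e n z) \<le> (1 + \<eta>) * q z"
proof -
  \<comment> \<open>The expansion below costs 4 |z| |A y|: twice |z| |A y| from the mixed term and
    twice from inner y (A y), as |y| \<le> 2 |z|.\<close>
  have "\<eta> * \<delta> / 4 > 0" using eta delta_pos by simp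
  from compact_on_trunc_proj_uniform[OF compact this] show ?thesis
  proof eventually_elim
    case (elim n)
    show ?case
    proof
      fix z
      let ?P = "trunc_proj e n"
      define y where "y = z - ?P z"
      define A where "A x = S x - x" for x
      have A_sym: "inner (A x) w = inner x (A w)" for x w
        by (simp add: A_def inner_diff_left inner_diff_right S_sym)
      have A_diff: "A (x - w) = A x - A w" for x w by (simp add: A_def linear_diff[OF S_lin])
      have q: "q x = inner x x + inner x (A x)" for x by (simp add: form_def A_def inner_diff_right)
      have Ay: "norm (A y) \<le> \<eta> * \<delta> / 4 * norm z" using spec[OF elim, of z] by (simp add: A_def y_def)
      have Pz: "?P z = z - y" by (simp add: y_def)
      have "inner (?P z) (?P z) \<le> inner z z"
        using power_mono[OF norm_trunc_proj_le[of n z], of 2] by (simp add: power2_norm_eq_inner)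
      moreover have "inner (?P z) (A (?P z)) = inner z (A z) - 2 * inner z (A y) + inner y (A y)"
        unfolding Pz A_diff using A_sym[of y z] by (simp add: inner_diff_left inner_diff_right inner_commute)
      moreover have "- inner z (A y) \<le> norm z * norm (A y)" using Cauchy_Schwarz_ineq2[of z "A y"] by linarith
      moreover have "inner y (A y) \<le> 2 * norm z * norm (A y)"
        using norm_cauchy_schwarz[of y "A y"] mult_right_mono[OF norm_trunc_proj_diff_le[of z n], of "norm (A y)"]
        by (simp add: y_def)
      ultimately have "q (?P z) \<le> q z + 4 * (norm z * norm (A y))" unfolding q by linarith
      also have "\<dots> \<le> q z + 4 * (norm z * (\<eta> * \<delta> / 4 * norm z))"
        using Ay by (intro add_left_mono mult_left_mono) auto
      also have "\<dots> = q z + \<eta> * (\<delta> * (norm z)\<^sup>2)" by (simp add: power2_eq_square)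
      also have "\<dots> \<le> q z + \<eta> * q z" using form_coercive[of z] eta by (intro add_left_mono mult_left_mono) auto
      finally show "q (?P z) \<le> (1 + \<eta>) * q z" by (simp add: distrib_right)
    qed
  qed
qed

text \<open>The same \<open>V\<close> works, because for x in the truncated space z and its
  projection have the same pairing. The quantifier over c stands inside the eventuality: c will be
  the eigenvalue of the truncation, which varies with n.\<close>

lemma symp_lower_untruncate:
  assumes eta: "\<eta> > 0"
  shows "\<forall>\<^sub>F n in sequentially. \<forall>c. symp_lower S symp_J (trunc_space n) k c \<longrightarrow> symp_lower S symp_J UNIV k (c / (1 + \<eta>))"
  using q_trunc_proj_le[OF eta]
proof eventually_elim
  case (elim n)
  let ?P = "trunc_proj e n"
  show ?case
  proof (intro allI impI)
    fix c assume "symp_lower S symp_J (trunc_space n) k c"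
    then obtain V where V: "finite V" "independent V" "card V = 2 * k" "V \<subseteq> trunc_space n"
      and bound: "\<And>x z. x \<in> span V \<Longrightarrow> z \<in> trunc_space n \<Longrightarrow> (c * inner (symp_J x) z)\<^sup>2 \<le> q x * q z"
      unfolding symp_lower_def form_def by blast
    have "(c / (1 + \<eta>) * inner (symp_J x) z)\<^sup>2 \<le> inner x (S x) * inner z (S z)" if x: "x \<in> span V" for x z
    proof -
      have "x \<in> trunc_space n" using span_minimal[OF V(4) trunc_space_subspace] x by blast
      then have "symp_J x \<in> trunc_space n" using trunc_space_J by blast
      then have "inner (symp_J x) z = inner (symp_J x) (?P z)"
        by (metis trunc_proj_id trunc_proj_symmetric)
      then have "(c * inner (symp_J x) z)\<^sup>2 \<le> q x * q (?P z)" using bound[OF x trunc_proj_in] by simp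
      also have "\<dots> \<le> q x * ((1 + \<eta>) * q z)" using spec[OF elim, of z] by (intro mult_left_mono q_nonneg)
      also have "\<dots> \<le> (1 + \<eta>)\<^sup>2 * (q x * q z)"
      proof -
        have "(1 + \<eta>) * (q x * q z) \<le> (1 + \<eta>)\<^sup>2 * (q x * q z)"
          using eta q_nonneg by (intro mult_right_mono) (auto simp: power2_eq_square)
        then show ?thesis by (simp add: ac_simps)
      qed
      finally have "(c * inner (symp_J x) z)\<^sup>2 / (1 + \<eta>)\<^sup>2 \<le> q x * q z"
        using eta by (simp add: divide_le_eq mult.commute)
      then show ?thesis by (simp add: form_def power_divide)
    qed
    then show "symp_lower S symp_J UNIV k (c / (1 + \<eta>))"
      unfolding symp_lower_def using V(1-3) by blast
  qed
qed

lemma symp_lower_one_UNIV: "symp_lower S symp_J UNIV k 1"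
  by (rule symp_lower_one[OF _ trunc_vec_independent]) simp_all

end

theorem theorem14:
  fixes e :: "nat \<Rightarrow> 'h::{real_inner, complete_space}"
    and S :: "'h \<times> 'h \<Rightarrow> 'h \<times> 'h"
  assumes "inj e" and "orthonormal_basis (range e)"
    and "gaussian_covariance_op S"
  shows "\<forall>k\<ge>1. (\<lambda>n. symplectic_eigenvalue_mat n (truncation e n S) k)
           \<longlonglongrightarrow> (if symplectic_count S = \<infinity> \<or> enat k \<le> symplectic_count S
                then symplectic_eigenvalue S k else 1)"
proof (intro allI impI)
  fix k :: nat assume k: "1 \<le> k"
  interpret hilbert_sequence e
  proof
    show "closure (span (range e)) = UNIV" using assms(2) by (simp add: orthonormal_basis_def)
    show "inner (e i) (e j) = (if i = j then 1 else 0)" for i j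
      using assms(1,2)
      by (auto simp: orthonormal_basis_def pairwise_def Linear_Algebra.orthogonal_def norm_eq_1 inj_eq)
  qed
  obtain \<delta> where form: "\<And>Z. subspace Z \<Longrightarrow> closed Z \<Longrightarrow> symp_J ` Z \<subseteq> Z \<Longrightarrow> gaussian_form S \<delta> symp_J Z"
    using gaussian_covariance_form[OF assms(3)] by metis
  interpret gaussian_form S \<delta> symp_J UNIV by (rule form) (auto simp: subspace_UNIV)
  interpret williamson_existence S \<delta> e by (rule williamson_existence.intro) unfold_locales
  obtain R d where Rd: "symplectic_data S = (R, d)" by fastforce
  \<comment> \<open>Existence makes the choice in \<open>symplectic_data\<close> meaningful; the
    selected pair then comes with a Williamson operator of its own.\<close>
  have "\<exists>p. (case p of (R, d) \<Rightarrow> \<exists>D. williamson_op S D \<and> eigenvalues_above_1 D R d)"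
  proof -
    obtain D where D: "williamson_op S D" using williamson_op_exists by blast
    interpret williamson_form S \<delta> D
      by (intro williamson_form.intro williamson_form_axioms.intro D) unfold_locales
    interpret D: compact_perturbation D by (rule D_compact_perturbation)
    show ?thesis using D D.eigenvalues_above_1_exists by auto
  qed
  from someI_ex[OF this] obtain D where D: "williamson_op S D" "eigenvalues_above_1 D R d"
    using Rd unfolding symplectic_data_def by auto
  interpret williamson_form S \<delta> D
    by (intro williamson_form.intro williamson_form_axioms.intro D) unfold_locales
  define t where "t = (if enat k \<le> R then d k else 1)"
  \<comment> \<open>An infinite count satisfies \<open>enat k \<le> R\<close> anyway, so the two
    alternatives of the condition merge.\<close>
  have t_eq: "(if symplectic_count S = \<infinity> \<or> enat k \<le> symplectic_count S then symplectic_eigenvalue S k else 1) = t"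
    using Rd by (auto simp: t_def symplectic_count_def symplectic_eigenvalue_def)
  have "d k > 1" if "enat k \<le> R" using D(2) k that unfolding eigenvalues_above_1_def by blast
  then have t: "t > 0" by (auto simp: t_def)
  have low: "symp_lower S symp_J UNIV k t"
    using symp_lower_eigenvalue[OF D(2) k] symp_lower_one_UNIV by (simp add: t_def)
  have up: "c \<le> t" if "symp_lower S symp_J UNIV k c" for c
    using symp_lower_imp_le[OF D(2) k that] by (simp add: t_def)
  define c where "c n = symplectic_eigenvalue_mat n (truncation e n S) k" for n
  \<comment> \<open>A truncation has n symplectic eigenvalues, so its k-th one is under control only
    from n = k on.\<close>
  have mat: "c n > 0" "symp_lower S symp_J (trunc_space n) k (c n)"
    "symp_lower S symp_J (trunc_space n) k c' \<Longrightarrow> c' \<le> c n" if "n \<ge> k" for n c'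
  proof -
    interpret T: truncated_form S \<delta> "trunc_space n" e n
      by (intro truncated_form.intro truncated_form_axioms.intro form trunc_space_subspace trunc_space_closed
          trunc_space_J refl) unfold_locales
    show "c n > 0" "symp_lower S symp_J (trunc_space n) k (c n)"
      "symp_lower S symp_J (trunc_space n) k c' \<Longrightarrow> c' \<le> c n"
      unfolding c_def by (rule T.symplectic_eigenvalue_mat[OF k that]; assumption)+
  qed
  have "c \<longlonglongrightarrow> t"
  proof (rule tendstoI)
    fix r :: real assume r: "r > 0"
    \<comment> \<open>The two transfers confine \<open>c n\<close> to an interval of radius \<eta> t
      around t, which has to be below r; the cap 1 / 2 ensures \<eta> < 1.\<close>
    define \<eta> where "\<eta> = min (1 / 2) (r / (2 * t))"
    have eta: "0 < \<eta>" "\<eta> < 1" "\<eta> * t < r"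
      using r t by (auto simp: \<eta>_def min_def field_simps)
    show "\<forall>\<^sub>F n in sequentially. dist (c n) t < r"
      using symp_lower_truncate[OF low eta(1,2)] symp_lower_untruncate[OF eta(1), of k] eventually_ge_at_top[of k]
    proof eventually_elim
      case (elim n)
      have "(1 - \<eta>) * t \<le> c n" using mat(3)[OF elim(3,1)] .
      moreover have "c n / (1 + \<eta>) \<le> t" using elim(2) mat(2)[OF elim(3)] up by blast
      then have "c n \<le> (1 + \<eta>) * t" using eta(1) by (simp add: divide_le_eq mult.commute)
      ultimately have "\<bar>c n - t\<bar> \<le> \<eta> * t" by (simp add: algebra_simps abs_le_iff)
      then show ?case using eta(3) by (simp add: dist_real_def)
    qed
  qed
  then show "(\<lambda>n. symplectic_eigenvalue_mat n (truncation e n S) k)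
      \<longlonglongrightarrow> (if symplectic_count S = \<infinity> \<or> enat k \<le> symplectic_count S then symplectic_eigenvalue S k else 1)"
    unfolding t_eq c_def[abs_def] .
qed

end
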